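(* Consider a run of the IDDP algorithm (described in the context) and the sequences of vectors $x_t^k$ and functions $\mathcal{Q}_t^k$ it generates. Let Assumptions (H1) and (H2) (stated in the context) hold. (i) Assume that the noises are bounded: for $t=1,\ldots,T$ we have $0\le \varepsilon_t^k\le \bar\varepsilon_t<+\infty$ for all $k\ge 1$. Define $\mathrm{Err}_1=\bar\varepsilon_1$ and, for $t=2,\ldots,T$, $\mathrm{Err}_t=\bar\eta_t+\bar\varepsilon_t$ if $X_t$ is of type S1 and $\mathrm{Err}_t=\bar\eta_t+2\bar\varepsilon_t$ if $X_t$ is of type S2, where $\bar\eta_t$ is the upper bound on $(\eta_t^k(\varepsilon_t^k))_{k\ge1}$ given in the context. Then there exists an infinite set of iterations $K$ such that for $t=1,\ldots,T$ the sequence $(x_t^k)_{k\in K}$ converges to some $x_t^*\in\mathcal{X}_t$ and, for $t=2,\ldots,T$, the sequence $(\mathcal{Q}_t^k(x_{t-1}^k))_{k\in K}$ converges with its limit satisfying $$\mathcal{Q}_t(x_{t-1}^* )-\sum_{\tau=t}^T \mathrm{Err}_\tau\ \le\ \lim_{k\to+\infty,\,k\in K}\mathcal{Q}_t^k(x_{t-1}^k)\ \le\ \mathcal{Q}_t(x_{t-1}^* ).$$ Moreover, $$\mathcal{Q}_1(x_0)-\sum_{\tau=2}^T\mathrm{Err}_\tau\ \le\ \lim_{k\to+\infty,\,k\in K}F_1^{k-1}(x_1^k,x_0)\ \le\ \mathcal{Q}_1(x_0)+\mathrm{Err}_1,$$ and $(x_1^*,\ldots,x_T^* )$ is a $\big(\sum_{\tau=1}^T\tau\,\mathrm{Err}_\tau\big)$-optimal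 solution of problem (P) of the context (i.e. it is feasible and its objective value is at most $\mathcal{Q}_1(x_0)+\sum_{\tau=1}^T\tau\,\mathrm{Err}_\tau$). (ii) If $\lim_{k\to+\infty}\varepsilon_t^k=0$ for $t=1,\ldots,T$, then for $t=2,\ldots,T+1$, $$\lim_{k\to+\infty}\ \mathcal{Q}_t(x_{t-1}^k)-\mathcal{Q}_t^k(x_{t-1}^k)=0,$$ $\lim_{k\to+\infty}F_1^{k-1}(x_1^k,x_0)=\mathcal{Q}_1(x_0)$, and any accumulation point of the sequence $(x_1^k,\ldots,x_T^k)_{k\ge1}$ is an optimal solution of (P).
   Context: **Notation.** $\mathbb{B}_n(x_0,r)$ is the closed Euclidean ball; $\mathrm{ri}$ is relative interior; $\mathrm{Aff}$ is affine span; $X^{\varepsilon}=X+\varepsilon\mathbb{B}_n(0,1)$; $\mathrm{Diam}(X)=\max_{x,y\in X}\|x-y\|$; $\mathcal{C}^1(\mathcal{X})$ is the set of real-valued continuously differentiable functions on $\mathcal{X}$. **Problem.** Given $x_0\in\mathbb{R}^n$, consider $$(P)\qquad \inf_{x_1,\ldots,x_T}\ \sum_{t=1}^T f_t(x_t,x_{t-1}),\qquad x_t\in X_t(x_{t-1}),\ t=1,\ldots,T,$$ with dynamic programming equations $\mathcal{Q}_{T+1}\equiv0$ and, for $t=1,\ldots,T$, $\mathcal{Q}_t(x_{t-1})=\inf\{F_t(x_t,x_{t-1}):=f_t(x_t,x_{t-1})+\mathcal{Q}_{t+1}(x_t)\,:\,x_t\in X_t(x_{t-1})\}$; $\mathcal{Q}_1(x_0)$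 is the optimal value of (P). For each $t$, $X_t$ is of one of two types (the type may depend on $t$): type S1: $X_t(x_{t-1})=\mathcal{X}_t\subset\mathbb{R}^n$; type S2: $X_t(x_{t-1})=\{x_t\in\mathcal{X}_t: g_t(x_t,x_{t-1})\le0,\ A_tx_t+B_tx_{t-1}=b_t\}$, where $g_t$ has $p$ components $g_{ti}$ and $A_t,B_t$ have $q$ rows. Set $\mathcal{X}_0=\{x_0\}$. **Assumption (H1).** For $t=1,\ldots,T$: (a) $\mathcal{X}_t$ is nonempty, convex, compact; (b) $f_t$ is convex on $\mathcal{X}_t\times\mathcal{X}_{t-1}$ and belongs to $\mathcal{C}^1(\mathcal{X}_t\times\mathcal{X}_{t-1})$. There is $\varepsilon>0$ such that for every $t$ with $X_t$ of type S2: (c) each $g_{ti}$ is convex on $\mathcal{X}_t\times\mathcal{X}_{t-1}^{\varepsilon}$ and belongs to $\mathcal{C}^1(\mathcal{X}_t\times\mathcal{X}_{t-1})$; (d) for every $x_{t-1}\in\mathcal{X}_{t-1}^{\varepsilon}$ the set $X_t(x_{t-1})\cap\mathrm{ri}(\mathcal{X}_t)$ is nonempty; (e) if $t\ge2$ there is $(\bar x_{tt},\bar x_{t\,t-1})\in\mathrm{ri}(\mathcal{X}_t)\times\mathcal{X}_{t-1}$ with $A_t\bar x_{tt}+B_t\bar x_{t\,t-1}=b_t$ and $g_t(\bar x_{tt},\bar x_{t\,t-1})<0$. **Assumption (H2).** For $t=2,\ldots,T$ (with $X_t$ of type S2) there are $\kappa_t>0,r_t>0$ such that for every $x_{t-1}\in\mathcal{X}_{t-1}$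 there is $x_t\in\mathcal{X}_t$ with $\mathbb{B}_n(x_t,r_t)\cap\mathrm{Aff}(\mathcal{X}_t)\subseteq\mathcal{X}_t$, $A_tx_t+B_tx_{t-1}=b_t$, and $g_{ti}(x_t,x_{t-1})\le-\kappa_t$ for $i=1,\ldots,p$. **IDDP algorithm.** Let $\varepsilon_t^k\ge0$ be given noises. Put $\mathcal{Q}_t^0\equiv-\infty$ for $t=2,\ldots,T$ and $\mathcal{Q}_{T+1}^k\equiv0$ for all $k\ge 0$. Let $F_t^k(y,x)=f_t(y,x)+\mathcal{Q}_{t+1}^k(y)$ and $\underline{\mathcal{Q}}_t^k(x)=\inf\{F_t^k(y,x):y\in X_t(x)\}$. An $\varepsilon$-optimal solution is a feasible point whose objective value is within $\varepsilon$ of the optimal value (when the objective is identically $-\infty$, any feasible point). Iteration $k\ge1$: *Forward pass*: $x_0^k=x_0$; for $t=1,\ldots,T$, $x_t^k$ is an $\varepsilon_t^k$-optimal solution of $\inf\{F_t^{k-1}(y,x_{t-1}^k):y\in X_t(x_{t-1}^k)\}$. *Backward pass*: for $t=T,\ldots,2$, let $x_t^{Bk}$ be an $\varepsilon_t^k$-optimal solution of $\inf\{F_t^k(y,x_{t-1}^k):y\in X_t(x_{t-1}^k)\}$. If $X_t$ is of type S1: $\theta_t^k=f_t(x_t^{Bk},x_{t-1}^k)+\mathcal{Q}_{t+1}^k(x_t^{Bk})$, $\beta_t^k=\nabla_{x_{t-1}}f_t(x_t^{Bk},x_{t-1}^k)$, and $$\eta_t^k(\varepsilon_t^k)=\max_{x_t\in\mathcal{X}_t}\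 \langle\nabla_{x_t}f_t(x_t^{Bk},x_{t-1}^k),x_t^{Bk}-x_t\rangle+\mathcal{Q}_{t+1}^k(x_t^{Bk})-\mathcal{Q}_{t+1}^k(x_t).$$ If $X_t$ is of type S2: let $(\lambda_t^k,\mu_t^k)$ be an $\varepsilon_t^k$-optimal solution of the dual problem of maximizing $h(\lambda,\mu)=\inf_{y\in\mathcal{X}_t}\{F_t^k(y,x_{t-1}^k)+\lambda^T(A_ty+B_tx_{t-1}^k-b_t)+\mu^Tg_t(y,x_{t-1}^k)\}$ over $\mu\in\mathbb{R}_+^p$ and $\lambda\in\{A_ty+B_tx_{t-1}^k-b_t:y\in\mathrm{Aff}(\mathcal{X}_t)\}$; then $\theta_t^k=f_t(x_t^{Bk},x_{t-1}^k)+\mathcal{Q}_{t+1}^k(x_t^{Bk})+\langle\mu_t^k,g_t(x_t^{Bk},x_{t-1}^k)\rangle$, $\beta_t^k=\nabla_{x_{t-1}}f_t(x_t^{Bk},x_{t-1}^k)+B_t^T\lambda_t^k+\sum_{i=1}^p\mu_t^k(i)\nabla_{x_{t-1}}g_{ti}(x_t^{Bk},x_{t-1}^k)$, and $$\eta_t^k(\varepsilon_t^k)=\max_{x_t\in\mathcal{X}_t}\Big\langle\nabla_{x_t}f_t(x_t^{Bk},x_{t-1}^k)+A_t^T\lambda_t^k+\sum_{i=1}^p\mu_t^k(i)\nabla_{x_t}g_{ti}(x_t^{Bk},x_{t-1}^k),\,x_t^{Bk}-x_t\Big\rangle+\mathcal{Q}_{t+1}^k(x_t^{Bk})-\mathcal{Q}_{t+1}^k(x_t).$$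 In both cases define the cut $\mathcal{C}_t^k(x_{t-1})=\theta_t^k-\eta_t^k(\varepsilon_t^k)+\langle\beta_t^k,x_{t-1}-x_{t-1}^k\rangle$ and $\mathcal{Q}_t^k=\max_{1\le j\le k}\mathcal{C}_t^j$. **The constants $\bar\eta_t$.** Let $M_{t2},M_{t3}$ be finite constants with $\|\nabla f_t\|\le M_{t2}$ and $\|\nabla g_{ti}\|\le M_{t3}$ ($i=1,\ldots,p$) on $\mathcal{X}_t\times\mathcal{X}_{t-1}$, $L(f_t)$ a Lipschitz constant of $f_t$ on $\mathcal{X}_t\times\mathcal{X}_{t-1}$, and $L(\mathcal{Q}_{t+1})$ a Lipschitz constant of $\mathcal{Q}_{t+1}$ on $\mathcal{X}_t$. Put $L_{T+1}=0$. For $t=T,\ldots,2$: if $X_t$ is of type S1, $\bar\eta_t=(M_{t2}+L_{t+1})\,\mathrm{Diam}(\mathcal{X}_t)$ and $L_t=M_{t2}$. If $X_t$ is of type S2, with $V_{\mathcal{X}_t}=\{x-y:x,y\in\mathrm{Aff}(\mathcal{X}_t)\}$, with $r_t$ decreased if necessary so that $r_t\le\kappa_t/(2L(g_t))$ where $L(g_t)>0$ is a common Lipschitz constant of the $g_{ti}$ on $\mathcal{X}_t\times\mathcal{X}_{t-1}$, and with $\rho_t>0$ such that $\mathbb{B}_q(0,\rho_t)\cap A_tV_{\mathcal{X}_t}\subseteq A_t(\mathbb{B}_n(0,r_t)\cap V_{\mathcal{X}_t})$, let $$U_t=\frac{(L(f_t)+L(\mathcal{Q}_{t+1}))r_t+\bar\varepsilon_t+\max_{x_t\in\mathcal{X}_t,x_{t-1}\in\mathcal{X}_{t-1}}(f_t(x_t,x_{t-1})+\mathcal{Q}_{t+1}(x_t))-\min_{x_{t-1}\in\mathcal{X}_{t-1}}\underline{\mathcal{Q}}_t^1(x_{t-1})}{\min(\rho_t,\kappa_t/2)},$$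 $\bar\eta_t=\big(M_{t2}+\sqrt2\max(\|A_t^T\|,M_{t3}\sqrt p)\,U_t+L_{t+1}\big)\mathrm{Diam}(\mathcal{X}_t)$ and $L_t=M_{t2}+\sqrt2\max(\|B_t^T\|,M_{t3}\sqrt p)\,U_t$. *)

theory Defs
  imports "HOL-Analysis.Analysis"
begin

section \<open>Optimality up to a tolerance\<close>

text \<open>Objectives are extended real: where the objective is identically \<open>-\<infinity>\<close> on \<open>S\<close>, every
  point of \<open>S\<close> is \<open>e\<close>-optimal.\<close>

definition eps_argmin :: "real \<Rightarrow> ('a \<Rightarrow> ereal) \<Rightarrow> 'a set \<Rightarrow> 'a set" where
  "eps_argmin e F S = {y \<in> S. F y \<le> (INF z\<in>S. F z) + ereal e}"

definition eps_argmax :: "real \<Rightarrow> ('a \<Rightarrow> ereal) \<Rightarrow> 'a set \<Rightarrow> 'a set" where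
  "eps_argmax e F S = {y \<in> S. (SUP z\<in>S. F z) \<le> F y + ereal e}"

section \<open>The problem\<close>

text \<open>Pairs are ordered \<open>(x\<^sub>t, x\<^sub>t\<^sub>-\<^sub>1)\<close>. Accordingly the first component of a gradient is the partial
  gradient in \<open>x\<^sub>t\<close> and the second one that in \<open>x\<^sub>t\<^sub>-\<^sub>1\<close>.

  The gradients are part of the data because the sets on which the functions are differentiable
  may have empty interior, where a gradient relative to the set is not unique; any choice
  satisfying \<open>C1_on\<close> below is allowed, in particular the ordinary gradient of a function that is
  continuously differentiable on a neighbourhood.\<close>

record ('n::finite, 'p::finite, 'q::finite) dp_problem =
  horizon :: nat
  init :: "real^'n"
  dom_set :: "nat \<Rightarrow> (real^'n) set"
  cost :: "nat \<Rightarrow> (real^'n) \<times> (real^'n) \<Rightarrow> real"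
  cost_grad :: "nat \<Rightarrow> (real^'n) \<times> (real^'n) \<Rightarrow> (real^'n) \<times> (real^'n)"
  typeS2 :: "nat \<Rightarrow> bool"
  ineq :: "nat \<Rightarrow> (real^'n) \<times> (real^'n) \<Rightarrow> real^'p"
  ineq_grad :: "nat \<Rightarrow> 'p \<Rightarrow> (real^'n) \<times> (real^'n) \<Rightarrow> (real^'n) \<times> (real^'n)"
  matA :: "nat \<Rightarrow> real^'n^'q"
  matB :: "nat \<Rightarrow> real^'n^'q"
  rhs :: "nat \<Rightarrow> real^'q"

definition state_set :: "('n::finite,'p::finite,'q::finite) dp_problem \<Rightarrow> nat \<Rightarrow> (real^'n) set" where
  "state_set P t = (if t = 0 then {init P} else dom_set P t)"

definition pair_set ::
    "('n::finite,'p::finite,'q::finite) dp_problem \<Rightarrow> nat \<Rightarrow> ((real^'n) \<times> (real^'n)) set" where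
  "pair_set P t = state_set P t \<times> state_set P (t - 1)"

definition eq_res ::
    "('n::finite,'p::finite,'q::finite) dp_problem \<Rightarrow> nat \<Rightarrow> real^'n \<Rightarrow> real^'n \<Rightarrow> real^'q" where
  "eq_res P t y x = matA P t *v y + matB P t *v x - rhs P t"

definition feas ::
    "('n::finite,'p::finite,'q::finite) dp_problem \<Rightarrow> nat \<Rightarrow> real^'n \<Rightarrow> (real^'n) set" where
  "feas P t x =
     (if typeS2 P t
      then {y \<in> state_set P t. (\<forall>i. ineq P t (y, x) $ i \<le> 0) \<and> eq_res P t y x = 0}
      else state_set P t)"

text \<open>The value functions \<open>\<Q>\<^sub>t\<close>.\<close>

function value_fun ::
    "('n::finite,'p::finite,'q::finite) dp_problem \<Rightarrow> nat \<Rightarrow> real^'n \<Rightarrow> ereal" where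
  "value_fun P t x =
     (if horizon P < t then 0
      else INF y\<in>feas P t x. ereal (cost P t (y, x)) + value_fun P (Suc t) y)"
  by auto
termination
  by (relation "Wellfounded.measure (\<lambda>(P, t, x). Suc (horizon P) - t)") auto

declare value_fun.simps [simp del]

text \<open>The problem over whole trajectories; only the entries \<open>0, \<dots>, horizon P\<close> of a trajectory
  matter.\<close>

definition feasible_paths ::
    "('n::finite,'p::finite,'q::finite) dp_problem \<Rightarrow> (nat \<Rightarrow> real^'n) set" where
  "feasible_paths P =
     {xs. xs 0 = init P \<and> (\<forall>t\<in>{1..horizon P}. xs t \<in> feas P t (xs (t - 1)))}"

definition total_cost ::
    "('n::finite,'p::finite,'q::finite) dp_problem \<Rightarrow> (nat \<Rightarrow> real^'n) \<Rightarrow> real" where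
  "total_cost P xs = (\<Sum>t=1..horizon P. cost P t (xs t, xs (t - 1)))"

definition eps_solutions ::
    "('n::finite,'p::finite,'q::finite) dp_problem \<Rightarrow> real \<Rightarrow> (nat \<Rightarrow> real^'n) set" where
  "eps_solutions P e = eps_argmin e (\<lambda>xs. ereal (total_cost P xs)) (feasible_paths P)"

section \<open>Assumptions (H1) and (H2)\<close>

definition C1_on :: "'a::real_inner set \<Rightarrow> ('a \<Rightarrow> real) \<Rightarrow> ('a \<Rightarrow> 'a) \<Rightarrow> bool" where
  "C1_on S f G \<longleftrightarrow>
     (\<forall>z\<in>S. (f has_derivative (\<lambda>h. G z \<bullet> h)) (at z within S)) \<and> continuous_on S G"

definition fatten :: "'a::metric_space set \<Rightarrow> real \<Rightarrow> 'a set" where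
  "fatten S e = (\<Union>x\<in>S. cball x e)"

definition H1 :: "('n::finite,'p::finite,'q::finite) dp_problem \<Rightarrow> bool" where
  "H1 P \<longleftrightarrow>
     (\<forall>t\<in>{1..horizon P}.
        state_set P t \<noteq> {} \<and> convex (state_set P t) \<and> compact (state_set P t) \<and>
        convex_on (pair_set P t) (cost P t) \<and>
        C1_on (pair_set P t) (cost P t) (cost_grad P t)) \<and>
     (\<exists>e>0. \<forall>t\<in>{1..horizon P}. typeS2 P t \<longrightarrow>
        (\<forall>i. convex_on (state_set P t \<times> fatten (state_set P (t - 1)) e) (\<lambda>z. ineq P t z $ i) \<and>
             C1_on (pair_set P t) (\<lambda>z. ineq P t z $ i) (ineq_grad P t i)) \<and>
        (\<forall>x\<in>fatten (state_set P (t - 1)) e. feas P t x \<inter> rel_interior (state_set P t) \<noteq> {}) \<and>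
        (2 \<le> t \<longrightarrow>
           (\<exists>y\<in>rel_interior (state_set P t). \<exists>x\<in>state_set P (t - 1).
              eq_res P t y x = 0 \<and> (\<forall>i. ineq P t (y, x) $ i < 0))))"

definition H2_at ::
    "('n::finite,'p::finite,'q::finite) dp_problem \<Rightarrow> nat \<Rightarrow> real \<Rightarrow> real \<Rightarrow> bool" where
  "H2_at P t \<kappa> r \<longleftrightarrow>
     (\<forall>x\<in>state_set P (t - 1). \<exists>y\<in>state_set P t.
        cball y r \<inter> affine hull (state_set P t) \<subseteq> state_set P t \<and>
        eq_res P t y x = 0 \<and> (\<forall>i. ineq P t (y, x) $ i \<le> - \<kappa>))"

definition H2 :: "('n::finite,'p::finite,'q::finite) dp_problem \<Rightarrow> bool" where
  "H2 P \<longleftrightarrow> (\<forall>t\<in>{2..horizon P}. typeS2 P t \<longrightarrow> (\<exists>\<kappa>>0. \<exists>r>0. H2_at P t \<kappa> r))"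

section \<open>The IDDP algorithm\<close>

text \<open>Everything is indexed by the stage \<open>t\<close> first and the iteration \<open>k \<ge> 1\<close> second:
  \<open>fwd R t k\<close> is \<open>x\<^sub>t\<^sup>k\<close> and \<open>bwd R t k\<close> is \<open>x\<^sub>t\<^sup>B\<^sup>k\<close>; \<open>dual_eq\<close> and \<open>dual_ineq\<close> are the multipliers
  \<open>\<lambda>\<close> and \<open>\<mu>\<close>.\<close>

record ('n::finite, 'p::finite, 'q::finite) iddp_run =
  fwd :: "nat \<Rightarrow> nat \<Rightarrow> real^'n"
  bwd :: "nat \<Rightarrow> nat \<Rightarrow> real^'n"
  dual_eq :: "nat \<Rightarrow> nat \<Rightarrow> real^'q"
  dual_ineq :: "nat \<Rightarrow> nat \<Rightarrow> real^'p"
  theta :: "nat \<Rightarrow> nat \<Rightarrow> real"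
  eta :: "nat \<Rightarrow> nat \<Rightarrow> real"
  beta :: "nat \<Rightarrow> nat \<Rightarrow> real^'n"

definition cut ::
    "('n::finite,'p::finite,'q::finite) iddp_run \<Rightarrow> nat \<Rightarrow> nat \<Rightarrow> real^'n \<Rightarrow> real" where
  "cut R t k x = theta R t k - eta R t k + beta R t k \<bullet> (x - fwd R (t - 1) k)"

text \<open>\<open>\<Q>\<^sub>t\<^sup>k\<close>, \<open>F\<^sub>t\<^sup>k\<close> and the infimum of \<open>F\<^sub>t\<^sup>k\<close> over the feasible set.\<close>

definition Qapp ::
    "('n::finite,'p::finite,'q::finite) dp_problem \<Rightarrow> ('n,'p,'q) iddp_run \<Rightarrow>
     nat \<Rightarrow> nat \<Rightarrow> real^'n \<Rightarrow> ereal" where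
  "Qapp P R t k x =
     (if horizon P < t then 0
      else if k = 0 then - \<infinity>
      else ereal (MAX j\<in>{1..k}. cut R t j x))"

definition Fapp ::
    "('n::finite,'p::finite,'q::finite) dp_problem \<Rightarrow> ('n,'p,'q) iddp_run \<Rightarrow>
     nat \<Rightarrow> nat \<Rightarrow> real^'n \<Rightarrow> real^'n \<Rightarrow> ereal" where
  "Fapp P R t k y x = ereal (cost P t (y, x)) + Qapp P R (Suc t) k y"

definition Qlow ::
    "('n::finite,'p::finite,'q::finite) dp_problem \<Rightarrow> ('n,'p,'q) iddp_run \<Rightarrow>
     nat \<Rightarrow> nat \<Rightarrow> real^'n \<Rightarrow> ereal" where
  "Qlow P R t k x = (INF y\<in>feas P t x. Fapp P R t k y x)"

definition dual_fun ::
    "('n::finite,'p::finite,'q::finite) dp_problem \<Rightarrow> ('n,'p,'q) iddp_run \<Rightarrow>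
     nat \<Rightarrow> nat \<Rightarrow> real^'n \<Rightarrow> (real^'q) \<times> (real^'p) \<Rightarrow> ereal" where
  "dual_fun P R t k x = (\<lambda>(l, m).
     INF y\<in>state_set P t. Fapp P R t k y x + ereal (l \<bullet> eq_res P t y x + m \<bullet> ineq P t (y, x)))"

definition dual_dom ::
    "('n::finite,'p::finite,'q::finite) dp_problem \<Rightarrow> nat \<Rightarrow> real^'n \<Rightarrow> ((real^'q) \<times> (real^'p)) set" where
  "dual_dom P t x = ((\<lambda>y. eq_res P t y x) ` (affine hull (state_set P t))) \<times> {m. \<forall>i. 0 \<le> m $ i}"

text \<open>\<open>\<eta>\<close> as a function of the gradient \<open>d\<close>, in the variable \<open>x\<^sub>t\<close>, of the smooth part of the
  Lagrangian at \<open>x\<^sub>t\<^sup>B\<^sup>k\<close>; the functions \<open>\<Q>\<^sub>t\<^sub>+\<^sub>1\<^sup>k\<close> are finite since \<open>k \<ge> 1\<close>.\<close>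

definition eta_of ::
    "('n::finite,'p::finite,'q::finite) dp_problem \<Rightarrow> ('n,'p,'q) iddp_run \<Rightarrow>
     nat \<Rightarrow> nat \<Rightarrow> real^'n \<Rightarrow> real" where
  "eta_of P R t k d =
     (SUP y\<in>state_set P t. d \<bullet> (bwd R t k - y)
        + real_of_ereal (Qapp P R (Suc t) k (bwd R t k)) - real_of_ereal (Qapp P R (Suc t) k y))"

definition forward_step ::
    "('n::finite,'p::finite,'q::finite) dp_problem \<Rightarrow> (nat \<Rightarrow> nat \<Rightarrow> real) \<Rightarrow> ('n,'p,'q) iddp_run \<Rightarrow>
     nat \<Rightarrow> nat \<Rightarrow> bool" where
  "forward_step P \<epsilon> R t k \<longleftrightarrow>
     fwd R t k \<in> eps_argmin (\<epsilon> t k) (\<lambda>y. Fapp P R t (k - 1) y (fwd R (t - 1) k))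
                   (feas P t (fwd R (t - 1) k))"

definition backward_step ::
    "('n::finite,'p::finite,'q::finite) dp_problem \<Rightarrow> (nat \<Rightarrow> nat \<Rightarrow> real) \<Rightarrow> ('n,'p,'q) iddp_run \<Rightarrow>
     nat \<Rightarrow> nat \<Rightarrow> bool" where
  "backward_step P \<epsilon> R t k \<longleftrightarrow>
     (let x = fwd R (t - 1) k; y = bwd R t k; l = dual_eq R t k; m = dual_ineq R t k;
          base = cost P t (y, x) + real_of_ereal (Qapp P R (Suc t) k y)
      in y \<in> eps_argmin (\<epsilon> t k) (\<lambda>y'. Fapp P R t k y' x) (feas P t x) \<and>
         (if typeS2 P t then
            (l, m) \<in> eps_argmax (\<epsilon> t k) (dual_fun P R t k x) (dual_dom P t x) \<and>
            theta R t k = base + m \<bullet> ineq P t (y, x) \<and>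
            beta R t k = snd (cost_grad P t (y, x)) + transpose (matB P t) *v l
                         + (\<Sum>i\<in>UNIV. (m $ i) *\<^sub>R snd (ineq_grad P t i (y, x))) \<and>
            eta R t k = eta_of P R t k
                          (fst (cost_grad P t (y, x)) + transpose (matA P t) *v l
                           + (\<Sum>i\<in>UNIV. (m $ i) *\<^sub>R fst (ineq_grad P t i (y, x))))
          else
            theta R t k = base \<and>
            beta R t k = snd (cost_grad P t (y, x)) \<and>
            eta R t k = eta_of P R t k (fst (cost_grad P t (y, x)))))"

definition is_iddp_run ::
    "('n::finite,'p::finite,'q::finite) dp_problem \<Rightarrow> (nat \<Rightarrow> nat \<Rightarrow> real) \<Rightarrow> ('n,'p,'q) iddp_run \<Rightarrow>
     bool" where
  "is_iddp_run P \<epsilon> R \<longleftrightarrow>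
     (\<forall>k\<ge>1.
        (\<forall>t\<in>{1..horizon P}. 0 \<le> \<epsilon> t k) \<and>
        fwd R 0 k = init P \<and>
        (\<forall>t\<in>{1..horizon P}. forward_step P \<epsilon> R t k) \<and>
        (\<forall>t\<in>{2..horizon P}. backward_step P \<epsilon> R t k))"

section \<open>The error bounds\<close>

text \<open>\<open>LQ C t\<close> is the Lipschitz constant of \<open>\<Q>\<^sub>t\<close> on the state set of stage \<open>t - 1\<close>.\<close>

record bound_consts =
  M2 :: "nat \<Rightarrow> real"
  M3 :: "nat \<Rightarrow> real"
  Lf :: "nat \<Rightarrow> real"
  Lg :: "nat \<Rightarrow> real"
  LQ :: "nat \<Rightarrow> real"
  kap :: "nat \<Rightarrow> real"
  rad :: "nat \<Rightarrow> real"
  rho :: "nat \<Rightarrow> real"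

definition dir_space :: "'a::real_vector set \<Rightarrow> 'a set" where
  "dir_space S = {x - y | x y. x \<in> affine hull S \<and> y \<in> affine hull S}"

definition valid_consts ::
    "('n::finite,'p::finite,'q::finite) dp_problem \<Rightarrow> bound_consts \<Rightarrow> bool" where
  "valid_consts P C \<longleftrightarrow>
     (\<forall>t\<in>{2..horizon P}.
        (\<forall>z\<in>pair_set P t. norm (cost_grad P t z) \<le> M2 C t) \<and>
        (typeS2 P t \<longrightarrow>
           (\<forall>i. \<forall>z\<in>pair_set P t. norm (ineq_grad P t i z) \<le> M3 C t) \<and>
           (Lf C t)-lipschitz_on (pair_set P t) (cost P t) \<and>
           (LQ C (Suc t))-lipschitz_on (state_set P t) (\<lambda>y. real_of_ereal (value_fun P (Suc t) y)) \<and>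
           0 < Lg C t \<and> (\<forall>i. (Lg C t)-lipschitz_on (pair_set P t) (\<lambda>z. ineq P t z $ i)) \<and>
           0 < kap C t \<and> 0 < rad C t \<and> H2_at P t (kap C t) (rad C t) \<and>
           rad C t \<le> kap C t / (2 * Lg C t) \<and>
           0 < rho C t \<and>
           cball 0 (rho C t) \<inter> ((*v) (matA P t)) ` dir_space (state_set P t)
             \<subseteq> ((*v) (matA P t)) ` (cball 0 (rad C t) \<inter> dir_space (state_set P t))))"

definition U_bound ::
    "('n::finite,'p::finite,'q::finite) dp_problem \<Rightarrow> ('n,'p,'q) iddp_run \<Rightarrow> bound_consts \<Rightarrow>
     (nat \<Rightarrow> real) \<Rightarrow> nat \<Rightarrow> real" where
  "U_bound P R C \<epsilon>bar t =
     ((Lf C t + LQ C (Suc t)) * rad C t + \<epsilon>bar t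
      + real_of_ereal (SUP (y, x)\<in>pair_set P t. ereal (cost P t (y, x)) + value_fun P (Suc t) y)
      - real_of_ereal (INF x\<in>state_set P (t - 1). Qlow P R t 1 x))
     / min (rho C t) (kap C t / 2)"

text \<open>The norm of a matrix is its operator norm for the Euclidean norms.\<close>

definition mult_bound ::
    "('n::finite,'p::finite,'q::finite) dp_problem \<Rightarrow> ('n,'p,'q) iddp_run \<Rightarrow> bound_consts \<Rightarrow>
     (nat \<Rightarrow> real) \<Rightarrow> nat \<Rightarrow> real^'n^'q \<Rightarrow> real" where
  "mult_bound P R C \<epsilon>bar t D =
     sqrt 2 * max (onorm ((*v) (transpose D))) (M3 C t * sqrt (real CARD('p))) * U_bound P R C \<epsilon>bar t"

definition L_cut ::
    "('n::finite,'p::finite,'q::finite) dp_problem \<Rightarrow> ('n,'p,'q) iddp_run \<Rightarrow> bound_consts \<Rightarrow>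
     (nat \<Rightarrow> real) \<Rightarrow> nat \<Rightarrow> real" where
  "L_cut P R C \<epsilon>bar t =
     (if horizon P < t then 0
      else if typeS2 P t then M2 C t + mult_bound P R C \<epsilon>bar t (matB P t)
      else M2 C t)"

definition eta_bar ::
    "('n::finite,'p::finite,'q::finite) dp_problem \<Rightarrow> ('n,'p,'q) iddp_run \<Rightarrow> bound_consts \<Rightarrow>
     (nat \<Rightarrow> real) \<Rightarrow> nat \<Rightarrow> real" where
  "eta_bar P R C \<epsilon>bar t =
     (if typeS2 P t
      then M2 C t + mult_bound P R C \<epsilon>bar t (matA P t) + L_cut P R C \<epsilon>bar (Suc t)
      else M2 C t + L_cut P R C \<epsilon>bar (Suc t))
     * diameter (state_set P t)"

definition Err ::
    "('n::finite,'p::finite,'q::finite) dp_problem \<Rightarrow> ('n,'p,'q) iddp_run \<Rightarrow> bound_consts \<Rightarrow>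
     (nat \<Rightarrow> real) \<Rightarrow> nat \<Rightarrow> real" where
  "Err P R C \<epsilon>bar t =
     (if t = 1 then \<epsilon>bar 1
      else if typeS2 P t then eta_bar P R C \<epsilon>bar t + 2 * \<epsilon>bar t
      else eta_bar P R C \<epsilon>bar t + \<epsilon>bar t)"

section \<open>Limits along an infinite set of iterations\<close>

definition along :: "nat set \<Rightarrow> nat filter" where
  "along K = inf sequentially (principal K)"

end

theory Submission
  imports Defs
begin

text \<open>
  Along a run, \<open>\<Q>\<^sub>t\<^sup>k\<close> is a maximum of affine functions. Everything
  follows from comparing it with \<open>\<Q>\<^sub>t\<close> at the forward point
  \<open>x\<^sub>t\<^sub>-\<^sub>1\<^sup>k\<close>, where iteration \<open>k\<close> adds a cut.

  The cuts lie below \<open>\<Q>\<^sub>t\<close> (\<open>cut_le\<close>, \<open>qapp_le_val\<close>):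
  each one is a tangent of the Lagrangian of the stage problem, and the correction
  \<open>\<eta>\<close> accounts for the base point being only an approximate minimizer. In the
  opposite direction, strong duality under the Slater condition (\<open>slater_strong_duality\<close>)
  shows that the new cut at its base point reproduces the value found in the forward pass up to an
  error \<open>err t k\<close> composed of noises and \<open>\<eta>\<close>
  (\<open>qapp_recursion\<close>). Hence the gap \<open>\<Q>\<^sub>t - \<Q>\<^sub>t\<^sup>k\<close> at
  \<open>x\<^sub>t\<^sub>-\<^sub>1\<^sup>k\<close> is at most \<open>err t k\<close> plus the lagged
  gap \<open>\<Q>\<^sub>t\<^sub>+\<^sub>1 -
  \<Q>\<^sub>t\<^sub>+\<^sub>1\<^sup>k\<^sup>-\<^sup>1\<close> at \<open>x\<^sub>t\<^sup>k\<close>.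

  The lagged gap refers to the approximation before the cut at \<open>x\<^sub>t\<^sup>k\<close> was
  added. But the approximations increase in \<open>k\<close>, share a Lipschitz constant, and the
  forward points stay in a compact set, so new points are eventually close to old ones and the lag
  does not matter asymptotically (\<open>limsup_le_lagged\<close>). Backward induction then bounds the
  limit superior of the gap of stage \<open>t\<close> by the sum of the asymptotic errors of the
  stages from \<open>t\<close> on (\<open>gap_limsup\<close>). Since the forward decisions are nearly
  optimal for the approximations, their cost telescopes to \<open>\<Q>\<^sub>1\<close> plus all lagged
  gaps and noises (\<open>run_cost_le\<close>).

  The common Lipschitz constant comes from a bound on the multipliers
  (\<open>multiplier_bound\<close>), which also bounds \<open>\<eta>\<close> by
  \<open>eta_bar\<close>; with the errors \<open>Err\<close> this is the case of bounded noises. For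
  vanishing noises the gradient of the Lagrangian has a modulus of continuity that does not depend on
  \<open>k\<close>, so nearly minimizing the Lagrangian means nearly satisfying its first-order
  condition, and \<open>\<eta>\<close> tends to zero (\<open>eta_vanishes\<close>); the same induction
  then runs with all asymptotic errors equal to zero. Finally, continuity of
  \<open>\<Q>\<^sub>t\<close>, which is needed for the limits of the iterates, rests on the Lipschitz
  behaviour of the feasible sets (\<open>feas_lipschitz\<close>).
\<close>

section \<open>Convex differentiable functions\<close>

text \<open>The derivative is taken within the domain, which may have empty interior, so the tangent inequality
  is read off from the difference quotients along the segment from \<open>z\<close> to
  \<open>w\<close>: by convexity they stay below \<open>f w - f z\<close>.\<close>

lemma convex_on_tangent_le:
  fixes f :: "'a::real_inner \<Rightarrow> real"
  assumes conv: "convex_on S f" and z: "z \<in> S" and w: "w \<in> S"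
    and der: "(f has_derivative (\<lambda>h. g \<bullet> h)) (at z within S)"
  shows "f z + g \<bullet> (w - z) \<le> f w"
proof -
  define p where "p s = z + s *\<^sub>R (w - z)" for s :: real
  have p_alt: "p s = (1 - s) *\<^sub>R z + s *\<^sub>R w" for s
    by (simp add: p_def algebra_simps)
  have sub: "p ` {0..1} \<subseteq> S"
    using convexD_alt[OF convex_on_imp_convex[OF conv] z w] by (auto simp: p_alt)
  have p0: "p 0 = z"
    by (simp add: p_def)
  have dp: "(p has_derivative (\<lambda>s. s *\<^sub>R (w - z))) (at 0 within {0..1})"
    unfolding p_def by (auto intro!: derivative_eq_intros)
  have "(f has_derivative (\<lambda>h. g \<bullet> h)) (at (p 0) within p ` {0..1})"
    using has_derivative_subset[OF der sub] by (simp add: p0)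
  from diff_chain_within[OF dp this]
  have "((\<lambda>s. f (p s)) has_derivative (\<lambda>s. s * (g \<bullet> (w - z)))) (at 0 within {0..1})"
    by (simp add: o_def)
  then have "((\<lambda>s. f (p s)) has_field_derivative (g \<bullet> (w - z))) (at 0 within {0..1})"
    unfolding has_field_derivative_def by (rule has_derivative_eq_rhs) (simp add: fun_eq_iff mult.commute)
  then have lim: "((\<lambda>s. (f (p s) - f z) / s) \<longlongrightarrow> g \<bullet> (w - z)) (at 0 within {0..1})"
    by (simp add: has_field_derivative_iff p0)
  have quot: "(f (p s) - f z) / s \<le> f w - f z" if "s \<in> {0..1}" "s \<noteq> 0" for s
  proof -
    have "f (p s) \<le> (1 - s) * f z + s * f w"
      unfolding p_alt using convex_onD[OF conv, of s z w] that z w by simp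
    then have "f (p s) - f z \<le> (f w - f z) * s"
      by (simp add: algebra_simps)
    then show ?thesis
      using that by (simp add: pos_divide_le_eq)
  qed
  have "g \<bullet> (w - z) \<le> f w - f z"
  proof (rule tendsto_upperbound[OF lim])
    show "\<forall>\<^sub>F s in at 0 within {0..1}. (f (p s) - f z) / s \<le> f w - f z"
      using quot by (auto simp: eventually_at_filter)
    show "at (0::real) within {0..1} \<noteq> bot"
      by (simp add: at_within_Icc_at_right)
  qed
  then show ?thesis
    by simp
qed

text \<open>The tangent inequalities at both end points give the Lipschitz estimate without a mean value
  theorem.\<close>

lemma convex_C1_on_lipschitz:
  fixes f :: "'a::real_inner \<Rightarrow> real"
  assumes conv: "convex_on S f" and C1: "C1_on S f G"
    and bound: "\<And>z. z \<in> S \<Longrightarrow> norm (G z) \<le> M" and M: "0 \<le> M"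
  shows "M-lipschitz_on S f"
proof (rule lipschitz_onI[OF _ M])
  have half: "f z - f w \<le> M * dist z w" if "z \<in> S" "w \<in> S" for z w
  proof -
    have "f z + G z \<bullet> (w - z) \<le> f w"
      using C1 that by (intro convex_on_tangent_le[OF conv]) (auto simp: C1_on_def)
    then have "f z - f w \<le> G z \<bullet> (z - w)"
      by (simp add: inner_diff_right)
    also have "\<dots> \<le> norm (G z) * norm (z - w)"
      by (rule norm_cauchy_schwarz)
    also have "\<dots> \<le> M * dist z w"
      using bound[OF that(1)] by (simp add: dist_norm mult_right_mono)
    finally show ?thesis .
  qed
  fix z w assume "z \<in> S" "w \<in> S"
  then show "dist (f z) (f w) \<le> M * dist z w"
    using half[of z w] half[of w z] by (simp add: dist_real_def dist_commute abs_le_iff)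
qed

lemma C1_on_bounded_gradient:
  fixes f :: "'a::real_inner \<Rightarrow> real"
  assumes "compact S" "C1_on S f G"
  obtains M where "0 < M" "\<And>z. z \<in> S \<Longrightarrow> norm (G z) \<le> M"
proof -
  have "bounded (G ` S)"
    using assms by (auto simp: C1_on_def intro!: compact_imp_bounded compact_continuous_image)
  then obtain B where "\<And>z. z \<in> S \<Longrightarrow> norm (G z) \<le> B"
    by (auto simp: bounded_iff)
  then have "\<And>z. z \<in> S \<Longrightarrow> norm (G z) \<le> max B 1"
    by (simp add: le_max_iff_disj)
  then show ?thesis
    using that[of "max B 1"] by simp
qed

lemma C1_on_continuous: "C1_on S f G \<Longrightarrow> continuous_on S f"
  by (auto simp: C1_on_def intro: has_derivative_continuous_on)

lemma convex_on_slice: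
  assumes "convex_on (Y \<times> X) f" "x \<in> X"
  shows "convex_on Y (\<lambda>y. f (y, x))"
proof (rule convex_onI)
  have "convex (Y \<times> X)"
    by (rule convex_on_imp_convex[OF assms(1)])
  then have "convex (fst ` (Y \<times> X))"
    by (intro convex_linear_image linear_fst)
  then show "convex Y"
    using assms(2) by (auto split: if_splits)
  fix s :: real and y z assume s: "0 < s" "s < 1" and yz: "y \<in> Y" "z \<in> Y"
  have "((1 - s) *\<^sub>R y + s *\<^sub>R z, x) = (1 - s) *\<^sub>R (y, x) + s *\<^sub>R (z, x)"
    by (simp add: algebra_simps)
  then show "f ((1 - s) *\<^sub>R y + s *\<^sub>R z, x) \<le> (1 - s) * f (y, x) + s * f (z, x)"
    using convex_onD[OF assms(1), of s "(y, x)" "(z, x)"] s yz assms(2) by simp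
qed

text \<open>An exact minimizer \<open>y0\<close> of \<open>\<phi> + q\<close> satisfies the first-order
  condition \<open>D y0 \<bullet> (y0 - y) + q y0 - q y \<le> 0\<close>. For a minimizer up to
  \<open>e\<close>, move from \<open>y0\<close> only the fraction \<open>s\<close> of the way towards
  \<open>y\<close>: the tangent at the intermediate point bounds \<open>\<phi> y0\<close> from below,
  so the violation of the condition, times \<open>s\<close>, is at most \<open>e\<close> plus
  \<open>s\<close> times the oscillation \<open>\<omega>\<close> of \<open>D\<close> times the
  diameter. The estimate is quantitative in \<open>e\<close>; since \<open>s\<close> may be chosen
  before \<open>e\<close>, it shows that the violation vanishes with \<open>e\<close>, uniformly in
  \<open>q\<close>.\<close>

lemma approx_minimizer_gap:
  fixes D :: "'a::real_inner \<Rightarrow> 'a" and \<phi> q :: "'a \<Rightarrow> real"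
  assumes q: "convex_on X q"
    and tangent: "\<And>y y'. y \<in> X \<Longrightarrow> y' \<in> X \<Longrightarrow> \<phi> y + D y \<bullet> (y' - y) \<le> \<phi> y'"
    and modulus: "\<And>y. y \<in> X \<Longrightarrow> norm (y - y0) \<le> s * d \<Longrightarrow> norm (D y - D y0) \<le> \<omega>"
    and approx: "\<And>y. y \<in> X \<Longrightarrow> \<phi> y0 + q y0 \<le> \<phi> y + q y + e"
    and diam: "\<And>y. y \<in> X \<Longrightarrow> norm (y - y0) \<le> d"
    and s: "0 < s" "s \<le> 1" and y0: "y0 \<in> X" and y: "y \<in> X"
  shows "D y0 \<bullet> (y0 - y) + q y0 - q y \<le> e / s + \<omega> * d"
proof -
  define w where "w = (1 - s) *\<^sub>R y0 + s *\<^sub>R y"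
  have w_alt: "w - y0 = s *\<^sub>R (y - y0)"
    by (simp add: w_def algebra_simps)
  have w: "w \<in> X"
    unfolding w_def using convexD_alt[OF convex_on_imp_convex[OF q] y0 y] s by simp
  have near: "norm (w - y0) \<le> s * d"
    using diam[OF y] s by (simp add: w_alt)
  have "(D w - D y0) \<bullet> (y - y0) \<le> norm (D w - D y0) * norm (y - y0)"
    by (rule norm_cauchy_schwarz)
  also have "\<dots> \<le> \<omega> * d"
    using modulus[OF w near] diam[OF y] norm_ge_zero[of "D w - D y0"]
    by (intro mult_mono) (auto intro: order_trans[OF norm_ge_zero])
  finally have Dw: "D w \<bullet> (y - y0) \<le> D y0 \<bullet> (y - y0) + \<omega> * d"
    by (simp add: inner_diff_left)
  have "y0 - w = - (s *\<^sub>R (y - y0))"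
    using w_alt by (metis minus_diff_eq)
  then have "\<phi> w - s * (D w \<bullet> (y - y0)) \<le> \<phi> y0"
    using tangent[OF w y0] by simp
  moreover have "q w \<le> (1 - s) * q y0 + s * q y"
    unfolding w_def using convex_onD[OF q, of s y0 y] s y0 y by simp
  ultimately have "0 \<le> s * (D w \<bullet> (y - y0)) + s * (q y - q y0) + e"
    using approx[OF w] by (simp add: algebra_simps)
  moreover have "s * (D w \<bullet> (y - y0)) \<le> s * (D y0 \<bullet> (y - y0) + \<omega> * d)"
    using Dw s by (intro mult_left_mono) auto
  ultimately have "s * (D y0 \<bullet> (y0 - y) + q y0 - q y) \<le> e + s * (\<omega> * d)"
    by (simp add: algebra_simps inner_diff_right)
  then have "D y0 \<bullet> (y0 - y) + q y0 - q y \<le> (e + s * (\<omega> * d)) / s"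
    using s by (simp add: pos_le_divide_eq mult.commute)
  then show ?thesis
    using s by (simp add: add_divide_distrib)
qed

section \<open>Affine constraints and Lagrange duality\<close>

lemma subspace_dir_space:
  assumes "S \<noteq> {}"
  shows "subspace (dir_space S)"
proof -
  obtain b where "b \<in> S"
    using assms by auto
  then obtain a where a: "a \<in> affine hull S"
    using hull_inc by metis
  have eq: "dir_space S = (\<lambda>x. x - a) ` (affine hull S)"
  proof (intro equalityI subsetI)
    fix v assume "v \<in> dir_space S"
    then obtain x y where xy: "x \<in> affine hull S" "y \<in> affine hull S" "v = x - y"
      by (auto simp: dir_space_def)
    have "x + 1 *\<^sub>R (a - y) \<in> affine hull S"
      using mem_affine_3_minus[OF affine_affine_hull xy(1) a xy(2), of 1] by simp
    then show "v \<in> (\<lambda>x. x - a) ` (affine hull S)"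
      by (rule rev_image_eqI) (simp add: xy)
  qed (use a in \<open>auto simp: dir_space_def\<close>)
  show ?thesis
    unfolding eq using affine_diffs_subspace_subtract[OF affine_affine_hull a] by simp
qed

lemma add_dir_space_affine_hull:
  assumes "a \<in> affine hull S" "u \<in> dir_space S"
  shows "a + u \<in> affine hull S"
proof -
  obtain x y where "x \<in> affine hull S" "y \<in> affine hull S" "u = x - y"
    using assms(2) by (auto simp: dir_space_def)
  then show ?thesis
    using mem_affine_3_minus[OF affine_affine_hull assms(1), of x y 1] by simp
qed

lemma diff_mem_dir_space: "x \<in> S \<Longrightarrow> y \<in> S \<Longrightarrow> x - y \<in> dir_space S"
  by (auto simp: dir_space_def intro: hull_inc)

text \<open>Open mapping property of a matrix between \<open>V\<close> and its image. It provides the constant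
  \<open>\<rho>\<close> that converts the size of a residual of the equality constraints into the size
  of a correction.\<close>

lemma matrix_image_ball_contains_ball:
  fixes A :: "real^'n^'q"
  assumes V: "subspace V" and r: "0 < r"
  shows "\<exists>\<rho>>0. cball 0 \<rho> \<inter> (*v) A ` V \<subseteq> (*v) A ` (cball 0 r \<inter> V)"
proof -
  obtain g where g: "range g \<subseteq> V" "linear g" "\<And>v. v \<in> (*v) A ` V \<Longrightarrow> A *v g v = v"
    using linear_exists_right_inverse_on[OF matrix_vector_mul_linear V, of A] by blast
  obtain K where K: "0 < K" "\<And>e. norm (g e) \<le> norm e * K"
    using bounded_linear.pos_bounded[of g] g(2) linear_conv_bounded_linear by blast
  have "cball 0 (r / K) \<inter> (*v) A ` V \<subseteq> (*v) A ` (cball 0 r \<inter> V)"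
  proof
    fix e assume e: "e \<in> cball 0 (r / K) \<inter> (*v) A ` V"
    then have "norm e * K \<le> r"
      using K by (simp add: pos_le_divide_eq)
    then have "norm (g e) \<le> r"
      using K(2)[of e] by simp
    then show "e \<in> (*v) A ` (cball 0 r \<inter> V)"
      using g(1) g(3)[of e] e by (intro rev_image_eqI[of "g e"]) auto
  qed
  then show ?thesis
    using K r by (intro exI[of _ "r / K"]) simp
qed

lemma matrix_preimage_bounded:
  fixes A :: "real^'n^'q"
  assumes V: "subspace V" and \<rho>: "0 < \<rho>"
    and sub: "cball 0 \<rho> \<inter> (*v) A ` V \<subseteq> (*v) A ` (cball 0 r \<inter> V)"
    and e: "e \<in> (*v) A ` V"
  shows "\<exists>u\<in>V. A *v u = e \<and> norm u \<le> r / \<rho> * norm e"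
proof (cases "e = 0")
  case True
  then show ?thesis
    using subspace_0[OF V] by (intro bexI[of _ 0]) auto
next
  case False
  define c where "c = \<rho> / norm e"
  have c: "0 < c"
    using False \<rho> by (simp add: c_def)
  have "c *\<^sub>R e \<in> (*v) A ` V"
    by (rule subspace_scale[OF linear_subspace_image[OF matrix_vector_mul_linear V] e])
  moreover have "norm (c *\<^sub>R e) = \<rho>"
    using False \<rho> by (simp add: c_def)
  ultimately obtain u where u: "u \<in> V" "norm u \<le> r" "A *v u = c *\<^sub>R e"
    using sub by (force simp: image_iff)
  show ?thesis
  proof (intro bexI conjI)
    show "(1 / c) *\<^sub>R u \<in> V"
      by (rule subspace_scale[OF V u(1)])
    show "A *v ((1 / c) *\<^sub>R u) = e"
      using c by (simp add: matrix_vector_mult_scaleR u(3))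
    have "norm ((1 / c) *\<^sub>R u) = norm u / c"
      using c by simp
    also have "\<dots> \<le> r / c"
      using u(2) c by (simp add: divide_right_mono)
    also have "\<dots> = r / \<rho> * norm e"
      by (simp add: c_def)
    finally show "norm ((1 / c) *\<^sub>R u) \<le> r / \<rho> * norm e" .
  qed
qed

text \<open>Lagrange duality under the Slater condition, by separation of the point \<open>(0, 0, p)\<close>
  from the convex set of triples (residual, bound on the inequalities, strict bound on the objective)
  that some \<open>y \<in> X\<close> realizes. The separating functional is taken in the affine hull
  of the set, which forces its first part into the range of the equality constraints. This is the
  normalization of \<open>\<lambda>\<close> in the dual problem, and together with the Slater point it
  excludes a functional without objective component.\<close>

lemma slater_strong_duality:
  fixes A :: "real^'n^'q" and G :: "real^'n \<Rightarrow> real^'p" and F :: "real^'n \<Rightarrow> real"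
  assumes X: "convex X" and F: "convex_on X F" and G: "\<And>i. convex_on X (\<lambda>y. G y $ i)"
    and E: "\<And>y. E y = A *v (y - y0)" and y0: "y0 \<in> X" "\<And>i. G y0 $ i < 0"
    and ri: "\<And>u. u \<in> dir_space X \<Longrightarrow> \<exists>s>0. y0 + s *\<^sub>R u \<in> X"
    and low: "\<And>y. y \<in> X \<Longrightarrow> E y = 0 \<Longrightarrow> (\<And>i. G y $ i \<le> 0) \<Longrightarrow> p \<le> F y"
  obtains l m where "l \<in> (*v) A ` dir_space X" "\<And>i. 0 \<le> m $ i"
    "\<And>y. y \<in> X \<Longrightarrow> p \<le> F y + l \<bullet> E y + m \<bullet> G y"
proof -
  define S where "S = {(e, s, v). \<exists>y\<in>X. e = E y \<and> (\<forall>i. G y $ i \<le> s $ i) \<and> F y < v}"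
  define z where "z = (0::real^'q, 0::real^'p, p)"
  have S_mem: "(E y, G y + d, F y + c) \<in> S" if "y \<in> X" "0 < c" "\<And>i. 0 \<le> d $ i" for y d c
    using that by (auto simp: S_def)
  have "convex S"
  proof (rule convexI)
    fix a b and \<alpha> \<beta> :: real
    assume ab: "a \<in> S" "b \<in> S" and \<alpha>\<beta>: "0 \<le> \<alpha>" "0 \<le> \<beta>" "\<alpha> + \<beta> = 1"
    obtain ea sa va ya where a: "a = (ea, sa, va)" "ya \<in> X" "ea = E ya"
        "\<And>i. G ya $ i \<le> sa $ i" "F ya < va"
      using ab(1) by (auto simp: S_def)
    obtain eb sb vb yb where b: "b = (eb, sb, vb)" "yb \<in> X" "eb = E yb"
        "\<And>i. G yb $ i \<le> sb $ i" "F yb < vb"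
      using ab(2) by (auto simp: S_def)
    define y where "y = \<alpha> *\<^sub>R ya + \<beta> *\<^sub>R yb"
    have y: "y \<in> X"
      unfolding y_def by (rule convexD[OF X a(2) b(2) \<alpha>\<beta>])
    have "y - y0 = \<alpha> *\<^sub>R (ya - y0) + \<beta> *\<^sub>R (yb - y0)"
    proof -
      have "y0 = (\<alpha> + \<beta>) *\<^sub>R y0" using \<alpha>\<beta> by simp
      then show ?thesis by (simp add: y_def algebra_simps)
    qed
    then have "E y = \<alpha> *\<^sub>R ea + \<beta> *\<^sub>R eb"
      by (simp add: E a b matrix_vector_right_distrib matrix_vector_mult_scaleR)
    moreover have "G y $ i \<le> \<alpha> * sa $ i + \<beta> * sb $ i" for i
    proof -
      have "G y $ i \<le> \<alpha> * G ya $ i + \<beta> * G yb $ i"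
        using G[of i] a(2) b(2) \<alpha>\<beta> unfolding convex_on_def y_def by blast
      also have "\<dots> \<le> \<alpha> * sa $ i + \<beta> * sb $ i"
        using a(4)[of i] b(4)[of i] \<alpha>\<beta> by (intro add_mono mult_left_mono) auto
      finally show ?thesis .
    qed
    moreover have "F y < \<alpha> * va + \<beta> * vb"
    proof -
      have "F y \<le> \<alpha> * F ya + \<beta> * F yb"
        using F a(2) b(2) \<alpha>\<beta> unfolding convex_on_def y_def by blast
      also have "\<dots> < \<alpha> * va + \<beta> * vb"
      proof (cases "\<alpha> = 0")
        case True
        then show ?thesis using \<alpha>\<beta> b(5) by simp
      next
        case False
        then show ?thesis
          using a(5) b(5) \<alpha>\<beta> by (intro add_less_le_mono mult_strict_left_mono mult_left_mono) auto
      qed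
      finally show ?thesis .
    qed
    ultimately show "\<alpha> *\<^sub>R a + \<beta> *\<^sub>R b \<in> S"
      using y by (auto simp: S_def a(1) b(1) intro!: bexI[of _ y])
  qed
  moreover have "S \<noteq> {}"
    using S_mem[OF y0(1), of 1 0] by auto
  moreover have "z \<notin> S"
  proof
    assume "z \<in> S"
    then obtain y where "y \<in> X" "E y = 0" "\<And>i. G y $ i \<le> 0" "F y < p"
      by (auto simp: S_def z_def)
    then show False
      using low[of y] by simp
  qed
  ultimately obtain a b where ab: "z + a \<in> affine hull (insert z S)" "a \<noteq> 0" "a \<bullet> z \<le> b"
      "\<And>x. x \<in> S \<Longrightarrow> b \<le> a \<bullet> x"
    by (rule separating_hyperplane_set_point_inaff) blast
  obtain l m \<nu> where a: "a = (l, m, \<nu>)"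
    by (cases a) auto
  have V: "subspace (dir_space X)"
    using y0 by (intro subspace_dir_space) auto
  have AV: "subspace ((*v) A ` dir_space X)"
    by (rule linear_subspace_image[OF matrix_vector_mul_linear V])
  have "subspace (((*v) A ` dir_space X) \<times> (UNIV :: ((real^'p) \<times> real) set))"
    by (intro subspace_Times AV subspace_UNIV)
  moreover have "insert z S \<subseteq> ((*v) A ` dir_space X) \<times> UNIV"
    using subspace_0[OF AV] diff_mem_dir_space[OF _ y0(1)] by (auto simp: S_def z_def E)
  ultimately have "affine hull (insert z S) \<subseteq> ((*v) A ` dir_space X) \<times> UNIV"
    using hull_minimal subspace_imp_affine by blast
  then have l: "l \<in> (*v) A ` dir_space X"
    using ab(1) by (auto simp: a z_def)
  have sep: "\<nu> * p \<le> l \<bullet> E y + m \<bullet> (G y + d) + \<nu> * (F y + c)"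
    if "y \<in> X" "0 < c" "\<And>i. 0 \<le> d $ i" for y d c
    using ab(4)[OF S_mem[OF that]] ab(3) by (simp add: a z_def)
  have E0: "E y0 = 0"
    by (simp add: E)
  \<comment> \<open>The set is unbounded upwards in its last two components; a negative coefficient would be refuted far out.\<close>
  have nu: "0 \<le> \<nu>"
  proof (rule ccontr)
    assume "\<not> 0 \<le> \<nu>"
    then have neg: "\<nu> < 0" by simp
    define w where "w = m \<bullet> G y0 + \<nu> * F y0 - \<nu> * p"
    define c where "c = (\<bar>w\<bar> + 1) / - \<nu>"
    have "0 < c" using neg by (simp add: c_def divide_pos_neg)
    then have "0 \<le> w + \<nu> * c"
      using sep[OF y0(1), of c 0] by (simp add: E0 w_def algebra_simps)
    moreover have "\<nu> * c = - (\<bar>w\<bar> + 1)"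
      using neg by (simp add: c_def)
    ultimately show False by linarith
  qed
  have m: "0 \<le> m $ i" for i
  proof (rule ccontr)
    assume "\<not> 0 \<le> m $ i"
    then have neg: "m $ i < 0" by simp
    define w where "w = m \<bullet> G y0 + \<nu> * (F y0 + 1) - \<nu> * p"
    define c where "c = (\<bar>w\<bar> + 1) / - (m $ i)"
    have "0 < c" using neg by (simp add: c_def divide_pos_neg)
    then have "0 \<le> w + m \<bullet> axis i c"
      using sep[OF y0(1), of 1 "axis i c"] by (simp add: E0 w_def axis_def algebra_simps)
    moreover have "m \<bullet> axis i c = - (\<bar>w\<bar> + 1)"
      using neg by (simp add: c_def inner_axis)
    ultimately show False by linarith
  qed
  \<comment> \<open>Without objective component, the Slater point forces the inequality part to vanish, and moving from it against the direction of \<open>l\<close> forces \<open>l\<close> to vanish.\<close>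
  have nu_pos: "0 < \<nu>"
  proof (rule ccontr)
    assume "\<not> 0 < \<nu>"
    then have nu0: "\<nu> = 0" using nu by simp
    have sep0: "0 \<le> l \<bullet> E y + m \<bullet> G y" if "y \<in> X" for y
      using sep[OF that, of 1 0] by (simp add: nu0)
    have "m $ i * G y0 $ i \<le> 0" for i
      using m[of i] y0(2)[of i] by (simp add: mult_nonneg_nonpos)
    then have "m $ i * G y0 $ i = 0" for i
      using sep0[OF y0(1)] sum_nonneg_0[of UNIV "\<lambda>i. - (m $ i * G y0 $ i)" i]
        sum_nonneg[of UNIV "\<lambda>i. - (m $ i * G y0 $ i)"]
      by (auto simp: E0 inner_vec_def sum_negf)
    then have m0: "m = 0"
      using y0(2) by (simp add: vec_eq_iff) (metis less_irrefl)
    obtain u where u: "u \<in> dir_space X" "l = A *v u"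
      using l by auto
    obtain s where s: "0 < s" "y0 + s *\<^sub>R (- u) \<in> X"
      using ri[of "- u"] subspace_neg[OF V u(1)] by auto
    have "E (y0 + s *\<^sub>R (- u)) = - (s *\<^sub>R l)"
      by (simp add: E u(2) matrix_vector_mult_scaleR
          linear_neg[OF matrix_vector_mul_linear])
    then have "s * (l \<bullet> l) \<le> 0"
      using sep0[OF s(2)] m0 by simp
    then have "l = 0"
      using s(1) inner_ge_zero[of l] by (simp add: mult_le_0_iff)
    then show False
      using ab(2) a m0 nu0 by (simp add: zero_prod_def)
  qed
  show ?thesis
  proof (rule that)
    show "(1 / \<nu>) *\<^sub>R l \<in> (*v) A ` dir_space X"
      by (rule subspace_scale[OF AV l])
    show "0 \<le> ((1 / \<nu>) *\<^sub>R m) $ i" for i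
      using m nu by simp
    fix y assume y: "y \<in> X"
    have "p \<le> F y + ((1 / \<nu>) *\<^sub>R l) \<bullet> E y + ((1 / \<nu>) *\<^sub>R m) \<bullet> G y"
    proof (rule field_le_epsilon)
      fix c :: real assume "0 < c"
      then have "\<nu> * p \<le> l \<bullet> E y + m \<bullet> G y + \<nu> * (F y + c)"
        using sep[OF y, of c 0] by simp
      then have "\<nu> * p \<le> \<nu> * (F y + ((1 / \<nu>) *\<^sub>R l) \<bullet> E y + ((1 / \<nu>) *\<^sub>R m) \<bullet> G y + c)"
        using nu_pos by (simp add: algebra_simps)
      then show "p \<le> F y + ((1 / \<nu>) *\<^sub>R l) \<bullet> E y + ((1 / \<nu>) *\<^sub>R m) \<bullet> G y + c"
        using nu_pos by simp
    qed
    then show "p \<le> F y + ((1 / \<nu>) *\<^sub>R l) \<bullet> E y + ((1 / \<nu>) *\<^sub>R m) \<bullet> G y" .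
  qed
qed

section \<open>Bounds for extrema and Lipschitz functions\<close>

lemma compact_continuous_abs_bound:
  fixes f :: "'a::topological_space \<Rightarrow> real"
  assumes "compact S" "continuous_on S f"
  obtains B where "0 \<le> B" "\<And>z. z \<in> S \<Longrightarrow> \<bar>f z\<bar> \<le> B"
proof -
  have "bounded (f ` S)"
    using assms by (intro compact_imp_bounded compact_continuous_image)
  then obtain B where "\<And>z. z \<in> S \<Longrightarrow> \<bar>f z\<bar> \<le> B"
    by (auto simp: bounded_iff)
  then show ?thesis
    using that[of "max B 0"] by (simp add: le_max_iff_disj)
qed

lemma INF_ereal_bounds:
  assumes "S \<noteq> {}" "\<And>y. y \<in> S \<Longrightarrow> \<bar>g y\<bar> \<le> (B::real)"
  obtains v where "(INF y\<in>S. ereal (g y)) = ereal v" "\<bar>v\<bar> \<le> B"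
proof -
  obtain y where y: "y \<in> S"
    using assms(1) by auto
  have "(INF y\<in>S. ereal (g y)) \<le> ereal (g y)"
    by (rule INF_lower[OF y])
  also have "\<dots> \<le> ereal B"
    using assms(2)[OF y] by (simp add: abs_le_iff)
  finally have up: "(INF y\<in>S. ereal (g y)) \<le> ereal B" .
  have lo: "ereal (- B) \<le> (INF y\<in>S. ereal (g y))"
  proof (rule INF_greatest)
    show "ereal (- B) \<le> ereal (g i)" if "i \<in> S" for i
      using assms(2)[OF that] by (simp add: abs_le_iff)
  qed
  from up lo show ?thesis
    by (cases "INF y\<in>S. ereal (g y)") (auto intro!: that simp: abs_le_iff)
qed

lemma SUP_ereal_ge:
  assumes "S \<noteq> {}" "\<And>z. z \<in> S \<Longrightarrow> \<bar>g z\<bar> \<le> (B::real)" "z \<in> S"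
  shows "g z \<le> real_of_ereal (SUP z\<in>S. ereal (g z))"
proof -
  have lo: "ereal (g z) \<le> (SUP z\<in>S. ereal (g z))"
    by (rule SUP_upper[OF assms(3)])
  have "(SUP z\<in>S. ereal (g z)) \<le> ereal B"
    using assms(2) by (intro SUP_least) (simp add: abs_le_iff)
  with lo show ?thesis
    by (cases "SUP z\<in>S. ereal (g z)") auto
qed

lemma lipschitz_on_slice:
  fixes f :: "'a::real_normed_vector \<times> 'b::real_normed_vector \<Rightarrow> real"
  assumes "L-lipschitz_on S f" "(y, x) \<in> S" "(y', x') \<in> S"
  shows "f (y', x') \<le> f (y, x) + L * (norm (y' - y) + norm (x' - x))"
proof -
  have "f (y', x') - f (y, x) \<le> L * dist (y', x') (y, x)"
    using lipschitz_onD[OF assms(1,3,2)] by (simp add: dist_real_def)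
  also have "dist (y', x') (y, x) \<le> norm (y' - y) + norm (x' - x)"
    using norm_Pair_le[of "y' - y" "x' - x"] by (simp add: dist_norm)
  finally show ?thesis
    using lipschitz_on_nonneg[OF assms(1)] by (simp add: mult_left_mono)
qed

lemma eps_argmin_le:
  assumes "y \<in> eps_argmin e F S" "z \<in> S"
  shows "F y \<le> F z + ereal e"
proof -
  have "F y \<le> (INF z\<in>S. F z) + ereal e"
    using assms(1) by (simp add: eps_argmin_def)
  also have "\<dots> \<le> F z + ereal e"
    by (intro add_right_mono INF_lower assms(2))
  finally show ?thesis .
qed

section \<open>Subsequences and asymptotic upper bounds\<close>

lemma common_convergent_subsequence:
  fixes u :: "'i \<Rightarrow> nat \<Rightarrow> 'a::metric_space"
  assumes "finite I" and "\<And>i. i \<in> I \<Longrightarrow> compact (S i)" and "\<And>i k. i \<in> I \<Longrightarrow> u i k \<in> S i"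
  shows "\<exists>\<sigma>::nat \<Rightarrow> nat. strict_mono \<sigma> \<and> (\<forall>i\<in>I. \<exists>l\<in>S i. (\<lambda>k. u i (\<sigma> k)) \<longlonglongrightarrow> l)"
  using assms
proof (induction I rule: finite_induct)
  case empty
  then show ?case
    by (intro exI[of _ id]) (simp add: strict_mono_def)
next
  case (insert a I)
  then obtain \<sigma> :: "nat \<Rightarrow> nat"
    where \<sigma>: "strict_mono \<sigma>" "\<And>i. i \<in> I \<Longrightarrow> \<exists>l\<in>S i. (\<lambda>k. u i (\<sigma> k)) \<longlonglongrightarrow> l"
    by auto
  have "\<forall>k. (u a \<circ> \<sigma>) k \<in> S a"
    using insert.prems by simp
  then obtain l and r :: "nat \<Rightarrow> nat" where r: "l \<in> S a" "strict_mono r" "((u a \<circ> \<sigma>) \<circ> r) \<longlonglongrightarrow> l"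
    using insert.prems(1)[of a] unfolding compact_def by blast
  have "\<exists>l\<in>S i. (\<lambda>k. u i (\<sigma> (r k))) \<longlonglongrightarrow> l" if "i \<in> I" for i
    using \<sigma>(2)[OF that] LIMSEQ_subseq_LIMSEQ[OF _ r(2)] by (fastforce simp: o_def)
  then show ?case
    using r \<sigma>(1) by (intro exI[of _ "\<sigma> \<circ> r"]) (auto simp: o_def intro: strict_mono_o[unfolded o_def])
qed

text \<open>The statement \<open>limsup u \<le> E\<close>, also for sequences that are not bounded below,
  without a detour through the extended reals.\<close>

definition limsup_le :: "(nat \<Rightarrow> real) \<Rightarrow> real \<Rightarrow> bool" where
  "limsup_le u E \<longleftrightarrow> (\<forall>\<delta>>0. \<forall>\<^sub>F k in sequentially. u k \<le> E + \<delta>)"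

lemma limsup_le_of_bound: "limsup_le u E" if "\<forall>\<^sub>F k in sequentially. u k \<le> E"
  unfolding limsup_le_def using that by (auto elim!: eventually_mono)

lemma limsup_le_of_tendsto: "limsup_le u E" if "u \<longlonglongrightarrow> E"
  unfolding limsup_le_def
proof (intro allI impI)
  fix \<delta> :: real assume "0 < \<delta>"
  then show "\<forall>\<^sub>F k in sequentially. u k \<le> E + \<delta>"
    using order_tendstoD(2)[OF that, of "E + \<delta>"] by (auto elim!: eventually_mono)
qed

lemma limsup_le_mono:
  assumes "limsup_le v E" "\<forall>\<^sub>F k in sequentially. u k \<le> v k"
  shows "limsup_le u E"
  unfolding limsup_le_def
proof (intro allI impI)
  fix \<delta> :: real assume "0 < \<delta>"
  then have "\<forall>\<^sub>F k in sequentially. v k \<le> E + \<delta>"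
    using assms(1) by (auto simp: limsup_le_def)
  then show "\<forall>\<^sub>F k in sequentially. u k \<le> E + \<delta>"
    using assms(2) by eventually_elim simp
qed

lemma limsup_le_add:
  assumes "limsup_le u D" "limsup_le v E"
  shows "limsup_le (\<lambda>k. u k + v k) (D + E)"
  unfolding limsup_le_def
proof (intro allI impI)
  fix \<delta> :: real assume "0 < \<delta>"
  then have "\<forall>\<^sub>F k in sequentially. u k \<le> D + \<delta> / 2" "\<forall>\<^sub>F k in sequentially. v k \<le> E + \<delta> / 2"
    using assms half_gt_zero unfolding limsup_le_def by blast+
  then show "\<forall>\<^sub>F k in sequentially. u k + v k \<le> D + E + \<delta>"
  proof eventually_elim
    case (elim k)
    then show ?case using field_sum_of_halves[of \<delta>] by linarith
  qed
qed

lemma limsup_le_sum: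
  "limsup_le (\<lambda>k. \<Sum>i\<in>I. u i k) (\<Sum>i\<in>I. E i)" if "finite I" "\<And>i. i \<in> I \<Longrightarrow> limsup_le (u i) (E i)"
  using that
proof (induction I rule: finite_induct)
  case empty
  then show ?case by (simp add: limsup_le_of_bound)
next
  case (insert a I)
  then show ?case by (simp add: limsup_le_add)
qed

lemma limsup_le_subseq_limit:
  assumes "limsup_le u E" "filterlim \<sigma> at_top sequentially" "(\<lambda>k. u (\<sigma> k)) \<longlonglongrightarrow> l"
  shows "l \<le> E"
proof (rule field_le_epsilon)
  fix \<delta> :: real assume "0 < \<delta>"
  then have "\<forall>\<^sub>F k in sequentially. u k \<le> E + \<delta>"
    using assms(1) by (simp add: limsup_le_def)
  then have "\<forall>\<^sub>F k in sequentially. u (\<sigma> k) \<le> E + \<delta>"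
    using assms(2) unfolding filterlim_iff by blast
  then show "l \<le> E + \<delta>"
    using tendsto_upperbound[OF assms(3)] by simp
qed

lemma limsup_le_0_tendsto:
  assumes "limsup_le u 0" "\<forall>\<^sub>F k in sequentially. 0 \<le> u k"
  shows "u \<longlonglongrightarrow> 0"
proof (rule order_tendstoI)
  fix a :: real assume "a < 0"
  then show "\<forall>\<^sub>F k in sequentially. a < u k"
    using assms(2) by (auto elim!: eventually_mono)
next
  fix a :: real assume "0 < a"
  then have "\<forall>\<^sub>F k in sequentially. u k \<le> 0 + a / 2"
    using assms(1) half_gt_zero unfolding limsup_le_def by blast
  then show "\<forall>\<^sub>F k in sequentially. u k < a"
    using \<open>0 < a\<close> by (auto elim!: eventually_mono)
qed

text \<open>The decreasing functions \<open>D k\<close> play the role of the errors \<open>\<Q>\<^sub>t -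
  \<Q>\<^sub>t\<^sup>k\<close>. The error at the new point \<open>x k\<close> before the model is
  updated there is asymptotically no worse than the error after the update: otherwise infinitely many
  points \<open>x k\<close> with a large old error would exist, two of them, \<open>x j\<close> and
  \<open>x k\<close> with \<open>j < k\<close>, would be close by compactness, and the small error at
  \<open>x j\<close> after iteration \<open>j\<close> would make the error at \<open>x k\<close> small
  before iteration \<open>k\<close> already.\<close>

lemma limsup_le_lagged:
  fixes D :: "nat \<Rightarrow> 'a::metric_space \<Rightarrow> real"
  assumes X: "compact X" and x: "\<And>k. 1 \<le> k \<Longrightarrow> x k \<in> X"
    and decr: "\<And>j k y. 1 \<le> j \<Longrightarrow> j \<le> k \<Longrightarrow> y \<in> X \<Longrightarrow> D k y \<le> D j y"
    and lip: "\<And>k. 1 \<le> k \<Longrightarrow> M-lipschitz_on X (D k)"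
    and gap: "limsup_le (\<lambda>k. D k (x k)) E"
  shows "limsup_le (\<lambda>k. D (k - 1) (x k)) E"
  unfolding limsup_le_def
proof (intro allI impI, rule ccontr)
  fix \<delta> :: real assume \<delta>: "0 < \<delta>" and "\<not> (\<forall>\<^sub>F k in sequentially. D (k - 1) (x k) \<le> E + \<delta>)"
  then have inf: "infinite {k. E + \<delta> < D (k - 1) (x k)}" (is "infinite ?B")
    by (auto simp: eventually_sequentially infinite_nat_iff_unbounded_le not_le)
  have M: "0 \<le> M"
    using lip[of 1] by (auto dest: lipschitz_on_nonneg)
  obtain N where N: "\<And>k. N \<le> k \<Longrightarrow> D k (x k) \<le> E + \<delta> / 2"
    using gap \<delta> half_gt_zero unfolding limsup_le_def eventually_sequentially by blast
  define B where "B = {k. E + \<delta> < D (k - 1) (x k)} \<inter> {max N 1..}"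
  have "infinite B"
  proof
    assume "finite B"
    then have "finite (B \<union> {..<max N 1})" by simp
    moreover have "?B \<subseteq> B \<union> {..<max N 1}"
      by (auto simp: B_def)
    ultimately show False
      using inf finite_subset by blast
  qed
  then obtain r :: "nat \<Rightarrow> nat" where r: "strict_mono r" "\<And>i. r i \<in> B"
    using infinite_enumerate by blast
  have "\<forall>i. (x \<circ> r) i \<in> X"
    using x r(2) by (fastforce simp: B_def)
  then obtain l \<sigma> where \<sigma>: "strict_mono (\<sigma> :: nat \<Rightarrow> nat)" "(x \<circ> r \<circ> \<sigma>) \<longlonglongrightarrow> l"
    using X unfolding compact_def by blast
  have "Cauchy (x \<circ> r \<circ> \<sigma>)"
    using \<sigma>(2) by (rule LIMSEQ_imp_Cauchy)
  moreover have "0 < \<delta> / (2 * (M + 1))"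
    using \<delta> M by simp
  ultimately obtain n where n: "\<And>i j. n \<le> i \<Longrightarrow> n \<le> j \<Longrightarrow>
      dist ((x \<circ> r \<circ> \<sigma>) i) ((x \<circ> r \<circ> \<sigma>) j) < \<delta> / (2 * (M + 1))"
    unfolding Cauchy_def by metis
  define j k where "j = r (\<sigma> n)" and "k = r (\<sigma> (Suc n))"
  have jk: "j < k" "j \<in> B" "k \<in> B"
    using r \<sigma>(1) by (auto simp: j_def k_def strict_mono_def)
  then have j1: "1 \<le> j" "N \<le> j" "1 \<le> k" and xjk: "x j \<in> X" "x k \<in> X"
    using x by (auto simp: B_def)
  have d: "dist (x k) (x j) * (2 * (M + 1)) < \<delta>"
    using n[of "Suc n" n] M by (simp add: j_def k_def pos_less_divide_eq)
  have "E + \<delta> < D (k - 1) (x k)"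
    using jk by (simp add: B_def)
  also have "\<dots> \<le> D j (x k)"
    using decr[of j "k - 1"] jk(1) j1 xjk by simp
  also have "\<dots> \<le> D j (x j) + M * dist (x k) (x j)"
    using lipschitz_onD[OF lip[OF j1(1)] xjk(2) xjk(1)] by (simp add: dist_real_def)
  also have "\<dots> \<le> E + \<delta> / 2 + \<delta> / 2"
  proof -
    have "M * dist (x k) (x j) \<le> \<delta> / 2"
      using d zero_le_dist[of "x k" "x j"] unfolding distrib_left by argo
    then show ?thesis
      using N[OF j1(2)] by simp
  qed
  finally show False
    by simp
qed

lemma tendsto_along_range:
  assumes "strict_mono (\<sigma> :: nat \<Rightarrow> nat)" "((\<lambda>j. f (\<sigma> j)) \<longlongrightarrow> l) sequentially"
  shows "(f \<longlongrightarrow> l) (along (range \<sigma>))"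
proof (rule topological_tendstoI)
  fix S assume "open S" "l \<in> S"
  then have "\<forall>\<^sub>F j in sequentially. f (\<sigma> j) \<in> S"
    using assms(2) by (rule topological_tendstoD[rotated])
  then obtain N where N: "\<And>j. N \<le> j \<Longrightarrow> f (\<sigma> j) \<in> S"
    by (auto simp: eventually_sequentially)
  have "f (\<sigma> j) \<in> S" if "\<sigma> N \<le> \<sigma> j" for j
    using N that assms(1) by (simp add: strict_mono_less_eq)
  then have "\<forall>\<^sub>F k in sequentially. k \<in> range \<sigma> \<longrightarrow> f k \<in> S"
    by (auto simp: eventually_sequentially)
  then show "\<forall>\<^sub>F k in along (range \<sigma>). f k \<in> S"
    by (simp add: along_def eventually_inf_principal)
qed

text \<open>Source of the weights in the error bound for the total cost: the error of stage
  \<open>\<tau>\<close> is counted once for every stage up to \<open>\<tau>\<close>.\<close>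

lemma sum_of_tail_sums:
  fixes E :: "nat \<Rightarrow> real"
  shows "(\<Sum>t=1..n. \<Sum>\<tau>=t..n. E \<tau>) = (\<Sum>\<tau>=1..n. real \<tau> * E \<tau>)"
proof (induction n)
  case (Suc n)
  have "(\<Sum>t=1..Suc n. \<Sum>\<tau>=t..Suc n. E \<tau>) = (\<Sum>t=1..n. (\<Sum>\<tau>=t..n. E \<tau>) + E (Suc n)) + E (Suc n)"
    by simp
  also have "\<dots> = (\<Sum>t=1..n. \<Sum>\<tau>=t..n. E \<tau>) + real (Suc n) * E (Suc n)"
    by (simp add: sum.distrib algebra_simps)
  finally show ?case
    using Suc by simp
qed simp

section \<open>Regularity of the value functions\<close>

text \<open>The uniform Slater data of a stage. The bound on \<open>r\<close> leaves the slack \<open>\<kappa> /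
  2\<close> in the inequalities after moving by \<open>r\<close> away from the strictly feasible
  point.\<close>

definition slater_consts ::
    "('n::finite,'p::finite,'q::finite) dp_problem \<Rightarrow> nat \<Rightarrow> real \<Rightarrow> real \<Rightarrow> real \<Rightarrow> real \<Rightarrow> bool" where
  "slater_consts P t lg \<kappa> r \<rho> \<longleftrightarrow>
     0 < lg \<and> (\<forall>i. lg-lipschitz_on (pair_set P t) (\<lambda>z. ineq P t z $ i)) \<and>
     0 < \<kappa> \<and> 0 < r \<and> H2_at P t \<kappa> r \<and> r \<le> \<kappa> / (2 * lg) \<and> 0 < \<rho> \<and>
     cball 0 \<rho> \<inter> (*v) (matA P t) ` dir_space (state_set P t)
       \<subseteq> (*v) (matA P t) ` (cball 0 r \<inter> dir_space (state_set P t))"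

lemma eq_res_diff_left: "eq_res P t y x - eq_res P t y' x = matA P t *v (y - y')"
  by (simp add: eq_res_def matrix_vector_mult_diff_distrib)

lemma eq_res_diff_right: "eq_res P t y x - eq_res P t y x' = matB P t *v (x - x')"
  by (simp add: eq_res_def matrix_vector_mult_diff_distrib)

text \<open>Real version of the value function; it loses nothing on the state sets, where the value function is
  finite.\<close>

definition val :: "('n::finite,'p::finite,'q::finite) dp_problem \<Rightarrow> nat \<Rightarrow> real^'n \<Rightarrow> real" where
  "val P t x = real_of_ereal (value_fun P t x)"

locale regular_dp =
  fixes P :: "('n::finite,'p::finite,'q::finite) dp_problem"
  assumes horizon_pos: "1 \<le> horizon P" and H1: "H1 P" and H2: "H2 P"
begin

lemma state_set:
  assumes "t \<le> horizon P"
  shows "state_set P t \<noteq> {}" "convex (state_set P t)" "compact (state_set P t)"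
proof -
  have "state_set P t \<noteq> {} \<and> convex (state_set P t) \<and> compact (state_set P t)"
  proof (cases "t = 0")
    case True
    then show ?thesis by (simp add: state_set_def)
  next
    case False
    then have "t \<in> {1..horizon P}" using assms by simp
    then show ?thesis using H1 by (auto simp: H1_def)
  qed
  then show "state_set P t \<noteq> {}" "convex (state_set P t)" "compact (state_set P t)"
    by simp_all
qed

lemma pair_set:
  assumes "t \<in> {1..horizon P}"
  shows "convex (pair_set P t)" "compact (pair_set P t)" "pair_set P t \<noteq> {}"
proof -
  have "t \<le> horizon P" "t - 1 \<le> horizon P"
    using assms by auto
  then show "convex (pair_set P t)" "compact (pair_set P t)" "pair_set P t \<noteq> {}"
    unfolding pair_set_def using state_set[of t] state_set[of "t - 1"]
    by (auto intro!: convex_Times compact_Times)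
qed

lemma cost:
  assumes "t \<in> {1..horizon P}"
  shows "convex_on (pair_set P t) (cost P t)" "C1_on (pair_set P t) (cost P t) (cost_grad P t)"
  using H1 assms by (auto simp: H1_def)

lemma ineq:
  assumes "t \<in> {1..horizon P}" "typeS2 P t"
  shows "convex_on (pair_set P t) (\<lambda>z. ineq P t z $ i)"
    "C1_on (pair_set P t) (\<lambda>z. ineq P t z $ i) (ineq_grad P t i)"
proof -
  obtain e where e: "0 < e" "convex_on (state_set P t \<times> fatten (state_set P (t - 1)) e) (\<lambda>z. ineq P t z $ i)"
    "C1_on (pair_set P t) (\<lambda>z. ineq P t z $ i) (ineq_grad P t i)"
    using H1 assms by (auto simp: H1_def)
  have "pair_set P t \<subseteq> state_set P t \<times> fatten (state_set P (t - 1)) e"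
    using e(1) unfolding pair_set_def fatten_def by (intro Sigma_mono) force+
  then show "convex_on (pair_set P t) (\<lambda>z. ineq P t z $ i)"
    using convex_on_subset[OF e(2)] pair_set(1)[OF assms(1)] by blast
  show "C1_on (pair_set P t) (\<lambda>z. ineq P t z $ i) (ineq_grad P t i)"
    by (rule e(3))
qed

lemma cost_continuous: "t \<in> {1..horizon P} \<Longrightarrow> continuous_on (pair_set P t) (cost P t)"
  using cost(2) C1_on_continuous by blast

lemma cost_bounded:
  assumes "t \<in> {1..horizon P}"
  obtains B where "0 \<le> B" "\<And>z. z \<in> pair_set P t \<Longrightarrow> \<bar>cost P t z\<bar> \<le> B"
  using compact_continuous_abs_bound[OF pair_set(2)[OF assms] cost_continuous[OF assms]] by blast

lemma feas_subset: "feas P t x \<subseteq> state_set P t"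
  by (auto simp: feas_def)

lemma feas_nonempty:
  assumes "t \<in> {1..horizon P}" "x \<in> state_set P (t - 1)"
  shows "feas P t x \<noteq> {}"
proof (cases "typeS2 P t")
  case True
  obtain e where e: "0 < e" "\<And>x. x \<in> fatten (state_set P (t - 1)) e \<Longrightarrow>
      feas P t x \<inter> rel_interior (state_set P t) \<noteq> {}"
    using H1 assms(1) True unfolding H1_def by blast
  have "x \<in> fatten (state_set P (t - 1)) e"
    using assms(2) e(1) by (force simp: fatten_def)
  then show ?thesis
    using e(2) by blast
next
  case False
  then show ?thesis
    using state_set(1)[of t] assms(1) by (simp add: feas_def)
qed

lemma feas_pair: "x \<in> state_set P (t - 1) \<Longrightarrow> y \<in> feas P t x \<Longrightarrow> (y, x) \<in> pair_set P t"
  using feas_subset by (auto simp: pair_set_def)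

text \<open>Closed graph of the feasible-set map; it makes limits of forward trajectories feasible.\<close>

lemma feas_limit:
  assumes t: "t \<in> {1..horizon P}" and x: "\<And>k. x k \<in> state_set P (t - 1)" "x \<longlonglongrightarrow> x'"
    and y: "\<And>k::nat. y k \<in> feas P t (x k)" "y \<longlonglongrightarrow> y'"
  shows "y' \<in> feas P t x'"
proof -
  have closed: "closed (state_set P s)" if "s \<le> horizon P" for s
    using state_set(3)[OF that] by (rule compact_imp_closed)
  have yX: "y k \<in> state_set P t" for k
    using y(1) feas_subset by blast
  have y': "y' \<in> state_set P t"
    by (rule closed_sequentially[OF closed yX y(2)]) (use t in auto)
  have x': "x' \<in> state_set P (t - 1)"
    by (rule closed_sequentially[OF closed x]) (use t in auto)
  show ?thesis
  proof (cases "typeS2 P t")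
    case False
    then show ?thesis using y' by (simp add: feas_def)
  next
    case True
    have "ineq P t (y', x') $ i \<le> 0" for i
    proof (rule tendsto_upperbound)
      have "continuous_on (pair_set P t) (\<lambda>z. ineq P t z $ i)"
        using ineq(2)[OF t True] by (rule C1_on_continuous)
      then show "(\<lambda>k. ineq P t (y k, x k) $ i) \<longlonglongrightarrow> ineq P t (y', x') $ i"
        by (rule continuous_on_tendsto_compose[of _ "\<lambda>z. ineq P t z $ i"])
          (use x y(2) x' y' yX in \<open>auto simp: pair_set_def intro!: tendsto_Pair\<close>)
      show "\<forall>\<^sub>F k in sequentially. ineq P t (y k, x k) $ i \<le> 0"
        using y(1) True by (auto simp: feas_def)
    qed simp
    moreover have "eq_res P t y' x' = 0"
    proof (rule LIMSEQ_unique)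
      show "(\<lambda>k. eq_res P t (y k) (x k)) \<longlonglongrightarrow> eq_res P t y' x'"
        unfolding eq_res_def
        by (intro tendsto_intros bounded_linear.tendsto[OF matrix_vector_mul_bounded_linear] x y)
      show "(\<lambda>k. eq_res P t (y k) (x k)) \<longlonglongrightarrow> 0"
        using y(1) True by (auto simp: feas_def)
    qed
    ultimately show ?thesis
      using y' True by (simp add: feas_def)
  qed
qed

lemma value_bounded:
  assumes "t \<in> {1..Suc (horizon P)}"
  shows "\<exists>B. \<forall>x\<in>state_set P (t - 1). \<exists>v. value_fun P t x = ereal v \<and> \<bar>v\<bar> \<le> B"
proof -
  have "t \<le> Suc (horizon P)" "1 \<le> t"
    using assms by auto
  then show ?thesis
  proof (induction rule: inc_induct)
    case base
    then show ?case
      by (intro exI[of _ 0]) (simp add: value_fun.simps)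
  next
    case (step s)
    have s: "s \<in> {1..horizon P}"
      using step by auto
    obtain B where B: "\<And>y. y \<in> state_set P s \<Longrightarrow> \<exists>v. value_fun P (Suc s) y = ereal v \<and> \<bar>v\<bar> \<le> B"
      using step by auto
    then obtain v where v: "\<And>y. y \<in> state_set P s \<Longrightarrow> value_fun P (Suc s) y = ereal (v y) \<and> \<bar>v y\<bar> \<le> B"
      by metis
    obtain C where C: "\<And>z. z \<in> pair_set P s \<Longrightarrow> \<bar>cost P s z\<bar> \<le> C"
      using cost_bounded[OF s] by blast
    show ?case
    proof (rule exI[of _ "C + B"], rule ballI)
      fix x assume x: "x \<in> state_set P (s - 1)"
      have "\<bar>cost P s (y, x) + v y\<bar> \<le> C + B" if "y \<in> feas P s x" for y
      proof -
        have "\<bar>cost P s (y, x)\<bar> \<le> C" "\<bar>v y\<bar> \<le> B"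
          using C[OF feas_pair[OF x that]] v that feas_subset by auto
        then show ?thesis by linarith
      qed
      from INF_ereal_bounds[where g = "\<lambda>y. cost P s (y, x) + v y", OF feas_nonempty[OF s x] this]
      obtain w where w: "(INF y\<in>feas P s x. ereal (cost P s (y, x) + v y)) = ereal w" "\<bar>w\<bar> \<le> C + B"
        by blast
      have "value_fun P s x = (INF y\<in>feas P s x. ereal (cost P s (y, x)) + value_fun P (Suc s) y)"
        using s by (subst value_fun.simps) auto
      also have "\<dots> = (INF y\<in>feas P s x. ereal (cost P s (y, x) + v y))"
        using v feas_subset by (intro INF_cong) force+
      finally show "\<exists>w. value_fun P s x = ereal w \<and> \<bar>w\<bar> \<le> C + B"
        using w by auto
    qed
  qed
qed

lemma value_fun_eq_val:
  assumes "t \<in> {1..Suc (horizon P)}" "x \<in> state_set P (t - 1)"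
  shows "value_fun P t x = ereal (val P t x)"
  using value_bounded[OF assms(1)] assms(2) by (fastforce simp: val_def)

lemma val_bounded:
  assumes "t \<in> {1..Suc (horizon P)}"
  obtains B where "\<And>x. x \<in> state_set P (t - 1) \<Longrightarrow> \<bar>val P t x\<bar> \<le> B"
  using value_bounded[OF assms] by (fastforce simp: val_def)

lemma val_after_horizon: "val P (Suc (horizon P)) x = 0"
  by (simp add: val_def value_fun.simps)

lemma val_eq_INF:
  assumes t: "t \<in> {1..horizon P}" and x: "x \<in> state_set P (t - 1)"
  shows "ereal (val P t x) = (INF y\<in>feas P t x. ereal (cost P t (y, x) + val P (Suc t) y))"
proof -
  have "ereal (val P t x) = value_fun P t x"
    using value_fun_eq_val[of t x] t x by simp
  also have "\<dots> = (INF y\<in>feas P t x. ereal (cost P t (y, x)) + value_fun P (Suc t) y)"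
    using t by (subst value_fun.simps) auto
  also have "\<dots> = (INF y\<in>feas P t x. ereal (cost P t (y, x) + val P (Suc t) y))"
    using t feas_subset by (intro INF_cong) (force simp: value_fun_eq_val)+
  finally show ?thesis .
qed

lemma val_le:
  assumes t: "t \<in> {1..horizon P}" and x: "x \<in> state_set P (t - 1)" and y: "y \<in> feas P t x"
  shows "val P t x \<le> cost P t (y, x) + val P (Suc t) y"
proof -
  have "ereal (val P t x) \<le> ereal (cost P t (y, x) + val P (Suc t) y)"
    unfolding val_eq_INF[OF t x] by (rule INF_lower[OF y])
  then show ?thesis by simp
qed

lemma val_greatest:
  assumes t: "t \<in> {1..horizon P}" and x: "x \<in> state_set P (t - 1)"
    and c: "\<And>y. y \<in> feas P t x \<Longrightarrow> c \<le> cost P t (y, x) + val P (Suc t) y"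
  shows "c \<le> val P t x"
proof -
  have "ereal c \<le> ereal (val P t x)"
    unfolding val_eq_INF[OF t x] using c by (intro INF_greatest) simp
  then show ?thesis by simp
qed

text \<open>This inequality, for all feasible trajectories, is what turns a bound on the cost of one trajectory
  relative to \<open>\<Q>\<^sub>1\<close> into its approximate optimality.\<close>

lemma val_le_path_cost:
  assumes xs: "xs \<in> feasible_paths P"
  shows "val P 1 (init P) \<le> total_cost P xs"
proof -
  have xs0: "xs 0 = init P" and feas: "\<And>t. t \<in> {1..horizon P} \<Longrightarrow> xs t \<in> feas P t (xs (t - 1))"
    using xs by (auto simp: feasible_paths_def)
  have state: "xs t \<in> state_set P t" if "t \<le> horizon P" for t
  proof (cases "t = 0")
    case True
    then show ?thesis by (simp add: state_set_def xs0)
  next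
    case False
    then show ?thesis using feas[of t] feas_subset that by auto
  qed
  have "val P t (xs (t - 1)) \<le> (\<Sum>\<tau>=t..horizon P. cost P \<tau> (xs \<tau>, xs (\<tau> - 1)))"
    if "t \<le> Suc (horizon P)" "1 \<le> t" for t
    using that
  proof (induction rule: inc_induct)
    case base
    then show ?case by (simp add: val_after_horizon)
  next
    case (step s)
    have s: "s \<in> {1..horizon P}" "xs (s - 1) \<in> state_set P (s - 1)"
      using step state by auto
    have "val P s (xs (s - 1)) \<le> cost P s (xs s, xs (s - 1)) + val P (Suc s) (xs s)"
      by (rule val_le[OF s feas[OF s(1)]])
    also have "\<dots> \<le> cost P s (xs s, xs (s - 1)) + (\<Sum>\<tau>=Suc s..horizon P. cost P \<tau> (xs \<tau>, xs (\<tau> - 1)))"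
      using step by simp
    also have "\<dots> = (\<Sum>\<tau>=s..horizon P. cost P \<tau> (xs \<tau>, xs (\<tau> - 1)))"
      using s by (simp add: sum.atLeast_Suc_atMost)
    finally show ?case .
  qed
  from this[of 1] show ?thesis
    by (simp add: xs0 total_cost_def)
qed

lemma ineq_grad_bounded:
  assumes "t \<in> {1..horizon P}" "typeS2 P t"
  obtains M where "0 < M" "\<And>i z. z \<in> pair_set P t \<Longrightarrow> norm (ineq_grad P t i z) \<le> M"
proof -
  have "\<exists>B>0. \<forall>z\<in>pair_set P t. norm (ineq_grad P t i z) \<le> B" for i
    using C1_on_bounded_gradient[OF pair_set(2)[OF assms(1)] ineq(2)[OF assms]] by metis
  then obtain B where B: "\<And>i. 0 < B i" "\<And>i z. z \<in> pair_set P t \<Longrightarrow> norm (ineq_grad P t i z) \<le> B i"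
    by metis
  have "B i \<le> (\<Sum>i\<in>UNIV. B i)" for i
    using B(1) by (intro member_le_sum) (auto intro: less_imp_le)
  then have "norm (ineq_grad P t i z) \<le> (\<Sum>i\<in>UNIV. B i)" if "z \<in> pair_set P t" for i z
    using B(2)[OF that] order_trans by blast
  moreover have "0 < (\<Sum>i\<in>UNIV. B i)"
    using B(1) by (intro sum_pos) auto
  ultimately show ?thesis
    using that by blast
qed

lemma slater_consts_exist:
  assumes t: "t \<in> {2..horizon P}" and S2: "typeS2 P t"
  shows "\<exists>lg \<kappa> r \<rho>. slater_consts P t lg \<kappa> r \<rho>"
proof -
  have t1: "t \<in> {1..horizon P}"
    using t by auto
  obtain lg where lg: "0 < lg" "\<And>i z. z \<in> pair_set P t \<Longrightarrow> norm (ineq_grad P t i z) \<le> lg"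
    using ineq_grad_bounded[OF t1 S2] by metis
  then have lip: "lg-lipschitz_on (pair_set P t) (\<lambda>z. ineq P t z $ i)" for i
    by (intro convex_C1_on_lipschitz[OF ineq[OF t1 S2]]) auto
  obtain \<kappa> r0 where \<kappa>: "0 < \<kappa>" "0 < r0" "H2_at P t \<kappa> r0"
    using H2 t S2 by (auto simp: H2_def)
  define r where "r = min r0 (\<kappa> / (2 * lg))"
  have r: "0 < r" "r \<le> \<kappa> / (2 * lg)"
    using \<kappa> lg by (auto simp: r_def)
  have "cball y r \<subseteq> cball y r0" for y :: "real^'n"
    by (rule subset_cball) (simp add: r_def)
  then have "H2_at P t \<kappa> r"
    using \<kappa>(3) unfolding H2_at_def by blast
  moreover have "subspace (dir_space (state_set P t))"
    using subspace_dir_space state_set(1) t by auto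
  ultimately show ?thesis
    using lg lip \<kappa>(1) r matrix_image_ball_contains_ball[OF _ r(1), of "dir_space (state_set P t)" "matA P t"]
    unfolding slater_consts_def by metis
qed

text \<open>Uniformity of the Slater data makes the constant independent of \<open>x\<close>. When
  \<open>x\<close> moves to \<open>x'\<close>, a feasible \<open>y\<close> violates the constraints by
  a multiple of \<open>d = norm (x' - x)\<close>. Pulling \<open>y\<close> towards the Slater point
  \<open>v\<close> of \<open>x'\<close>, by a fraction \<open>s\<close> proportional to
  \<open>d\<close>, restores the inequalities, and a displacement \<open>u\<close> in the direction
  space restores the equalities. The displacement must be absorbed by the ball around
  \<open>v\<close>, which is shrunk by the factor \<open>s\<close>; this is the second reason why
  \<open>s\<close> must be a multiple of \<open>d\<close>.\<close>

lemma feas_lipschitz: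
  assumes t: "t \<in> {2..horizon P}"
  shows "\<exists>N\<ge>0. \<forall>x\<in>state_set P (t - 1). \<forall>x'\<in>state_set P (t - 1). \<forall>y\<in>feas P t x.
           \<exists>y'\<in>feas P t x'. norm (y' - y) \<le> N * norm (x' - x)"
proof (cases "typeS2 P t")
  case False
  then show ?thesis
    by (intro exI[of _ 0]) (auto simp: feas_def)
next
  case S2: True
  let ?X = "state_set P t" and ?A = "matA P t" and ?B = "matB P t"
  have t1: "t \<in> {1..horizon P}" and tT: "t \<le> horizon P"
    using t by auto
  have V: "subspace (dir_space ?X)"
    by (rule subspace_dir_space[OF state_set(1)[OF tT]])
  obtain lg \<kappa> r \<rho> where "slater_consts P t lg \<kappa> r \<rho>"
    using slater_consts_exist[OF t S2] by blast
  then have lg: "0 < lg" and lip: "\<And>i. lg-lipschitz_on (pair_set P t) (\<lambda>z. ineq P t z $ i)"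
    and \<kappa>: "0 < \<kappa>" and r: "0 < r" "r \<le> \<kappa> / (2 * lg)" and H2t: "H2_at P t \<kappa> r" and \<rho>: "0 < \<rho>"
    and open_map: "cball 0 \<rho> \<inter> (*v) ?A ` dir_space ?X \<subseteq> (*v) ?A ` (cball 0 r \<inter> dir_space ?X)"
    by (auto simp: slater_consts_def)
  obtain b where b: "0 < b" "\<And>h. norm (?B *v h) \<le> norm h * b"
    using bounded_linear.pos_bounded[OF matrix_vector_mul_bounded_linear] by blast
  \<comment> \<open>The first summand is what the equalities require of \<open>s / d\<close>, the second one what the inequalities require.\<close>
  define M where "M = b / \<rho> + 2 * lg / \<kappa>"
  have M: "0 < M"
    using b \<rho> lg \<kappa> by (simp add: M_def add_pos_pos)
  have diam: "norm (y' - y) \<le> diameter ?X" if "y \<in> ?X" "y' \<in> ?X" for y y'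
    using diameter_bounded_bound[OF compact_imp_bounded[OF state_set(3)[OF tT]] that(2,1)]
    by (simp add: dist_norm)
  have diam0: "0 \<le> diameter ?X"
    using diameter_ge_0 compact_imp_bounded state_set(3)[OF tT] by blast
  show ?thesis
  proof (intro exI[of _ "M * diameter ?X"] conjI ballI)
    show "0 \<le> M * diameter ?X"
      using M diam0 by simp
    fix x x' y assume x: "x \<in> state_set P (t - 1)" and x': "x' \<in> state_set P (t - 1)"
      and y: "y \<in> feas P t x"
    have yX: "y \<in> ?X" and y_ineq: "\<And>i. ineq P t (y, x) $ i \<le> 0" and y_eq: "eq_res P t y x = 0"
      using y S2 by (auto simp: feas_def)
    obtain v where v: "v \<in> ?X" "cball v r \<inter> affine hull ?X \<subseteq> ?X" "eq_res P t v x' = 0"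
        "\<And>i. ineq P t (v, x') $ i \<le> - \<kappa>"
      using H2t x' unfolding H2_at_def by blast
    define d where "d = norm (x' - x)"
    define s where "s = M * d"
    consider "d = 0" | "1 < s" | "0 < d" "s \<le> 1"
      using norm_ge_zero[of "x' - x"] by (force simp: d_def)
    then show "\<exists>y'\<in>feas P t x'. norm (y' - y) \<le> M * diameter ?X * norm (x' - x)"
    proof cases
      case 1
      then show ?thesis
        using y by (intro bexI[of _ y]) (auto simp: d_def)
    next
      case 2
      have "v \<in> feas P t x'"
        using v \<kappa> S2 by (auto simp: feas_def intro: order_trans[of _ "- \<kappa>"])
      moreover have "norm (v - y) \<le> M * diameter ?X * norm (x' - x)"
      proof -
        have "norm (v - y) \<le> 1 * diameter ?X"
          using diam[OF yX v(1)] by simp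
        also have "\<dots> \<le> s * diameter ?X"
          using 2 diam0 by (intro mult_right_mono) auto
        finally show ?thesis
          by (simp add: s_def d_def mult_ac)
      qed
      ultimately show ?thesis by blast
    next
      case 3
      have s: "0 < s" "s \<le> 1"
        using 3 M by (auto simp: s_def)
      define e where "e = eq_res P t y x'"
      have "- e = ?A *v (v - y)"
        using eq_res_diff_left[of P t v x' y] v(3) by (simp add: e_def)
      then have "- e \<in> (*v) ?A ` dir_space ?X"
        using diff_mem_dir_space[OF v(1) yX] by simp
      from matrix_preimage_bounded[OF V \<rho> open_map this]
      obtain u where u: "u \<in> dir_space ?X" "?A *v u = - e" "norm u \<le> r / \<rho> * norm e"
        by auto
      have "norm e \<le> d * b"
        using b(2)[of "x' - x"] eq_res_diff_right[of P t y x' x] y_eq by (simp add: e_def d_def)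
      then have "norm u \<le> r / \<rho> * (d * b)"
        using u(3) r \<rho> by (meson divide_pos_pos less_imp_le mult_left_mono order_trans)
      also have "\<dots> = r * (b / \<rho> * d)"
        by simp
      also have "\<dots> \<le> r * s"
        using r lg \<kappa> 3 by (intro mult_left_mono) (auto simp: s_def M_def algebra_simps)
      finally have nu: "norm u \<le> r * s" .
      \<comment> \<open>The displacement \<open>(1 - s) *\<^sub>R u\<close> is applied to \<open>v\<close>, which enters with weight \<open>s\<close>.\<close>
      define c where "c = (1 - s) / s"
      have c: "0 \<le> c" "c * s = 1 - s"
        using s by (auto simp: c_def)
      have "norm (c *\<^sub>R u) \<le> c * (r * s)"
        using nu c by (simp add: mult_left_mono)
      also have "\<dots> = (1 - s) * r"
        using c by (simp add: mult_ac)
      also have "\<dots> \<le> r"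
        using s r by (simp add: algebra_simps)
      finally have cu: "norm (c *\<^sub>R u) \<le> r" .
      define w where "w = v + c *\<^sub>R u"
      have "w \<in> affine hull ?X"
        unfolding w_def using v(1) u(1) V
        by (intro add_dir_space_affine_hull subspace_scale) (auto intro: hull_inc)
      then have w: "w \<in> ?X"
        using v(2) cu by (auto simp: w_def dist_norm)
      have w_ineq: "ineq P t (w, x') $ i \<le> - \<kappa> / 2" for i
      proof -
        have "ineq P t (w, x') $ i \<le> ineq P t (v, x') $ i + lg * norm (c *\<^sub>R u)"
          using lipschitz_on_slice[OF lip, of v x' w x' i] v(1) w x' by (simp add: pair_set_def w_def)
        also have "\<dots> \<le> - \<kappa> + lg * (\<kappa> / (2 * lg))"
          using v(4)[of i] cu r lg by (intro add_mono mult_left_mono) auto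
        also have "\<dots> = - \<kappa> / 2"
          using lg by simp
        finally show ?thesis .
      qed
      define y' where "y' = (1 - s) *\<^sub>R y + s *\<^sub>R w"
      have y': "y' \<in> ?X"
        unfolding y'_def using convexD_alt[OF state_set(2)[OF tT] yX w] s by simp
      have "eq_res P t y' x' = (1 - s) *\<^sub>R eq_res P t y x' + s *\<^sub>R eq_res P t w x'"
        by (simp add: eq_res_def y'_def matrix_vector_right_distrib matrix_vector_mult_scaleR algebra_simps)
      also have "eq_res P t w x' = - (c *\<^sub>R e)"
        using eq_res_diff_left[of P t w x' v] v(3) by (simp add: w_def matrix_vector_mult_scaleR u(2))
      also have "(1 - s) *\<^sub>R eq_res P t y x' + s *\<^sub>R (- (c *\<^sub>R e)) = 0"
        using c(2) by (simp add: e_def mult.commute)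
      finally have y'_eq: "eq_res P t y' x' = 0" .
      have "ineq P t (y', x') $ i \<le> 0" for i
      proof -
        have "(y', x') = (1 - s) *\<^sub>R (y, x') + s *\<^sub>R (w, x')"
          by (simp add: y'_def algebra_simps)
        then have "ineq P t (y', x') $ i \<le> (1 - s) * ineq P t (y, x') $ i + s * ineq P t (w, x') $ i"
          using convex_onD[OF ineq(1)[OF t1 S2], of s "(y, x')" "(w, x')" i] s yX w x'
          by (simp add: pair_set_def)
        also have "\<dots> \<le> (1 - s) * (lg * d) + s * (- \<kappa> / 2)"
        proof (intro add_mono mult_left_mono)
          show "ineq P t (y, x') $ i \<le> lg * d"
            using lipschitz_on_slice[OF lip, of y x y x' i] y_ineq[of i] yX x x'
            by (simp add: pair_set_def d_def)
        qed (use s w_ineq in auto)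
        also have "\<dots> \<le> lg * d - s * (\<kappa> / 2)"
          using s lg 3 by (simp add: algebra_simps)
        also have "\<dots> = - (b / \<rho> * d * (\<kappa> / 2))"
          using \<kappa> by (simp add: s_def M_def field_simps)
        also have "\<dots> \<le> 0"
          using b \<rho> \<kappa> 3 by simp
        finally show ?thesis .
      qed
      then have "y' \<in> feas P t x'"
        using y' y'_eq S2 by (simp add: feas_def)
      moreover have "norm (y' - y) \<le> M * diameter ?X * norm (x' - x)"
      proof -
        have "y' - y = s *\<^sub>R (w - y)"
          by (simp add: y'_def algebra_simps)
        then have "norm (y' - y) \<le> s * diameter ?X"
          using diam[OF yX w] s by (simp add: mult_left_mono)
        then show ?thesis
          by (simp add: s_def d_def mult_ac)
      qed
      ultimately show ?thesis by blast
    qed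
  qed
qed

lemma cost_lipschitz:
  assumes t: "t \<in> {1..horizon P}"
  obtains M where "0 < M" "\<And>z. z \<in> pair_set P t \<Longrightarrow> norm (cost_grad P t z) \<le> M"
    "M-lipschitz_on (pair_set P t) (cost P t)"
proof -
  obtain M where M: "0 < M" "\<And>z. z \<in> pair_set P t \<Longrightarrow> norm (cost_grad P t z) \<le> M"
    using C1_on_bounded_gradient[OF pair_set(2)[OF t] cost(2)[OF t]] by metis
  then show ?thesis
    using that convex_C1_on_lipschitz[OF cost[OF t] M(2)] by simp
qed

text \<open>Lipschitz continuity of the value functions, backwards in time: a decision feasible for
  \<open>x\<close> is replaced by a nearby one feasible for \<open>x'\<close>.\<close>

lemma val_lipschitz:
  assumes "t \<in> {2..Suc (horizon P)}"
  shows "\<exists>L. L-lipschitz_on (state_set P (t - 1)) (val P t)"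
proof -
  have "t \<le> Suc (horizon P)" "2 \<le> t"
    using assms by auto
  then show ?thesis
  proof (induction rule: inc_induct)
    case base
    show ?case
      by (intro exI[of _ 0] lipschitz_onI) (simp_all add: val_after_horizon)
  next
    case (step s)
    have s: "s \<in> {2..horizon P}" "s \<in> {1..horizon P}"
      using step by auto
    obtain L where L: "L-lipschitz_on (state_set P s) (val P (Suc s))"
      using step by auto
    obtain M where M: "0 < M" "M-lipschitz_on (pair_set P s) (cost P s)"
      using cost_lipschitz[OF s(2)] by blast
    obtain N where N: "0 \<le> N" "\<And>x x' y. x \<in> state_set P (s - 1) \<Longrightarrow> x' \<in> state_set P (s - 1) \<Longrightarrow>
        y \<in> feas P s x \<Longrightarrow> \<exists>y'\<in>feas P s x'. norm (y' - y) \<le> N * norm (x' - x)"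
      using feas_lipschitz[OF s(1)] by blast
    have L0: "0 \<le> L"
      by (rule lipschitz_on_nonneg[OF L])
    define C where "C = M * (N + 1) + L * N"
    have half: "val P s x' - C * norm (x' - x) \<le> val P s x"
      if x: "x \<in> state_set P (s - 1)" and x': "x' \<in> state_set P (s - 1)" for x x'
    proof (rule val_greatest[OF s(2) x])
      fix y assume y: "y \<in> feas P s x"
      obtain y' where y': "y' \<in> feas P s x'" "norm (y' - y) \<le> N * norm (x' - x)"
        using N(2)[OF x x' y] by blast
      have "val P s x' \<le> cost P s (y', x') + val P (Suc s) y'"
        by (rule val_le[OF s(2) x' y'(1)])
      also have "cost P s (y', x') \<le> cost P s (y, x) + M * (norm (y' - y) + norm (x' - x))"
        by (rule lipschitz_on_slice[OF M(2) feas_pair[OF x y] feas_pair[OF x' y'(1)]])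
      also have "val P (Suc s) y' \<le> val P (Suc s) y + L * norm (y' - y)"
        using lipschitz_onD[OF L, of y' y] feas_subset y y'(1) by (force simp: dist_real_def dist_norm)
      also have "M * (norm (y' - y) + norm (x' - x)) \<le> M * (N * norm (x' - x) + norm (x' - x))"
        using y'(2) M(1) by (intro mult_left_mono) auto
      also have "L * norm (y' - y) \<le> L * (N * norm (x' - x))"
        using y'(2) L0 by (intro mult_left_mono) auto
      finally show "val P s x' - C * norm (x' - x) \<le> cost P s (y, x) + val P (Suc s) y"
        by (simp add: C_def algebra_simps)
    qed
    show ?case
    proof (intro exI[of _ C] lipschitz_onI)
      show "0 \<le> C"
        using M(1) N(1) L0 by (simp add: C_def)
      fix x x' assume "x \<in> state_set P (s - 1)" "x' \<in> state_set P (s - 1)"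
      then show "dist (val P s x) (val P s x') \<le> C * dist x x'"
        using half[of x x'] half[of x' x] by (simp add: dist_real_def dist_norm norm_minus_commute abs_le_iff)
    qed
  qed
qed

text \<open>Vanishing noises come without constants, but the estimates for bounded noises are needed there as
  well.\<close>

lemma valid_consts_exist: "\<exists>C. valid_consts P C"
proof -
  define ok where "ok t C \<longleftrightarrow>
        (\<forall>z\<in>pair_set P t. norm (cost_grad P t z) \<le> M2 C t) \<and>
        (typeS2 P t \<longrightarrow>
           (\<forall>i. \<forall>z\<in>pair_set P t. norm (ineq_grad P t i z) \<le> M3 C t) \<and>
           (Lf C t)-lipschitz_on (pair_set P t) (cost P t) \<and>
           (LQ C (Suc t))-lipschitz_on (state_set P t) (val P (Suc t)) \<and>
           slater_consts P t (Lg C t) (kap C t) (rad C t) (rho C t))" for t and C :: bound_consts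
  have "\<exists>C. ok t C" if t: "t \<in> {2..horizon P}" for t
  proof -
    have t1: "t \<in> {1..horizon P}"
      using t by auto
    obtain m2 where m2: "\<And>z. z \<in> pair_set P t \<Longrightarrow> norm (cost_grad P t z) \<le> m2"
        "m2-lipschitz_on (pair_set P t) (cost P t)"
      using cost_lipschitz[OF t1] by blast
    obtain lq where lq: "lq-lipschitz_on (state_set P t) (val P (Suc t))"
      using val_lipschitz[of "Suc t"] t by auto
    show ?thesis
    proof (cases "typeS2 P t")
      case False
      then show ?thesis
        using m2 by (intro exI[of _ "\<lparr>M2 = \<lambda>_. m2, M3 = \<lambda>_. 0, Lf = \<lambda>_. 0, Lg = \<lambda>_. 0, LQ = \<lambda>_. 0,
              kap = \<lambda>_. 0, rad = \<lambda>_. 0, rho = \<lambda>_. 0\<rparr>"]) (simp add: ok_def)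
    next
      case True
      obtain m3 where m3: "\<And>i z. z \<in> pair_set P t \<Longrightarrow> norm (ineq_grad P t i z) \<le> m3"
        using ineq_grad_bounded[OF t1 True] by metis
      obtain lg \<kappa> r \<rho> where "slater_consts P t lg \<kappa> r \<rho>"
        using slater_consts_exist[OF t True] by blast
      then show ?thesis
        using m2 m3 lq by (intro exI[of _ "\<lparr>M2 = \<lambda>_. m2, M3 = \<lambda>_. m3, Lf = \<lambda>_. m2,
              Lg = \<lambda>_. lg, LQ = \<lambda>_. lq, kap = \<lambda>_. \<kappa>, rad = \<lambda>_. r, rho = \<lambda>_. \<rho>\<rparr>"]) (simp add: ok_def)
    qed
  qed
  then obtain Cs where Cs: "\<And>t. t \<in> {2..horizon P} \<Longrightarrow> ok t (Cs t)"
    by metis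
  \<comment> \<open>\<open>LQ\<close> is indexed by the stage of the value function, one later than the stage that uses it.\<close>
  define C where "C = \<lparr>M2 = \<lambda>t. M2 (Cs t) t, M3 = \<lambda>t. M3 (Cs t) t, Lf = \<lambda>t. Lf (Cs t) t,
    Lg = \<lambda>t. Lg (Cs t) t, LQ = \<lambda>t. LQ (Cs (t - 1)) t, kap = \<lambda>t. kap (Cs t) t,
    rad = \<lambda>t. rad (Cs t) t, rho = \<lambda>t. rho (Cs t) t\<rparr>"
  have "ok t C" if "t \<in> {2..horizon P}" for t
    using Cs[OF that] by (simp add: ok_def C_def)
  then have "valid_consts P C"
    unfolding valid_consts_def ok_def slater_consts_def val_def[abs_def] by blast
  then show ?thesis ..
qed

lemma cost_tendsto:
  assumes t: "t \<in> {1..horizon P}" and y: "\<And>j::nat. y j \<in> state_set P t" "y \<longlonglongrightarrow> y'" "y' \<in> state_set P t"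
    and x: "\<And>j. x j \<in> state_set P (t - 1)" "x \<longlonglongrightarrow> x'" "x' \<in> state_set P (t - 1)"
  shows "(\<lambda>j. cost P t (y j, x j)) \<longlonglongrightarrow> cost P t (y', x')"
proof (rule continuous_on_tendsto_compose[OF cost_continuous[OF t]])
  show "(\<lambda>j. (y j, x j)) \<longlonglongrightarrow> (y', x')"
    by (rule tendsto_Pair[OF y(2) x(2)])
qed (use y x in \<open>auto simp: pair_set_def\<close>)

lemma val_tendsto:
  assumes t: "t \<in> {2..Suc (horizon P)}"
    and x: "\<And>j::nat. x j \<in> state_set P (t - 1)" "x \<longlonglongrightarrow> x'" "x' \<in> state_set P (t - 1)"
  shows "(\<lambda>j. val P t (x j)) \<longlonglongrightarrow> val P t x'"
proof -
  obtain L where "L-lipschitz_on (state_set P (t - 1)) (val P t)"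
    using val_lipschitz[OF t] by blast
  then have "continuous_on (state_set P (t - 1)) (val P t)"
    by (rule lipschitz_on_continuous_on)
  then show ?thesis
    by (rule continuous_on_tendsto_compose[OF _ x(2,3)]) (use x(1) in simp)
qed

lemma eps_solutionI:
  assumes xs: "xs \<in> feasible_paths P" and le: "total_cost P xs \<le> val P 1 (init P) + e"
  shows "xs \<in> eps_solutions P e"
proof -
  have "ereal (val P 1 (init P)) \<le> (INF xs\<in>feasible_paths P. ereal (total_cost P xs))"
    using val_le_path_cost by (intro INF_greatest) simp
  then have "ereal (val P 1 (init P)) + ereal e \<le> (INF xs\<in>feasible_paths P. ereal (total_cost P xs)) + ereal e"
    by (rule add_right_mono)
  moreover have "ereal (total_cost P xs) \<le> ereal (val P 1 (init P)) + ereal e"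
    using le by simp
  ultimately have "ereal (total_cost P xs) \<le> (INF xs\<in>feasible_paths P. ereal (total_cost P xs)) + ereal e"
    by (rule order_trans[rotated])
  then show ?thesis
    using xs by (simp add: eps_solutions_def eps_argmin_def)
qed

lemma init_state: "init P \<in> state_set P (1 - 1)"
  by (simp add: state_set_def)

end

section \<open>Validity and quality of the cuts\<close>

text \<open>Real version of the approximation, meaningful from the first iteration on.\<close>

definition qapp ::
    "('n::finite,'p::finite,'q::finite) dp_problem \<Rightarrow> ('n,'p,'q) iddp_run \<Rightarrow>
     nat \<Rightarrow> nat \<Rightarrow> real^'n \<Rightarrow> real" where
  "qapp P R t k x = real_of_ereal (Qapp P R t k x)"

text \<open>A stage without coupling constraints is treated as a stage with zero multipliers. This makes the cut
  data of both types the same expressions in the Lagrangian.\<close>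

definition mult_eq ::
    "('n::finite,'p::finite,'q::finite) dp_problem \<Rightarrow> ('n,'p,'q) iddp_run \<Rightarrow> nat \<Rightarrow> nat \<Rightarrow> real^'q" where
  "mult_eq P R t k = (if typeS2 P t then dual_eq R t k else 0)"

definition mult_ineq ::
    "('n::finite,'p::finite,'q::finite) dp_problem \<Rightarrow> ('n,'p,'q) iddp_run \<Rightarrow> nat \<Rightarrow> nat \<Rightarrow> real^'p" where
  "mult_ineq P R t k = (if typeS2 P t then dual_ineq R t k else 0)"

definition lagr ::
    "('n::finite,'p::finite,'q::finite) dp_problem \<Rightarrow> nat \<Rightarrow> real^'q \<Rightarrow> real^'p \<Rightarrow>
     real^'n \<Rightarrow> real^'n \<Rightarrow> real" where
  "lagr P t l m y x = cost P t (y, x) + l \<bullet> eq_res P t y x + m \<bullet> ineq P t (y, x)"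

definition lagr_grad1 ::
    "('n::finite,'p::finite,'q::finite) dp_problem \<Rightarrow> nat \<Rightarrow> real^'q \<Rightarrow> real^'p \<Rightarrow>
     real^'n \<Rightarrow> real^'n \<Rightarrow> real^'n" where
  "lagr_grad1 P t l m y x = fst (cost_grad P t (y, x)) + transpose (matA P t) *v l
     + (\<Sum>i\<in>UNIV. (m $ i) *\<^sub>R fst (ineq_grad P t i (y, x)))"

definition lagr_grad2 ::
    "('n::finite,'p::finite,'q::finite) dp_problem \<Rightarrow> nat \<Rightarrow> real^'q \<Rightarrow> real^'p \<Rightarrow>
     real^'n \<Rightarrow> real^'n \<Rightarrow> real^'n" where
  "lagr_grad2 P t l m y x = snd (cost_grad P t (y, x)) + transpose (matB P t) *v l
     + (\<Sum>i\<in>UNIV. (m $ i) *\<^sub>R snd (ineq_grad P t i (y, x)))"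

lemma qapp_after_horizon: "horizon P < t \<Longrightarrow> qapp P R t k x = 0"
  by (simp add: qapp_def Qapp_def)

lemma Qapp_eq_qapp: "1 \<le> k \<Longrightarrow> Qapp P R t k x = ereal (qapp P R t k x)"
  by (auto simp: qapp_def Qapp_def zero_ereal_def)

lemma qapp_eq_Max: "1 \<le> k \<Longrightarrow> t \<le> horizon P \<Longrightarrow> qapp P R t k x = (MAX j\<in>{1..k}. cut R t j x)"
  by (simp add: qapp_def Qapp_def)

lemma cut_le_qapp: "1 \<le> j \<Longrightarrow> j \<le> k \<Longrightarrow> t \<le> horizon P \<Longrightarrow> cut R t j x \<le> qapp P R t k x"
  by (subst qapp_eq_Max) (auto intro!: Max_ge)

lemma qapp_mono: "1 \<le> j \<Longrightarrow> j \<le> k \<Longrightarrow> qapp P R t j x \<le> qapp P R t k x"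
proof (cases "t \<le> horizon P")
  case True
  assume "1 \<le> j" "j \<le> k"
  then show ?thesis
    using True by (subst qapp_eq_Max) (auto simp: cut_le_qapp)
qed (simp add: qapp_after_horizon)

lemma qapp_lipschitz:
  assumes k: "1 \<le> k" and L: "0 \<le> L" "\<And>j. 1 \<le> j \<Longrightarrow> j \<le> k \<Longrightarrow> t \<le> horizon P \<Longrightarrow> norm (beta R t j) \<le> L"
  shows "L-lipschitz_on X (qapp P R t k)"
proof (cases "t \<le> horizon P")
  case True
  have half: "qapp P R t k x - L * dist x y \<le> qapp P R t k y" for x y
  proof -
    have "qapp P R t k x \<le> qapp P R t k y + L * dist x y"
    proof (subst qapp_eq_Max[OF k True], rule Max.boundedI)
      fix a assume "a \<in> (\<lambda>j. cut R t j x) ` {1..k}"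
      then obtain j where j: "1 \<le> j" "j \<le> k" "a = cut R t j x"
        by auto
      have "a = cut R t j y + beta R t j \<bullet> (x - y)"
        by (simp add: j(3) cut_def inner_diff_right)
      also have "beta R t j \<bullet> (x - y) \<le> norm (beta R t j) * norm (x - y)"
        by (rule norm_cauchy_schwarz)
      also have "\<dots> \<le> L * dist x y"
        using L(2)[OF j(1,2) True] by (simp add: dist_norm mult_right_mono)
      also have "cut R t j y \<le> qapp P R t k y"
        by (rule cut_le_qapp[OF j(1,2) True])
      finally show "a \<le> qapp P R t k y + L * dist x y"
        by simp
    qed (use k in auto)
    then show ?thesis by simp
  qed
  show ?thesis
  proof (rule lipschitz_onI[OF _ L(1)])
    show "dist (qapp P R t k x) (qapp P R t k y) \<le> L * dist x y" for x y
      using half[of x y] half[of y x] by (simp add: dist_real_def abs_le_iff dist_commute)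
  qed
next
  case False
  then show ?thesis
    using L(1) by (intro lipschitz_onI) (auto simp: qapp_after_horizon)
qed

lemma qapp_continuous:
  assumes k: "1 \<le> k"
  shows "continuous_on X (qapp P R t k)"
proof (rule lipschitz_on_continuous_on[OF qapp_lipschitz[OF k, where L = "\<Sum>j\<in>{1..k}. norm (beta R t j)"]])
  show "norm (beta R t j) \<le> (\<Sum>j\<in>{1..k}. norm (beta R t j))" if "1 \<le> j" "j \<le> k" for j
    using that by (intro member_le_sum) auto
qed (simp add: sum_nonneg)

lemma qapp_convex:
  assumes k: "1 \<le> k" and X: "convex X"
  shows "convex_on X (qapp P R t k)"
proof (rule convex_onI[OF _ X])
  fix s :: real and x y assume s: "0 < s" "s < 1"
  show "qapp P R t k ((1 - s) *\<^sub>R x + s *\<^sub>R y) \<le> (1 - s) * qapp P R t k x + s * qapp P R t k y"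
  proof (cases "t \<le> horizon P")
    case False
    then show ?thesis by (simp add: qapp_after_horizon)
  next
    case True
    show ?thesis
    proof (subst qapp_eq_Max[OF k True], rule Max.boundedI)
      fix a assume "a \<in> (\<lambda>j. cut R t j ((1 - s) *\<^sub>R x + s *\<^sub>R y)) ` {1..k}"
      then obtain j where j: "1 \<le> j" "j \<le> k" "a = cut R t j ((1 - s) *\<^sub>R x + s *\<^sub>R y)"
        by auto
      have "a = (1 - s) * cut R t j x + s * cut R t j y"
        by (simp add: j(3) cut_def algebra_simps)
      also have "\<dots> \<le> (1 - s) * qapp P R t k x + s * qapp P R t k y"
        using s cut_le_qapp[OF j(1,2) True] by (intro add_mono mult_left_mono) auto
      finally show "a \<le> (1 - s) * qapp P R t k x + s * qapp P R t k y" .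
    qed (use k in auto)
  qed
qed

context regular_dp
begin

text \<open>The inequality constraints contribute only through nonnegative multiples of convex functions. On
  stages without coupling constraints, where \<open>ineq\<close> is arbitrary, the multiplier is zero.\<close>

lemma lagr_tangent:
  assumes t: "t \<in> {1..horizon P}" and yx: "(y, x) \<in> pair_set P t" and yx': "(y', x') \<in> pair_set P t"
    and m: "\<And>i. 0 \<le> m $ i" "typeS2 P t \<or> m = 0"
  shows "lagr P t l m y x + lagr_grad1 P t l m y x \<bullet> (y' - y) + lagr_grad2 P t l m y x \<bullet> (x' - x)
           \<le> lagr P t l m y' x'"
proof -
  have tangent: "f (y, x) + fst (G (y, x)) \<bullet> (y' - y) + snd (G (y, x)) \<bullet> (x' - x) \<le> f (y', x')"
    if "convex_on (pair_set P t) f" "C1_on (pair_set P t) f G" for f G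
  proof -
    have "f (y, x) + G (y, x) \<bullet> ((y', x') - (y, x)) \<le> f (y', x')"
      using that yx by (intro convex_on_tangent_le[OF that(1) yx yx']) (auto simp: C1_on_def)
    then show ?thesis
      by (cases "G (y, x)") simp
  qed
  have inner_expand: "m \<bullet> g = (\<Sum>i\<in>UNIV. m $ i * g $ i)" for g
    by (simp add: inner_vec_def)
  have "m $ i * (ineq P t (y, x) $ i + fst (ineq_grad P t i (y, x)) \<bullet> (y' - y)
      + snd (ineq_grad P t i (y, x)) \<bullet> (x' - x)) \<le> m $ i * ineq P t (y', x') $ i" for i
  proof (cases "typeS2 P t")
    case True
    show ?thesis
      using tangent[OF ineq[OF t True]] m(1) by (rule mult_left_mono)
  next
    case False
    then show ?thesis using m(2) by simp
  qed
  then have "(\<Sum>i\<in>UNIV. m $ i * (ineq P t (y, x) $ i + fst (ineq_grad P t i (y, x)) \<bullet> (y' - y)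
      + snd (ineq_grad P t i (y, x)) \<bullet> (x' - x))) \<le> (\<Sum>i\<in>UNIV. m $ i * ineq P t (y', x') $ i)"
    by (rule sum_mono)
  then have "m \<bullet> ineq P t (y, x) + (\<Sum>i\<in>UNIV. (m $ i) *\<^sub>R fst (ineq_grad P t i (y, x))) \<bullet> (y' - y)
      + (\<Sum>i\<in>UNIV. (m $ i) *\<^sub>R snd (ineq_grad P t i (y, x))) \<bullet> (x' - x) \<le> m \<bullet> ineq P t (y', x')"
    unfolding inner_expand by (simp add: inner_sum_left distrib_left sum.distrib)
  moreover have "l \<bullet> eq_res P t y x + (transpose (matA P t) *v l) \<bullet> (y' - y)
      + (transpose (matB P t) *v l) \<bullet> (x' - x) = l \<bullet> eq_res P t y' x'"
    by (simp add: dot_lmul_matrix eq_res_def matrix_vector_mult_diff_distrib inner_diff_right inner_add_right)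
  moreover have "cost P t (y, x) + fst (cost_grad P t (y, x)) \<bullet> (y' - y)
      + snd (cost_grad P t (y, x)) \<bullet> (x' - x) \<le> cost P t (y', x')"
    by (rule tangent[OF cost[OF t]])
  ultimately show ?thesis
    unfolding lagr_def lagr_grad1_def lagr_grad2_def inner_add_left by linarith
qed

lemma lagr_le_cost:
  assumes "y \<in> feas P t x" "\<And>i. 0 \<le> m $ i" "typeS2 P t \<or> (l = 0 \<and> m = 0)"
  shows "lagr P t l m y x \<le> cost P t (y, x)"
proof (cases "typeS2 P t")
  case True
  then have "eq_res P t y x = 0" "\<And>i. ineq P t (y, x) $ i \<le> 0"
    using assms(1) by (auto simp: feas_def)
  moreover from this(2) have "m \<bullet> ineq P t (y, x) \<le> 0"
    unfolding inner_vec_def using assms(2) by (auto intro!: sum_nonpos mult_nonneg_nonpos)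
  ultimately show ?thesis
    by (simp add: lagr_def)
next
  case False
  then show ?thesis
    using assms(3) by (simp add: lagr_def)
qed

end

locale iddp = regular_dp P
  for P :: "('n::finite,'p::finite,'q::finite) dp_problem" +
  fixes \<epsilon> :: "nat \<Rightarrow> nat \<Rightarrow> real" and R :: "('n,'p,'q) iddp_run"
  assumes run: "is_iddp_run P \<epsilon> R"
begin

abbreviation "Q \<equiv> qapp P R"
abbreviation "lam \<equiv> mult_eq P R"
abbreviation "mu \<equiv> mult_ineq P R"

lemma noise_nonneg: "1 \<le> k \<Longrightarrow> t \<in> {1..horizon P} \<Longrightarrow> 0 \<le> \<epsilon> t k"
  using run by (auto simp: is_iddp_run_def)

lemma fwd_init: "1 \<le> k \<Longrightarrow> fwd R 0 k = init P"
  using run by (auto simp: is_iddp_run_def)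

lemma forward: "1 \<le> k \<Longrightarrow> t \<in> {1..horizon P} \<Longrightarrow> forward_step P \<epsilon> R t k"
  using run by (auto simp: is_iddp_run_def)

lemma backward: "1 \<le> k \<Longrightarrow> t \<in> {2..horizon P} \<Longrightarrow> backward_step P \<epsilon> R t k"
  using run by (auto simp: is_iddp_run_def)

lemma fwd_feas: "1 \<le> k \<Longrightarrow> t \<in> {1..horizon P} \<Longrightarrow> fwd R t k \<in> feas P t (fwd R (t - 1) k)"
  using forward[of k t] by (auto simp: forward_step_def eps_argmin_def)

lemma fwd_state:
  assumes "1 \<le> k" "t \<le> horizon P"
  shows "fwd R t k \<in> state_set P t"
proof (cases "t = 0")
  case True
  then show ?thesis
    using assms by (simp add: state_set_def fwd_init)
next
  case False
  then show ?thesis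
    using fwd_feas[of k t] assms feas_subset by auto
qed

lemma fwd_opt:
  assumes k: "2 \<le> k" and t: "t \<in> {1..horizon P}" and y: "y \<in> feas P t (fwd R (t - 1) k)"
  shows "cost P t (fwd R t k, fwd R (t - 1) k) + Q (Suc t) (k - 1) (fwd R t k)
           \<le> cost P t (y, fwd R (t - 1) k) + Q (Suc t) (k - 1) y + \<epsilon> t k"
proof -
  have "fwd R t k \<in> eps_argmin (\<epsilon> t k) (\<lambda>y. Fapp P R t (k - 1) y (fwd R (t - 1) k))
          (feas P t (fwd R (t - 1) k))"
    using forward[of k t] k t by (auto simp: forward_step_def)
  from eps_argmin_le[OF this y] show ?thesis
    using k by (simp add: Fapp_def Qapp_eq_qapp)
qed

lemma bwd_argmin:
  "1 \<le> k \<Longrightarrow> t \<in> {2..horizon P} \<Longrightarrow>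
    bwd R t k \<in> eps_argmin (\<epsilon> t k) (\<lambda>y. Fapp P R t k y (fwd R (t - 1) k)) (feas P t (fwd R (t - 1) k))"
  using backward[of k t] by (simp add: backward_step_def Let_def)

lemma bwd_feas: "1 \<le> k \<Longrightarrow> t \<in> {2..horizon P} \<Longrightarrow> bwd R t k \<in> feas P t (fwd R (t - 1) k)"
  using bwd_argmin[of k t] by (simp add: eps_argmin_def)

lemma bwd_opt:
  assumes "1 \<le> k" "t \<in> {2..horizon P}" "y \<in> feas P t (fwd R (t - 1) k)"
  shows "cost P t (bwd R t k, fwd R (t - 1) k) + Q (Suc t) k (bwd R t k)
           \<le> cost P t (y, fwd R (t - 1) k) + Q (Suc t) k y + \<epsilon> t k"
  using eps_argmin_le[OF bwd_argmin[OF assms(1,2)] assms(3)] assms(1)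
  by (simp add: Fapp_def Qapp_eq_qapp)

lemma dual_argmax:
  "1 \<le> k \<Longrightarrow> t \<in> {2..horizon P} \<Longrightarrow> typeS2 P t \<Longrightarrow>
    (lam t k, mu t k) \<in> eps_argmax (\<epsilon> t k) (dual_fun P R t k (fwd R (t - 1) k)) (dual_dom P t (fwd R (t - 1) k))"
  using backward[of k t] by (simp add: backward_step_def Let_def mult_eq_def mult_ineq_def)

lemma multipliers:
  assumes "1 \<le> k" "t \<in> {2..horizon P}"
  shows "0 \<le> mu t k $ i" "typeS2 P t \<or> mu t k = 0" "typeS2 P t \<or> (lam t k = 0 \<and> mu t k = 0)"
proof -
  show "0 \<le> mu t k $ i"
    using dual_argmax[OF assms] by (cases "typeS2 P t") (auto simp: eps_argmax_def dual_dom_def mult_ineq_def)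
qed (auto simp: mult_eq_def mult_ineq_def)

text \<open>The term \<open>l \<bullet> eq_res\<close> of the Lagrangian vanishes at the feasible point
  \<open>bwd R t k\<close>, which is why \<open>theta\<close> is the Lagrangian.\<close>

lemma cut_data:
  assumes k: "1 \<le> k" and t: "t \<in> {2..horizon P}"
  defines "x \<equiv> fwd R (t - 1) k" and "y \<equiv> bwd R t k"
  shows "theta R t k = lagr P t (lam t k) (mu t k) y x + Q (Suc t) k y"
    "beta R t k = lagr_grad2 P t (lam t k) (mu t k) y x"
    "eta R t k = (SUP z\<in>state_set P t. lagr_grad1 P t (lam t k) (mu t k) y x \<bullet> (y - z) + Q (Suc t) k y - Q (Suc t) k z)"
proof -
  have "typeS2 P t \<Longrightarrow> eq_res P t y x = 0"
    using bwd_feas[OF k t] by (simp add: feas_def x_def y_def)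
  then show "theta R t k = lagr P t (lam t k) (mu t k) y x + Q (Suc t) k y"
    "beta R t k = lagr_grad2 P t (lam t k) (mu t k) y x"
    "eta R t k = (SUP z\<in>state_set P t. lagr_grad1 P t (lam t k) (mu t k) y x \<bullet> (y - z) + Q (Suc t) k y - Q (Suc t) k z)"
    using backward[OF k t] unfolding backward_step_def Let_def
    by (auto simp: x_def y_def lagr_def lagr_grad1_def lagr_grad2_def mult_eq_def mult_ineq_def qapp_def
        eta_of_def split: if_splits)
qed

lemma bwd_pair: "1 \<le> k \<Longrightarrow> t \<in> {2..horizon P} \<Longrightarrow> (bwd R t k, fwd R (t - 1) k) \<in> pair_set P t"
  using fwd_state[of k "t - 1"] by (intro feas_pair bwd_feas) auto

lemma eta_ge:
  assumes k: "1 \<le> k" and t: "t \<in> {2..horizon P}" and z: "z \<in> state_set P t"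
  shows "lagr_grad1 P t (lam t k) (mu t k) (bwd R t k) (fwd R (t - 1) k) \<bullet> (bwd R t k - z)
           + Q (Suc t) k (bwd R t k) - Q (Suc t) k z \<le> eta R t k"
  unfolding cut_data(3)[OF k t]
proof (rule cSUP_upper[OF z])
  let ?g = "\<lambda>z. lagr_grad1 P t (lam t k) (mu t k) (bwd R t k) (fwd R (t - 1) k) \<bullet> (bwd R t k - z)
           + Q (Suc t) k (bwd R t k) - Q (Suc t) k z"
  have "continuous_on (state_set P t) ?g"
    by (intro continuous_intros qapp_continuous k)
  moreover have "compact (state_set P t)"
    using state_set t by auto
  ultimately show "bdd_above (?g ` state_set P t)"
    by (intro bounded_imp_bdd_above compact_imp_bounded compact_continuous_image)
qed

lemma eta_le:
  assumes k: "1 \<le> k" and t: "t \<in> {2..horizon P}"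
    and le: "\<And>z. z \<in> state_set P t \<Longrightarrow> lagr_grad1 P t (lam t k) (mu t k) (bwd R t k) (fwd R (t - 1) k) \<bullet> (bwd R t k - z)
           + Q (Suc t) k (bwd R t k) - Q (Suc t) k z \<le> B"
  shows "eta R t k \<le> B"
  unfolding cut_data(3)[OF k t] using state_set(1)[of t] t le by (intro cSUP_least) auto

lemma eta_nonneg: "1 \<le> k \<Longrightarrow> t \<in> {2..horizon P} \<Longrightarrow> 0 \<le> eta R t k"
  using eta_ge[of k t "bwd R t k"] bwd_feas[of k t] feas_subset by auto

text \<open>Validity of the cut. The tangent of the Lagrangian at the backward point, evaluated at \<open>(y,
  x)\<close>, contains the partial gradient in \<open>y\<close>, which would vanish against \<open>Q
  (Suc t) k\<close> only for exact minimizers; \<open>eta\<close> is the worst value of this term over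
  the whole state set. For feasible \<open>y\<close> the Lagrangian is below the cost.\<close>

lemma cut_le:
  assumes k: "1 \<le> k" and t: "t \<in> {2..horizon P}" and x: "x \<in> state_set P (t - 1)" and y: "y \<in> feas P t x"
  shows "cut R t k x \<le> cost P t (y, x) + Q (Suc t) k y"
proof -
  have t1: "t \<in> {1..horizon P}" and yX: "y \<in> state_set P t"
    using t y feas_subset by auto
  have "lagr P t (lam t k) (mu t k) y x \<le> cost P t (y, x)"
    by (rule lagr_le_cost[OF y multipliers(1,3)[OF k t]])
  then show ?thesis
    using lagr_tangent[OF t1 bwd_pair[OF k t] feas_pair[OF x y] multipliers(1,2)[OF k t]]
      eta_ge[OF k t yX]
    unfolding cut_def cut_data(1,2)[OF k t] inner_diff_right by (smt (verit))
qed

text \<open>The approximation of stage \<open>t\<close> is built from that of stage \<open>t + 1\<close>, so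
  validity propagates backwards in time.\<close>

lemma qapp_le_val:
  assumes k: "1 \<le> k" and "t \<in> {2..Suc (horizon P)}" "x \<in> state_set P (t - 1)"
  shows "Q t k x \<le> val P t x"
proof -
  have "t \<le> Suc (horizon P)" "2 \<le> t"
    using assms by auto
  then show ?thesis
    using assms(3)
  proof (induction arbitrary: x rule: inc_induct)
    case base
    then show ?case by (simp add: qapp_after_horizon val_after_horizon)
  next
    case (step s)
    then have s: "s \<in> {2..horizon P}" "s \<in> {1..horizon P}" "s \<le> horizon P"
      by auto
    show ?case
    proof (subst qapp_eq_Max[OF k s(3)], rule Max.boundedI)
      fix a assume "a \<in> (\<lambda>j. cut R s j x) ` {1..k}"
      then obtain j where j: "1 \<le> j" "j \<le> k" "a = cut R s j x"
        by auto
      show "a \<le> val P s x"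
      proof (rule val_greatest[OF s(2) step.prems(2)])
        fix y assume y: "y \<in> feas P s x"
        have "a \<le> cost P s (y, x) + Q (Suc s) j y"
          unfolding j(3) by (rule cut_le[OF j(1) s(1) step.prems(2) y])
        also have "Q (Suc s) j y \<le> Q (Suc s) k y"
          by (rule qapp_mono[OF j(1,2)])
        also have "Q (Suc s) k y \<le> val P (Suc s) y"
          using step.IH[of y] y feas_subset s by auto
        finally show "a \<le> cost P s (y, x) + val P (Suc s) y"
          by simp
      qed
    qed (use k in auto)
  qed
qed

lemma slater_point:
  assumes "t \<in> {2..horizon P}" "typeS2 P t" "x \<in> state_set P (t - 1)"
  obtains v r \<kappa> where "v \<in> state_set P t" "0 < r" "cball v r \<inter> affine hull state_set P t \<subseteq> state_set P t"
    "eq_res P t v x = 0" "0 < \<kappa>" "\<And>i. ineq P t (v, x) $ i \<le> - \<kappa>"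
  using H2 assms unfolding H2_def H2_at_def by metis

text \<open>Strong duality for the stage problem in which the value function is replaced by its approximation.\<close>

lemma dual_value_ge:
  assumes k: "1 \<le> k" and t: "t \<in> {2..horizon P}" and S2: "typeS2 P t"
    and x: "x \<in> state_set P (t - 1)"
    and p: "\<And>y. y \<in> feas P t x \<Longrightarrow> p \<le> cost P t (y, x) + Q (Suc t) k y"
  shows "ereal p \<le> (SUP z\<in>dual_dom P t x. dual_fun P R t k x z)"
proof -
  let ?X = "state_set P t"
  have t1: "t \<in> {1..horizon P}" and tT: "t \<le> horizon P"
    using t by auto
  obtain v r \<kappa> where v: "v \<in> ?X" "0 < r" "cball v r \<inter> affine hull ?X \<subseteq> ?X" "eq_res P t v x = 0"
      "0 < \<kappa>" "\<And>i. ineq P t (v, x) $ i \<le> - \<kappa>"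
    using slater_point[OF t S2 x] by metis
  have V: "subspace (dir_space ?X)"
    by (rule subspace_dir_space[OF state_set(1)[OF tT]])
  have slice: "convex_on ?X (\<lambda>y. f (y, x))" if "convex_on (pair_set P t) f" for f
    using convex_on_slice[OF that[unfolded pair_set_def] x] .
  have ri: "\<exists>s>0. v + s *\<^sub>R u \<in> ?X" if u: "u \<in> dir_space ?X" for u
  proof (intro exI conjI)
    let ?s = "r / (norm u + 1)"
    have pos: "0 < norm u + 1"
      by (simp add: add_nonneg_pos)
    then show "0 < ?s"
      using v(2) by simp
    have "?s * norm u \<le> ?s * (norm u + 1)"
      using pos v(2) by (intro mult_left_mono) auto
    then have "norm (?s *\<^sub>R u) \<le> r"
      using pos v(2) by simp
    moreover have "v + ?s *\<^sub>R u \<in> affine hull ?X"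
      using v(1) u V by (intro add_dir_space_affine_hull subspace_scale) (auto intro: hull_inc)
    ultimately show "v + ?s *\<^sub>R u \<in> ?X"
      using v(3) by (auto simp: dist_norm)
  qed
  obtain l m where lm: "l \<in> (*v) (matA P t) ` dir_space ?X" "\<And>i. 0 \<le> m $ i"
    "\<And>y. y \<in> ?X \<Longrightarrow> p \<le> (cost P t (y, x) + Q (Suc t) k y) + l \<bullet> eq_res P t y x + m \<bullet> ineq P t (y, x)"
  proof (rule slater_strong_duality[of ?X "\<lambda>y. cost P t (y, x) + Q (Suc t) k y" "\<lambda>y. ineq P t (y, x)"
        "\<lambda>y. eq_res P t y x" "matA P t" v p])
    show "convex ?X"
      by (rule state_set(2)[OF tT])
    show "convex_on ?X (\<lambda>y. cost P t (y, x) + Q (Suc t) k y)"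
      by (intro convex_on_add slice cost t1 qapp_convex k state_set(2) tT)
    show "convex_on ?X (\<lambda>y. ineq P t (y, x) $ i)" for i
      by (rule slice[OF ineq(1)[OF t1 S2]])
    show "eq_res P t y x = matA P t *v (y - v)" for y
      using eq_res_diff_left[of P t y x v] v(4) by simp
    show "ineq P t (v, x) $ i < 0" for i
      using v(5) v(6)[of i] by linarith
    show "p \<le> cost P t (y, x) + Q (Suc t) k y"
      if "y \<in> ?X" "eq_res P t y x = 0" "\<And>i. ineq P t (y, x) $ i \<le> 0" for y
      using p[of y] that S2 by (simp add: feas_def)
  qed (use v(1) ri in blast)+
  obtain u where u: "u \<in> dir_space ?X" "l = matA P t *v u"
    using lm(1) by auto
  have "v + u \<in> affine hull ?X"
    using v(1) u(1) by (intro add_dir_space_affine_hull) (auto intro: hull_inc)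
  moreover have "l = eq_res P t (v + u) x"
    using eq_res_diff_left[of P t "v + u" x v] v(4) u(2) by simp
  ultimately have dom: "(l, m) \<in> dual_dom P t x"
    using lm(2) by (auto simp: dual_dom_def)
  have "ereal p \<le> dual_fun P R t k x (l, m)"
    unfolding dual_fun_def using lm(3) k
    by (auto simp: Fapp_def Qapp_eq_qapp add.assoc intro!: INF_greatest)
  also have "\<dots> \<le> (SUP z\<in>dual_dom P t x. dual_fun P R t k x z)"
    by (rule SUP_upper[OF dom])
  finally show ?thesis .
qed

text \<open>Any lower bound \<open>p\<close> of the stage problem is, up to the noise in the dual solution, a
  lower bound of the Lagrangian on the whole state set. It will be used with \<open>p\<close> derived
  from the forward pass, from the backward point and from the first iteration.\<close>

lemma near_saddle:
  assumes k: "1 \<le> k" and t: "t \<in> {2..horizon P}"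
    and p: "\<And>y. y \<in> feas P t (fwd R (t - 1) k) \<Longrightarrow> p \<le> cost P t (y, fwd R (t - 1) k) + Q (Suc t) k y"
    and y: "y \<in> state_set P t"
  shows "p \<le> lagr P t (lam t k) (mu t k) y (fwd R (t - 1) k) + Q (Suc t) k y
           + (if typeS2 P t then \<epsilon> t k else 0)"
proof (cases "typeS2 P t")
  case False
  then show ?thesis
    using p[of y] y by (simp add: feas_def lagr_def mult_eq_def mult_ineq_def)
next
  case True
  let ?x = "fwd R (t - 1) k"
  have x: "?x \<in> state_set P (t - 1)"
    using fwd_state[of k "t - 1"] k t by auto
  have "ereal p \<le> (SUP z\<in>dual_dom P t ?x. dual_fun P R t k ?x z)"
    by (rule dual_value_ge[OF k t True x p])
  also have "\<dots> \<le> dual_fun P R t k ?x (lam t k, mu t k) + ereal (\<epsilon> t k)"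
    using dual_argmax[OF k t True] by (simp add: eps_argmax_def)
  also have "dual_fun P R t k ?x (lam t k, mu t k)
      \<le> Fapp P R t k y ?x + ereal (lam t k \<bullet> eq_res P t y ?x + mu t k \<bullet> ineq P t (y, ?x))"
    unfolding dual_fun_def by (auto intro!: INF_lower2[OF y])
  also have "\<dots> = ereal (lagr P t (lam t k) (mu t k) y ?x + Q (Suc t) k y)"
    using k by (simp add: Fapp_def Qapp_eq_qapp lagr_def)
  finally show ?thesis
    using True by (simp add: add_right_mono)
qed

text \<open>Loss of the cut at the point where it is built, relative to the value found in the forward pass: the
  primal noise, the dual noise if there is a dual problem, and the correction that makes the cut
  valid.\<close>

definition err :: "nat \<Rightarrow> nat \<Rightarrow> real" where
  "err t k = \<epsilon> t k + (if typeS2 P t then \<epsilon> t k else 0) + eta R t k"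

text \<open>The forward value computed with the old approximation is, up to \<open>\<epsilon> t k\<close>, a
  lower bound of the stage problem with the new, larger approximation. By \<open>near_saddle\<close>,
  \<open>theta\<close> exceeds this bound up to the dual noise, and the value of the new cut at its
  base point is \<open>theta - eta\<close>.\<close>

lemma qapp_recursion:
  assumes k: "2 \<le> k" and t: "t \<in> {2..horizon P}"
  shows "cost P t (fwd R t k, fwd R (t - 1) k) + Q (Suc t) (k - 1) (fwd R t k) - err t k
           \<le> Q t k (fwd R (t - 1) k)"
proof -
  let ?x = "fwd R (t - 1) k"
  define p where "p = cost P t (fwd R t k, ?x) + Q (Suc t) (k - 1) (fwd R t k) - \<epsilon> t k"
  have k1: "1 \<le> k" and t1: "t \<in> {1..horizon P}" and tT: "t \<le> horizon P"
    using k t by auto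
  have "p \<le> cost P t (y, ?x) + Q (Suc t) k y" if "y \<in> feas P t ?x" for y
  proof -
    have "Q (Suc t) (k - 1) y \<le> Q (Suc t) k y"
      using k by (intro qapp_mono) auto
    then show ?thesis
      using fwd_opt[OF k t1 that] by (simp add: p_def)
  qed
  moreover have "bwd R t k \<in> state_set P t"
    using bwd_feas[OF k1 t] feas_subset by blast
  ultimately have "p \<le> theta R t k + (if typeS2 P t then \<epsilon> t k else 0)"
    unfolding cut_data(1)[OF k1 t] by (rule near_saddle[OF k1 t])
  moreover have "theta R t k - eta R t k \<le> Q t k ?x"
    using cut_le_qapp[OF k1 order_refl tT, of R ?x] by (simp add: cut_def)
  ultimately show ?thesis
    by (simp add: p_def err_def)
qed

end

section \<open>Bounds on multipliers, cut slopes and corrections\<close>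

text \<open>All terms are charged to the same constant, so that only the total size of the two multipliers
  matters; this total is what the Slater condition controls.\<close>

lemma multiplier_combination_norm:
  fixes E :: "real^'q^'n" and m :: "real^'p" and w :: "'p \<Rightarrow> real^'n"
  assumes c: "norm c \<le> M" and w: "\<And>i. norm (w i) \<le> N" and m: "\<And>i. 0 \<le> m $ i"
    and U: "norm l + (\<Sum>i\<in>UNIV. m $ i) \<le> U"
  shows "norm (c + E *v l + (\<Sum>i\<in>UNIV. (m $ i) *\<^sub>R w i))
           \<le> M + sqrt 2 * max (onorm ((*v) E)) (N * sqrt (real CARD('p))) * U"
proof -
  define K where "K = max (onorm ((*v) E)) (N * sqrt (real CARD('p)))"
  have N0: "0 \<le> N"
    using norm_ge_zero w order_trans by blast
  have "1 \<le> CARD('p)"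
    using zero_less_card_finite[where 'a = 'p] by linarith
  then have "N * 1 \<le> N * sqrt (real CARD('p))"
    using N0 by (intro mult_left_mono) auto
  then have NK: "N \<le> K"
    by (simp add: K_def)
  have K0: "0 \<le> K"
    using N0 NK by simp
  have U0: "0 \<le> U"
    using U m by (smt (verit) norm_ge_zero sum_nonneg)
  have "norm (E *v l) \<le> onorm ((*v) E) * norm l"
    by (rule onorm[OF matrix_vector_mul_bounded_linear])
  also have "\<dots> \<le> K * norm l"
    by (intro mult_right_mono) (simp_all add: K_def)
  finally have 1: "norm (E *v l) \<le> K * norm l" .
  have "norm (\<Sum>i\<in>UNIV. (m $ i) *\<^sub>R w i) \<le> (\<Sum>i\<in>UNIV. m $ i * K)"
  proof (rule sum_norm_le)
    show "norm ((m $ i) *\<^sub>R w i) \<le> m $ i * K" for i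
      using m[of i] order_trans[OF w NK] by (simp add: mult_left_mono)
  qed
  then have 2: "norm (\<Sum>i\<in>UNIV. (m $ i) *\<^sub>R w i) \<le> K * (\<Sum>i\<in>UNIV. m $ i)"
    by (simp add: sum_distrib_left mult.commute)
  have "K * norm l + K * (\<Sum>i\<in>UNIV. m $ i) \<le> K * U"
    using mult_left_mono[OF U K0] by (simp add: distrib_left)
  also have "\<dots> \<le> sqrt 2 * (K * U)"
    using mult_right_mono[of 1 "sqrt 2" "K * U"] K0 U0 by simp
  finally have "norm (c + E *v l + (\<Sum>i\<in>UNIV. (m $ i) *\<^sub>R w i)) \<le> M + sqrt 2 * (K * U)"
    using norm_triangle_ineq[of "c + E *v l" "\<Sum>i\<in>UNIV. (m $ i) *\<^sub>R w i"] norm_triangle_ineq[of c "E *v l"]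
      1 2 c by linarith
  then show ?thesis
    by (simp add: K_def mult.assoc)
qed

locale bounded_iddp = iddp P \<epsilon> R
  for P :: "('n::finite,'p::finite,'q::finite) dp_problem" and \<epsilon> and R :: "('n,'p,'q) iddp_run" +
  fixes C :: bound_consts and \<epsilon>bar :: "nat \<Rightarrow> real"
  assumes valid: "valid_consts P C"
    and noise_bound: "\<And>t k. t \<in> {1..horizon P} \<Longrightarrow> 1 \<le> k \<Longrightarrow> \<epsilon> t k \<le> \<epsilon>bar t"
begin

lemma M2_bound: "t \<in> {2..horizon P} \<Longrightarrow> z \<in> pair_set P t \<Longrightarrow> norm (cost_grad P t z) \<le> M2 C t"
  using valid by (auto simp: valid_consts_def)

lemma S2_consts:
  assumes "t \<in> {2..horizon P}" "typeS2 P t"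
  shows "\<And>i z. z \<in> pair_set P t \<Longrightarrow> norm (ineq_grad P t i z) \<le> M3 C t"
    "slater_consts P t (Lg C t) (kap C t) (rad C t) (rho C t)"
    "0 \<le> Lf C t" "0 \<le> LQ C (Suc t)"
  using valid assms unfolding valid_consts_def slater_consts_def
  by (auto dest: lipschitz_on_nonneg)

text \<open>The supremum in \<open>U_bound\<close> is taken in the extended reals; it is finite, and so is a
  genuine bound after the conversion to a real number.\<close>

lemma cost_plus_val_le_SUP:
  assumes t: "t \<in> {2..horizon P}" and z: "(y, x) \<in> pair_set P t"
  shows "cost P t (y, x) + val P (Suc t) y
           \<le> real_of_ereal (SUP (y, x)\<in>pair_set P t. ereal (cost P t (y, x)) + value_fun P (Suc t) y)"
proof -
  have t1: "t \<in> {1..horizon P}" "Suc t \<in> {1..Suc (horizon P)}"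
    using t by auto
  let ?g = "\<lambda>(y, x). cost P t (y, x) + val P (Suc t) y"
  obtain B where B: "\<And>z. z \<in> pair_set P t \<Longrightarrow> \<bar>cost P t z\<bar> \<le> B"
    using cost_bounded[OF t1(1)] by blast
  obtain D where D: "\<And>y. y \<in> state_set P t \<Longrightarrow> \<bar>val P (Suc t) y\<bar> \<le> D"
    using val_bounded[OF t1(2)] by auto
  have "?g (y, x) \<le> real_of_ereal (SUP z\<in>pair_set P t. ereal (?g z))"
  proof (rule SUP_ereal_ge[OF pair_set(3)[OF t1(1)] _ z])
    fix z assume "z \<in> pair_set P t"
    moreover obtain a b where z: "z = (a, b)" by (cases z)
    ultimately have "\<bar>cost P t (a, b)\<bar> \<le> B" "\<bar>val P (Suc t) a\<bar> \<le> D"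
      using B D by (auto simp: pair_set_def)
    then show "\<bar>?g z\<bar> \<le> B + D"
      by (simp add: z)
  qed
  moreover have "(SUP z\<in>pair_set P t. ereal (?g z))
      = (SUP (y, x)\<in>pair_set P t. ereal (cost P t (y, x)) + value_fun P (Suc t) y)"
    using value_fun_eq_val[OF t1(2)] by (intro SUP_cong) (auto simp: pair_set_def)
  ultimately show ?thesis by simp
qed

lemma INF_Qlow_le:
  assumes t: "t \<in> {2..horizon P}" and x: "x \<in> state_set P (t - 1)" and y: "y \<in> feas P t x"
  shows "real_of_ereal (INF x\<in>state_set P (t - 1). Qlow P R t 1 x) \<le> cost P t (y, x) + Q (Suc t) 1 y"
proof -
  have t1: "t \<in> {1..horizon P}" and tT: "t \<le> horizon P" "t - 1 \<le> horizon P"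
    using t by auto
  let ?g = "\<lambda>x y. cost P t (y, x) + Q (Suc t) 1 y"
  obtain B where B: "\<And>z. z \<in> pair_set P t \<Longrightarrow> \<bar>cost P t z\<bar> \<le> B"
    using cost_bounded[OF t1] by blast
  obtain D where D: "\<And>y. y \<in> state_set P t \<Longrightarrow> \<bar>Q (Suc t) 1 y\<bar> \<le> D"
    using compact_continuous_abs_bound[OF state_set(3)[OF tT(1)] qapp_continuous[OF order_refl]] by blast
  have Qlow: "Qlow P R t 1 x = (INF y\<in>feas P t x. ereal (?g x y))" for x
    by (simp add: Qlow_def Fapp_def Qapp_eq_qapp)
  have "\<exists>v. Qlow P R t 1 x = ereal v \<and> \<bar>v\<bar> \<le> B + D" if x: "x \<in> state_set P (t - 1)" for x
  proof -
    have "\<bar>?g x y\<bar> \<le> B + D" if "y \<in> feas P t x" for y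
    proof -
      have "\<bar>cost P t (y, x)\<bar> \<le> B" "\<bar>Q (Suc t) 1 y\<bar> \<le> D"
        using B[OF feas_pair[OF x that]] D that feas_subset by auto
      then show ?thesis by linarith
    qed
    from INF_ereal_bounds[where g = "?g x", OF feas_nonempty[OF t1 x] this] show ?thesis
      unfolding Qlow by blast
  qed
  then obtain w where w: "\<And>x. x \<in> state_set P (t - 1) \<Longrightarrow> Qlow P R t 1 x = ereal (w x) \<and> \<bar>w x\<bar> \<le> B + D"
    by metis
  then have "(INF x\<in>state_set P (t - 1). Qlow P R t 1 x) = (INF x\<in>state_set P (t - 1). ereal (w x))"
    by (intro INF_cong) auto
  moreover obtain v where v: "(INF x\<in>state_set P (t - 1). ereal (w x)) = ereal v"
    using INF_ereal_bounds[of "state_set P (t - 1)" w "B + D"] state_set(1)[OF tT(2)] w by metis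
  moreover have "(INF x\<in>state_set P (t - 1). Qlow P R t 1 x) \<le> Qlow P R t 1 x"
    by (rule INF_lower[OF x])
  moreover have "Qlow P R t 1 x \<le> ereal (?g x y)"
    unfolding Qlow by (rule INF_lower[OF y])
  ultimately show ?thesis
    by (metis order_trans ereal_less_eq(3) real_of_ereal.simps(1))
qed

text \<open>The dual function at a multiplier of large norm is very negative: evaluate the Lagrangian at a point
  near the Slater point \<open>v\<close> whose residual in the equalities points opposite to
  \<open>\<lambda>\<close> with length \<open>\<rho>\<close>, while the inequalities keep the slack
  \<open>\<kappa> / 2\<close>. The Lagrangian drops there by \<open>\<rho> * norm \<lambda> + \<kappa>
  / 2 * (\<Sum>i. \<mu> $ i)\<close>, but a nearly optimal dual solution keeps it above the primal
  value by strong duality.\<close>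

lemma multiplier_bound:
  assumes k: "1 \<le> k" and t: "t \<in> {2..horizon P}" and S2: "typeS2 P t"
  shows "norm (lam t k) + (\<Sum>i\<in>UNIV. mu t k $ i) \<le> U_bound P R C \<epsilon>bar t"
proof -
  let ?X = "state_set P t" and ?A = "matA P t" and ?x = "fwd R (t - 1) k"
  let ?l = "lam t k" and ?m = "mu t k" and ?r = "rad C t" and ?\<rho> = "rho C t" and ?\<kappa> = "kap C t"
  have t1: "t \<in> {1..horizon P}" and tT: "t \<le> horizon P"
    using t by auto
  have x: "?x \<in> state_set P (t - 1)"
    using fwd_state[of k "t - 1"] k t by auto
  have lg: "0 < Lg C t" and lip: "\<And>i. (Lg C t)-lipschitz_on (pair_set P t) (\<lambda>z. ineq P t z $ i)"
    and \<kappa>: "0 < ?\<kappa>" and r: "0 < ?r" "?r \<le> ?\<kappa> / (2 * Lg C t)" and H2t: "H2_at P t ?\<kappa> ?r" and \<rho>: "0 < ?\<rho>"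
    and open_map: "cball 0 ?\<rho> \<inter> (*v) ?A ` dir_space ?X \<subseteq> (*v) ?A ` (cball 0 ?r \<inter> dir_space ?X)"
    using S2_consts(2)[OF t S2] by (auto simp: slater_consts_def)
  obtain v where v: "v \<in> ?X" "cball v ?r \<inter> affine hull ?X \<subseteq> ?X" "eq_res P t v ?x = 0"
      "\<And>i. ineq P t (v, ?x) $ i \<le> - ?\<kappa>"
    using H2t x unfolding H2_at_def by blast
  have V: "subspace (dir_space ?X)"
    by (rule subspace_dir_space[OF state_set(1)[OF tT]])
  have AV: "subspace ((*v) ?A ` dir_space ?X)"
    by (rule linear_subspace_image[OF matrix_vector_mul_linear V])
  have "(?l, ?m) \<in> dual_dom P t ?x"
    using dual_argmax[OF k t S2] by (simp add: eps_argmax_def)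
  then obtain w where w: "w \<in> affine hull ?X" "?l = eq_res P t w ?x"
    by (auto simp: dual_dom_def)
  have "?l = ?A *v (w - v)"
    using eq_res_diff_left[of P t w ?x v] v(3) w(2) by simp
  moreover have "w - v \<in> dir_space ?X"
    using w(1) hull_inc[OF v(1)] by (auto simp: dir_space_def)
  ultimately have l: "?l \<in> (*v) ?A ` dir_space ?X"
    by simp
  \<comment> \<open>For \<open>?l = 0\<close> division by zero makes this the zero residual, which is the right choice then.\<close>
  define e where "e = (- (?\<rho> / norm ?l)) *\<^sub>R ?l"
  have "e \<in> (*v) ?A ` dir_space ?X"
    unfolding e_def by (rule subspace_scale[OF AV l])
  moreover have "norm e \<le> ?\<rho>"
    using \<rho> by (simp add: e_def)
  ultimately obtain u where u: "u \<in> dir_space ?X" "norm u \<le> ?r" "?A *v u = e"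
    using open_map by (force simp: image_iff)
  have le: "?l \<bullet> e = - (?\<rho> * norm ?l)"
    by (simp add: e_def power2_norm_eq_inner[symmetric] power2_eq_square)
  define y where "y = v + u"
  have "y \<in> affine hull ?X"
    unfolding y_def by (intro add_dir_space_affine_hull u(1) hull_inc v(1))
  then have y: "y \<in> ?X"
    using v(2) u(2) by (auto simp: y_def dist_norm)
  have yx: "(y, ?x) \<in> pair_set P t"
    using y x by (simp add: pair_set_def)
  have y_eq: "eq_res P t y ?x = e"
    using eq_res_diff_left[of P t y ?x v] v(3) u(3) by (simp add: y_def)
  have "ineq P t (y, ?x) $ i \<le> - ?\<kappa> / 2" for i
  proof -
    have "ineq P t (y, ?x) $ i \<le> ineq P t (v, ?x) $ i + Lg C t * norm u"
      using lipschitz_on_slice[OF lip, of v ?x y ?x i] v(1) y x by (simp add: pair_set_def y_def)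
    also have "\<dots> \<le> - ?\<kappa> + Lg C t * (?\<kappa> / (2 * Lg C t))"
      using v(4)[of i] u(2) r lg by (intro add_mono mult_left_mono) auto
    also have "\<dots> = - ?\<kappa> / 2"
      using lg by simp
    finally show ?thesis .
  qed
  then have "?m \<bullet> ineq P t (y, ?x) \<le> (\<Sum>i\<in>UNIV. ?m $ i * (- ?\<kappa> / 2))"
    unfolding inner_vec_def inner_real_def
    using multipliers(1)[OF k t] by (intro sum_mono mult_left_mono) auto
  also have "\<dots> = - (?\<kappa> / 2 * (\<Sum>i\<in>UNIV. ?m $ i))"
    by (simp add: sum_distrib_left sum_negf sum_divide_distrib mult.commute)
  finally have m: "?m \<bullet> ineq P t (y, ?x) \<le> - (?\<kappa> / 2 * (\<Sum>i\<in>UNIV. ?m $ i))" .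
  define lo where "lo = real_of_ereal (INF x\<in>state_set P (t - 1). Qlow P R t 1 x)"
  define hi where "hi = real_of_ereal (SUP (y, x)\<in>pair_set P t. ereal (cost P t (y, x)) + value_fun P (Suc t) y)"
  have lo_le: "lo \<le> cost P t (z, ?x) + Q (Suc t) k z" if "z \<in> feas P t ?x" for z
    using INF_Qlow_le[OF t x that] qapp_mono[of 1 k P R "Suc t" z] k by (simp add: lo_def)
  have "lo \<le> lagr P t ?l ?m y ?x + Q (Suc t) k y + \<epsilon> t k"
    using near_saddle[OF k t lo_le y] S2 by simp
  also have "\<dots> \<le> cost P t (y, ?x) - ?\<rho> * norm ?l - ?\<kappa> / 2 * (\<Sum>i\<in>UNIV. ?m $ i) + val P (Suc t) y + \<epsilon>bar t"
    using m le y_eq qapp_le_val[OF k, of "Suc t" y] y t noise_bound[OF t1 k] by (simp add: lagr_def)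
  also have "\<dots> \<le> hi + \<epsilon>bar t - ?\<rho> * norm ?l - ?\<kappa> / 2 * (\<Sum>i\<in>UNIV. ?m $ i)"
    using cost_plus_val_le_SUP[OF t yx] by (simp add: hi_def)
  finally have key: "?\<rho> * norm ?l + ?\<kappa> / 2 * (\<Sum>i\<in>UNIV. ?m $ i) \<le> \<epsilon>bar t + hi - lo"
    by simp
  define d where "d = min ?\<rho> (?\<kappa> / 2)"
  have d: "0 < d" "d \<le> ?\<rho>" "d \<le> ?\<kappa> / 2"
    using \<rho> \<kappa> by (auto simp: d_def)
  have "0 \<le> (\<Sum>i\<in>UNIV. ?m $ i)"
    using multipliers(1)[OF k t] by (simp add: sum_nonneg)
  then have "d * norm ?l + d * (\<Sum>i\<in>UNIV. ?m $ i) \<le> ?\<rho> * norm ?l + ?\<kappa> / 2 * (\<Sum>i\<in>UNIV. ?m $ i)"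
    using d by (intro add_mono mult_right_mono) auto
  also have "\<dots> \<le> (Lf C t + LQ C (Suc t)) * ?r + \<epsilon>bar t + hi - lo"
    using key S2_consts(3,4)[OF t S2] r(1) by (smt (verit) mult_nonneg_nonneg)
  finally show ?thesis
    using d(1) unfolding U_bound_def hi_def[symmetric] lo_def[symmetric] d_def[symmetric]
    by (simp add: pos_le_divide_eq distrib_left mult.commute)
qed

lemma lagr_grad_norm:
  assumes k: "1 \<le> k" and t: "t \<in> {2..horizon P}" and z: "(y, x) \<in> pair_set P t"
  shows "norm (lagr_grad1 P t (lam t k) (mu t k) y x)
      \<le> M2 C t + (if typeS2 P t then mult_bound P R C \<epsilon>bar t (matA P t) else 0)"
    and "norm (lagr_grad2 P t (lam t k) (mu t k) y x)
      \<le> M2 C t + (if typeS2 P t then mult_bound P R C \<epsilon>bar t (matB P t) else 0)"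
proof -
  have fst_le: "norm (fst w) \<le> norm w" and snd_le: "norm (snd w) \<le> norm w" for w :: "(real^'n) \<times> (real^'n)"
    using norm_fst_le[of "fst w" "snd w"] norm_snd_le[of "snd w" "fst w"] by auto
  have c: "norm (fst (cost_grad P t (y, x))) \<le> M2 C t" "norm (snd (cost_grad P t (y, x))) \<le> M2 C t"
    using M2_bound[OF t z] fst_le snd_le order_trans by blast+
  show "norm (lagr_grad1 P t (lam t k) (mu t k) y x)
      \<le> M2 C t + (if typeS2 P t then mult_bound P R C \<epsilon>bar t (matA P t) else 0)"
  proof (cases "typeS2 P t")
    case True
    have "norm (fst (ineq_grad P t i (y, x))) \<le> M3 C t" for i
      using S2_consts(1)[OF t True z] fst_le order_trans by blast
    from multiplier_combination_norm[where E = "transpose (matA P t)", OF c(1) this multipliers(1)[OF k t]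
        multiplier_bound[OF k t True]]
    show ?thesis
      using True by (simp only: lagr_grad1_def mult_bound_def if_True)
  next
    case False
    then show ?thesis
      using c(1) by (simp add: lagr_grad1_def mult_eq_def mult_ineq_def)
  qed
  show "norm (lagr_grad2 P t (lam t k) (mu t k) y x)
      \<le> M2 C t + (if typeS2 P t then mult_bound P R C \<epsilon>bar t (matB P t) else 0)"
  proof (cases "typeS2 P t")
    case True
    have "norm (snd (ineq_grad P t i (y, x))) \<le> M3 C t" for i
      using S2_consts(1)[OF t True z] snd_le order_trans by blast
    from multiplier_combination_norm[where E = "transpose (matB P t)", OF c(2) this multipliers(1)[OF k t]
        multiplier_bound[OF k t True]]
    show ?thesis
      using True by (simp only: lagr_grad2_def mult_bound_def if_True)
  next
    case False
    then show ?thesis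
      using c(2) by (simp add: lagr_grad2_def mult_eq_def mult_ineq_def)
  qed
qed

lemma beta_norm: "1 \<le> k \<Longrightarrow> t \<in> {2..horizon P} \<Longrightarrow> norm (beta R t k) \<le> L_cut P R C \<epsilon>bar t"
  using lagr_grad_norm(2)[OF _ _ bwd_pair, of k t k] by (auto simp: cut_data(2) L_cut_def)

lemma L_cut_nonneg: "2 \<le> t \<Longrightarrow> 0 \<le> L_cut P R C \<epsilon>bar t"
  using order_trans[OF norm_ge_zero beta_norm[of 1 t]] by (cases "t \<le> horizon P") (auto simp: L_cut_def)

text \<open>The Lipschitz constant does not depend on the iteration. Together with the monotonicity in
  \<open>k\<close> this is what \<open>limsup_le_lagged\<close> requires.\<close>

lemma Q_lipschitz: "1 \<le> k \<Longrightarrow> 2 \<le> t \<Longrightarrow> (L_cut P R C \<epsilon>bar t)-lipschitz_on X (Q t k)"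
  by (intro qapp_lipschitz beta_norm L_cut_nonneg) auto

lemma state_diam: "t \<le> horizon P \<Longrightarrow> y \<in> state_set P t \<Longrightarrow> z \<in> state_set P t \<Longrightarrow>
    norm (y - z) \<le> diameter (state_set P t)"
  using diameter_bounded_bound[OF compact_imp_bounded[OF state_set(3)]] by (simp add: dist_norm)

lemma eta_le_eta_bar:
  assumes k: "1 \<le> k" and t: "t \<in> {2..horizon P}"
  shows "eta R t k \<le> eta_bar P R C \<epsilon>bar t"
proof (rule eta_le[OF k t])
  fix z assume z: "z \<in> state_set P t"
  let ?y = "bwd R t k"
  let ?g = "lagr_grad1 P t (lam t k) (mu t k) ?y (fwd R (t - 1) k)"
  let ?M = "M2 C t + (if typeS2 P t then mult_bound P R C \<epsilon>bar t (matA P t) else 0)"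
  let ?L = "L_cut P R C \<epsilon>bar (Suc t)"
  have y: "?y \<in> state_set P t"
    using bwd_feas[OF k t] feas_subset by blast
  have d: "norm (?y - z) \<le> diameter (state_set P t)"
    using state_diam y z t by auto
  have g: "norm ?g \<le> ?M"
    by (rule lagr_grad_norm(1)[OF k t bwd_pair[OF k t]])
  have L: "0 \<le> ?L"
    using t by (intro L_cut_nonneg) auto
  have "?g \<bullet> (?y - z) \<le> norm ?g * norm (?y - z)"
    by (rule norm_cauchy_schwarz)
  also have "\<dots> \<le> ?M * diameter (state_set P t)"
    using g d by (intro mult_mono) (auto intro: order_trans[OF norm_ge_zero])
  finally have 1: "?g \<bullet> (?y - z) \<le> ?M * diameter (state_set P t)" .
  have "?L-lipschitz_on UNIV (Q (Suc t) k)"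
    using k t by (intro Q_lipschitz) auto
  then have "Q (Suc t) k ?y - Q (Suc t) k z \<le> ?L * norm (?y - z)"
    using lipschitz_onD[of ?L UNIV "Q (Suc t) k" ?y z] by (simp add: dist_real_def dist_norm)
  also have "\<dots> \<le> ?L * diameter (state_set P t)"
    using d L by (rule mult_left_mono)
  finally have "?g \<bullet> (?y - z) + Q (Suc t) k ?y - Q (Suc t) k z \<le> (?M + ?L) * diameter (state_set P t)"
    using 1 by (simp add: distrib_right)
  also have "\<dots> = eta_bar P R C \<epsilon>bar t"
    by (simp add: eta_bar_def)
  finally show "?g \<bullet> (?y - z) + Q (Suc t) k ?y - Q (Suc t) k z \<le> eta_bar P R C \<epsilon>bar t" .
qed

text \<open>Uniformity in \<open>k\<close>: the multipliers vary with the iteration, but they are bounded, and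
  the equality constraints contribute a constant to the gradient.\<close>

lemma lagr_grad1_modulus:
  assumes t: "t \<in> {2..horizon P}" and e: "0 < e"
  obtains \<delta> where "0 < \<delta>" "\<And>k y y' x. 1 \<le> k \<Longrightarrow> (y, x) \<in> pair_set P t \<Longrightarrow> (y', x) \<in> pair_set P t \<Longrightarrow>
    norm (y - y') < \<delta> \<Longrightarrow>
    norm (lagr_grad1 P t (lam t k) (mu t k) y x - lagr_grad1 P t (lam t k) (mu t k) y' x) \<le> e"
proof -
  have t1: "t \<in> {1..horizon P}"
    using t by auto
  define U where "U = max 0 (U_bound P R C \<epsilon>bar t)"
  have mu_le: "(\<Sum>i\<in>UNIV. mu t k $ i) \<le> U" if "1 \<le> k" for k
  proof (cases "typeS2 P t")
    case True
    then show ?thesis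
      using multiplier_bound[OF that t True] norm_ge_zero[of "lam t k"] unfolding U_def by linarith
  next
    case False
    then show ?thesis by (simp add: mult_ineq_def U_def)
  qed
  define G where "G z = (cost_grad P t z, \<chi> i. if typeS2 P t then ineq_grad P t i z else 0)" for z
  have "continuous_on (pair_set P t) (cost_grad P t)"
    using cost(2)[OF t1] by (simp add: C1_on_def)
  moreover have "continuous_on (pair_set P t) (\<lambda>z. if typeS2 P t then ineq_grad P t i z else 0)" for i
    using ineq(2)[OF t1, of i] by (cases "typeS2 P t") (auto simp: C1_on_def)
  ultimately have "continuous_on (pair_set P t) G"
    unfolding G_def by (intro continuous_on_Pair continuous_on_vec_lambda)
  then have "uniformly_continuous_on (pair_set P t) G"
    by (rule compact_uniformly_continuous[OF _ pair_set(2)[OF t1]])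
  moreover have "0 < e / (1 + U)"
    using e by (simp add: U_def add_pos_nonneg)
  ultimately obtain \<delta> where \<delta>: "0 < \<delta>"
    "\<And>z z'. z \<in> pair_set P t \<Longrightarrow> z' \<in> pair_set P t \<Longrightarrow> dist z z' < \<delta> \<Longrightarrow> dist (G z) (G z') < e / (1 + U)"
    unfolding uniformly_continuous_on_def by (metis dist_commute)
  show ?thesis
  proof (rule that[OF \<delta>(1)])
    fix k :: nat and y y' x
    assume k: "1 \<le> k" and z: "(y, x) \<in> pair_set P t" "(y', x) \<in> pair_set P t" and near: "norm (y - y') < \<delta>"
    let ?m = "mu t k"
    have "dist (y, x) (y', x) < \<delta>"
      using near by (simp add: dist_Pair_Pair dist_norm)
    then have G: "norm (G (y, x) - G (y', x)) < e / (1 + U)"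
      using \<delta>(2)[OF z] by (simp add: dist_norm)
    have fst_le: "norm (fst w) \<le> norm w" for w :: "'a::real_normed_vector \<times> 'b::real_normed_vector"
      using norm_fst_le[of "fst w" "snd w"] by simp
    have snd_le: "norm (snd w) \<le> norm w" for w :: "'a::real_normed_vector \<times> 'b::real_normed_vector"
      using norm_snd_le[of "snd w" "fst w"] by simp
    let ?dc = "cost_grad P t (y, x) - cost_grad P t (y', x)"
    let ?di = "\<lambda>i. ineq_grad P t i (y, x) - ineq_grad P t i (y', x)"
    have "norm ?dc \<le> e / (1 + U)"
      using fst_le[of "G (y, x) - G (y', x)"] G by (simp add: G_def)
    then have dc: "norm (fst ?dc) \<le> e / (1 + U)"
      using fst_le order_trans by blast
    have di: "norm ((?m $ i) *\<^sub>R fst (?di i)) \<le> ?m $ i * (e / (1 + U))" for i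
    proof (cases "typeS2 P t")
      case True
      have "norm (?di i) = norm (snd (G (y, x) - G (y', x)) $ i)"
        using True by (simp add: G_def)
      also have "\<dots> \<le> norm (snd (G (y, x) - G (y', x)))"
        by (rule Finite_Cartesian_Product.norm_nth_le)
      finally have "norm (fst (?di i)) \<le> e / (1 + U)"
        using snd_le[of "G (y, x) - G (y', x)"] fst_le[of "?di i"] G by linarith
      from mult_left_mono[OF this multipliers(1)[OF k t]] show ?thesis
        using multipliers(1)[OF k t] by simp
    next
      case False
      then show ?thesis by (simp add: mult_ineq_def)
    qed
    have "lagr_grad1 P t (lam t k) ?m y x - lagr_grad1 P t (lam t k) ?m y' x
        = fst ?dc + (\<Sum>i\<in>UNIV. (?m $ i) *\<^sub>R fst (?di i))"
      by (simp add: lagr_grad1_def scaleR_diff_right sum_subtractf)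
    then have "norm (lagr_grad1 P t (lam t k) ?m y x - lagr_grad1 P t (lam t k) ?m y' x)
        \<le> norm (fst ?dc) + norm (\<Sum>i\<in>UNIV. (?m $ i) *\<^sub>R fst (?di i))"
      by (simp only: norm_triangle_ineq)
    also have "\<dots> \<le> e / (1 + U) + (\<Sum>i\<in>UNIV. ?m $ i * (e / (1 + U)))"
      by (intro add_mono dc sum_norm_le di)
    also have "\<dots> = e / (1 + U) * (1 + (\<Sum>i\<in>UNIV. ?m $ i))"
      unfolding sum_distrib_right[symmetric] by (simp add: algebra_simps)
    also have "\<dots> \<le> e / (1 + U) * (1 + U)"
      using mu_le[OF k] e by (intro mult_left_mono) (auto simp: U_def)
    also have "\<dots> = e"
      by (simp add: U_def max_def)
    finally show "norm (lagr_grad1 P t (lam t k) ?m y x - lagr_grad1 P t (lam t k) ?m y' x) \<le> e" .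
  qed
qed

text \<open>One noise comes from the primal, the other one from the dual solution.\<close>

lemma bwd_approx_minimizes_lagr:
  assumes k: "1 \<le> k" and t: "t \<in> {2..horizon P}" and y: "y \<in> state_set P t"
  defines "x \<equiv> fwd R (t - 1) k"
  shows "lagr P t (lam t k) (mu t k) (bwd R t k) x + Q (Suc t) k (bwd R t k)
           \<le> lagr P t (lam t k) (mu t k) y x + Q (Suc t) k y + 2 * \<epsilon> t k"
proof -
  let ?p = "cost P t (bwd R t k, x) + Q (Suc t) k (bwd R t k) - \<epsilon> t k"
  have "?p \<le> cost P t (z, x) + Q (Suc t) k z" if "z \<in> feas P t x" for z
    using bwd_opt[OF k t, of z] that by (simp add: x_def)
  then have "?p \<le> lagr P t (lam t k) (mu t k) y x + Q (Suc t) k y + (if typeS2 P t then \<epsilon> t k else 0)"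
    unfolding x_def by (rule near_saddle[OF k t _ y])
  moreover have "lagr P t (lam t k) (mu t k) (bwd R t k) x \<le> cost P t (bwd R t k, x)"
    unfolding x_def by (rule lagr_le_cost[OF bwd_feas[OF k t] multipliers(1,3)[OF k t]])
  moreover have "0 \<le> \<epsilon> t k"
    using noise_nonneg[OF k, of t] t by simp
  ultimately show ?thesis
    by (auto split: if_splits)
qed

text \<open>By \<open>approx_minimizer_gap\<close> for the Lagrangian and \<open>Q (Suc t) k\<close>, whose
  modulus does not depend on \<open>k\<close>.\<close>

lemma eta_vanishes:
  assumes t: "t \<in> {2..horizon P}" and lim: "\<epsilon> t \<longlonglongrightarrow> 0"
  shows "limsup_le (eta R t) 0"
  unfolding limsup_le_def
proof (intro allI impI)
  fix \<omega> :: real assume \<omega>: "0 < \<omega>"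
  have t1: "t \<in> {1..horizon P}" and tT: "t \<le> horizon P"
    using t by auto
  \<comment> \<open>The offsets by one in the following constants keep the denominators positive for singleton state sets.\<close>
  define d where "d = diameter (state_set P t)"
  have d: "0 \<le> d"
    unfolding d_def using diameter_ge_0 compact_imp_bounded state_set(3)[OF tT] by blast
  define e where "e = \<omega> / (2 * (d + 1))"
  have e: "0 < e" "e * d \<le> \<omega> / 2"
    using \<omega> d by (auto simp: e_def field_simps)
  obtain \<delta> where \<delta>: "0 < \<delta>" "\<And>k y y' x. 1 \<le> k \<Longrightarrow> (y, x) \<in> pair_set P t \<Longrightarrow> (y', x) \<in> pair_set P t \<Longrightarrow>
    norm (y - y') < \<delta> \<Longrightarrow>
    norm (lagr_grad1 P t (lam t k) (mu t k) y x - lagr_grad1 P t (lam t k) (mu t k) y' x) \<le> e"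
    using lagr_grad1_modulus[OF t e(1)] by metis
  \<comment> \<open>The step fraction is fixed by the modulus alone; the noise is made small compared to it afterwards.\<close>
  define s where "s = min 1 (\<delta> / (d + 1))"
  have s: "0 < s" "s \<le> 1"
    using \<delta>(1) d by (auto simp: s_def)
  have "s * d < \<delta>"
  proof -
    have "s * (d + 1) \<le> \<delta> / (d + 1) * (d + 1)"
      using d by (intro mult_right_mono) (auto simp: s_def)
    then have "s * (d + 1) \<le> \<delta>"
      using d by simp
    then show ?thesis
      using s(1) by (simp add: distrib_left)
  qed
  have "\<forall>\<^sub>F k in sequentially. \<epsilon> t k < \<omega> * s / 4"
    using order_tendstoD(2)[OF lim, of "\<omega> * s / 4"] \<omega> s(1) by simp
  moreover have "\<forall>\<^sub>F k in sequentially. (1::nat) \<le> k"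
    by (rule eventually_ge_at_top)
  ultimately show "\<forall>\<^sub>F k in sequentially. eta R t k \<le> 0 + \<omega>"
  proof eventually_elim
    case (elim k)
    then have k: "1 \<le> k" by simp
    let ?x = "fwd R (t - 1) k" and ?y0 = "bwd R t k"
    have x: "?x \<in> state_set P (t - 1)"
      using fwd_state[of k "t - 1"] k t by auto
    have y0: "?y0 \<in> state_set P t"
      using bwd_feas[OF k t] feas_subset by blast
    have pair: "(y, ?x) \<in> pair_set P t" if "y \<in> state_set P t" for y
      using that x by (simp add: pair_set_def)
    have "eta R t k \<le> 2 * \<epsilon> t k / s + e * d"
    proof (rule eta_le[OF k t], rule approx_minimizer_gap[where X = "state_set P t" and s = s
          and \<phi> = "\<lambda>y. lagr P t (lam t k) (mu t k) y ?x"
          and D = "\<lambda>y. lagr_grad1 P t (lam t k) (mu t k) y ?x"])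
      show "convex_on (state_set P t) (Q (Suc t) k)"
        by (rule qapp_convex[OF k state_set(2)[OF tT]])
      show "lagr P t (lam t k) (mu t k) y ?x + lagr_grad1 P t (lam t k) (mu t k) y ?x \<bullet> (y' - y)
          \<le> lagr P t (lam t k) (mu t k) y' ?x" if "y \<in> state_set P t" "y' \<in> state_set P t" for y y'
        using lagr_tangent[OF t1 pair[OF that(1)] pair[OF that(2)] multipliers(1,2)[OF k t], of "lam t k"]
        by simp
      show "norm (lagr_grad1 P t (lam t k) (mu t k) y ?x - lagr_grad1 P t (lam t k) (mu t k) ?y0 ?x) \<le> e"
        if "y \<in> state_set P t" "norm (y - ?y0) \<le> s * d" for y
        using \<delta>(2)[OF k pair[OF that(1)] pair[OF y0]] that(2) \<open>s * d < \<delta>\<close> by linarith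
      show "norm (y - ?y0) \<le> d" if "y \<in> state_set P t" for y
        using state_diam[OF tT that y0] by (simp add: d_def)
    qed (use s y0 bwd_approx_minimizes_lagr[OF k t] in auto)
    also have "2 * \<epsilon> t k / s \<le> \<omega> / 2"
      using elim s(1) by (simp add: pos_divide_le_eq)
    finally show ?case
      using e(2) by simp
  qed
qed

end

section \<open>Propagation of the errors through the stages\<close>

context bounded_iddp
begin

text \<open>The lagged gap is the error that the forward pass of the preceding stage sees: its model does not
  contain the cut of the current iteration yet.\<close>

definition gap :: "nat \<Rightarrow> nat \<Rightarrow> real" where
  "gap t k = val P t (fwd R (t - 1) k) - Q t k (fwd R (t - 1) k)"

definition lag_gap :: "nat \<Rightarrow> nat \<Rightarrow> real" where
  "lag_gap t k = val P t (fwd R (t - 1) k) - Q t (k - 1) (fwd R (t - 1) k)"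

definition run_cost :: "nat \<Rightarrow> real" where
  "run_cost k = (\<Sum>t=1..horizon P. cost P t (fwd R t k, fwd R (t - 1) k))"

definition first_value :: "nat \<Rightarrow> real" where
  "first_value k = cost P 1 (fwd R 1 k, init P) + Q 2 (k - 1) (fwd R 1 k)"

lemma state_before:
  assumes "1 \<le> k" "t \<in> {1..Suc (horizon P)}"
  shows "fwd R (t - 1) k \<in> state_set P (t - 1)"
  using assms by (intro fwd_state) auto

lemma gap_nonneg: "1 \<le> k \<Longrightarrow> t \<in> {2..Suc (horizon P)} \<Longrightarrow> 0 \<le> gap t k"
  using qapp_le_val[of k t "fwd R (t - 1) k"] state_before[of k t] by (auto simp: gap_def)

lemma lag_gap_nonneg: "2 \<le> k \<Longrightarrow> t \<in> {2..Suc (horizon P)} \<Longrightarrow> 0 \<le> lag_gap t k"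
  using qapp_le_val[of "k - 1" t "fwd R (t - 1) k"] state_before[of k t] by (auto simp: lag_gap_def)

lemma gap_recursion:
  assumes k: "2 \<le> k" and t: "t \<in> {2..horizon P}"
  shows "gap t k \<le> lag_gap (Suc t) k + err t k"
proof -
  have k1: "1 \<le> k" and t1: "t \<in> {1..horizon P}" "t \<in> {1..Suc (horizon P)}"
    using k t by auto
  show ?thesis
    using qapp_recursion[OF k t] val_le[OF t1(1) state_before[OF k1 t1(2)] fwd_feas[OF k1 t1(1)]]
    by (simp add: gap_def lag_gap_def)
qed

lemma lag_gap_limsup:
  assumes t: "t \<in> {2..Suc (horizon P)}" and gap: "limsup_le (gap t) E"
  shows "limsup_le (lag_gap t) E"
proof -
  obtain L where L: "L-lipschitz_on (state_set P (t - 1)) (val P t)"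
    using val_lipschitz[OF t] by blast
  let ?D = "\<lambda>k x. val P t x - Q t k x"
  have "limsup_le (\<lambda>k. ?D (k - 1) (fwd R (t - 1) k)) E"
  proof (rule limsup_le_lagged[where X = "state_set P (t - 1)" and D = ?D])
    show "compact (state_set P (t - 1))"
      using t by (intro state_set(3)) auto
    show "fwd R (t - 1) k \<in> state_set P (t - 1)" if "1 \<le> k" for k
      using that t by (intro state_before) auto
    show "?D k y \<le> ?D j y" if "1 \<le> j" "j \<le> k" for j k y
      using qapp_mono[OF that, of P R t y] by simp
    show "(L + L_cut P R C \<epsilon>bar t)-lipschitz_on (state_set P (t - 1)) (?D k)" if "1 \<le> k" for k
      using that t by (intro lipschitz_on_diff L Q_lipschitz) auto
    show "limsup_le (\<lambda>k. ?D k (fwd R (t - 1) k)) E"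
      using gap by (simp add: gap_def[abs_def])
  qed
  then show ?thesis
    by (simp add: lag_gap_def[abs_def])
qed

text \<open>Backward induction over the stages. The bounds hold along the full sequence of iterations; a
  subsequence is needed only to make the iterates themselves converge.\<close>

lemma gap_limsup:
  assumes E: "\<And>t. t \<in> {2..horizon P} \<Longrightarrow> limsup_le (err t) (E t)" and t: "t \<in> {2..Suc (horizon P)}"
  shows "limsup_le (gap t) (\<Sum>\<tau>=t..horizon P. E \<tau>)" "limsup_le (lag_gap t) (\<Sum>\<tau>=t..horizon P. E \<tau>)"
proof -
  have "t \<le> Suc (horizon P)" "2 \<le> t"
    using t by auto
  then have *: "limsup_le (gap t) (\<Sum>\<tau>=t..horizon P. E \<tau>)"
  proof (induction rule: inc_induct)
    case base
    show ?case
      by (rule limsup_le_of_bound) (simp add: gap_def val_after_horizon qapp_after_horizon)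
  next
    case (step s)
    have s: "s \<in> {2..horizon P}" "Suc s \<in> {2..Suc (horizon P)}"
      using step by auto
    have "limsup_le (\<lambda>k. lag_gap (Suc s) k + err s k) ((\<Sum>\<tau>=Suc s..horizon P. E \<tau>) + E s)"
      by (intro limsup_le_add lag_gap_limsup[OF s(2)] E[OF s(1)]) (use step in auto)
    moreover have "\<forall>\<^sub>F k in sequentially. gap s k \<le> lag_gap (Suc s) k + err s k"
      using eventually_ge_at_top[of 2] by eventually_elim (rule gap_recursion[OF _ s(1)])
    ultimately have "limsup_le (gap s) ((\<Sum>\<tau>=Suc s..horizon P. E \<tau>) + E s)"
      by (rule limsup_le_mono)
    then show ?case
      using s by (simp add: sum.atLeast_Suc_atMost add.commute)
  qed
  show "limsup_le (gap t) (\<Sum>\<tau>=t..horizon P. E \<tau>)" "limsup_le (lag_gap t) (\<Sum>\<tau>=t..horizon P. E \<tau>)"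
    using * lag_gap_limsup[OF t] by auto
qed

lemma fwd_value_le:
  assumes k: "2 \<le> k" and t: "t \<in> {1..horizon P}"
  shows "cost P t (fwd R t k, fwd R (t - 1) k) + Q (Suc t) (k - 1) (fwd R t k)
           \<le> val P t (fwd R (t - 1) k) + \<epsilon> t k"
proof -
  have x: "fwd R (t - 1) k \<in> state_set P (t - 1)"
    using k t by (intro state_before) auto
  have "cost P t (fwd R t k, fwd R (t - 1) k) + Q (Suc t) (k - 1) (fwd R t k) - \<epsilon> t k
           \<le> val P t (fwd R (t - 1) k)"
  proof (rule val_greatest[OF t x])
    fix y assume y: "y \<in> feas P t (fwd R (t - 1) k)"
    have "Q (Suc t) (k - 1) y \<le> val P (Suc t) y"
      using y feas_subset k t by (intro qapp_le_val) auto
    then show "cost P t (fwd R t k, fwd R (t - 1) k) + Q (Suc t) (k - 1) (fwd R t k) - \<epsilon> t k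
        \<le> cost P t (y, fwd R (t - 1) k) + val P (Suc t) y"
      using fwd_opt[OF k t y] by simp
  qed
  then show ?thesis by simp
qed

text \<open>The forward decisions are optimal for the approximations. Replacing these by the value functions
  costs one lagged gap per stage, and the value functions telescope along the trajectory.\<close>

lemma run_cost_le:
  assumes k: "2 \<le> k"
  shows "run_cost k \<le> val P 1 (init P) + (\<Sum>t=1..horizon P. lag_gap (Suc t) k + \<epsilon> t k)"
proof -
  let ?v = "\<lambda>t. val P t (fwd R (t - 1) k)"
  have "run_cost k \<le> (\<Sum>t=1..horizon P. (?v t - ?v (Suc t)) + (lag_gap (Suc t) k + \<epsilon> t k))"
    unfolding run_cost_def using fwd_value_le[OF k] by (intro sum_mono) (simp add: lag_gap_def algebra_simps)
  also have "\<dots> = (\<Sum>t=1..horizon P. ?v t - ?v (Suc t)) + (\<Sum>t=1..horizon P. lag_gap (Suc t) k + \<epsilon> t k)"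
    by (rule sum.distrib)
  also have "(\<Sum>t=1..horizon P. ?v t - ?v (Suc t)) = ?v 1 - ?v (Suc (horizon P))"
    using sum_Suc_diff[of 1 "horizon P" "\<lambda>t. - ?v t"] by simp
  also have "\<dots> = val P 1 (init P)"
    using k by (simp add: val_after_horizon fwd_init)
  finally show ?thesis .
qed

lemma run_cost_limsup:
  assumes E: "\<And>t. t \<in> {2..horizon P} \<Longrightarrow> limsup_le (err t) (E t)"
    and N: "\<And>t. t \<in> {1..horizon P} \<Longrightarrow> limsup_le (\<epsilon> t) (N t)"
  shows "limsup_le run_cost (val P 1 (init P) + (\<Sum>t=1..horizon P. (\<Sum>\<tau>=Suc t..horizon P. E \<tau>) + N t))"
proof (rule limsup_le_mono)
  show "\<forall>\<^sub>F k in sequentially. run_cost k \<le> val P 1 (init P) + (\<Sum>t=1..horizon P. lag_gap (Suc t) k + \<epsilon> t k)"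
    using eventually_ge_at_top[of 2] by eventually_elim (rule run_cost_le)
  show "limsup_le (\<lambda>k. val P 1 (init P) + (\<Sum>t=1..horizon P. lag_gap (Suc t) k + \<epsilon> t k))
      (val P 1 (init P) + (\<Sum>t=1..horizon P. (\<Sum>\<tau>=Suc t..horizon P. E \<tau>) + N t))"
  proof (rule limsup_le_add)
    show "limsup_le (\<lambda>k. val P 1 (init P)) (val P 1 (init P))"
      by (simp add: limsup_le_of_bound)
    show "limsup_le (\<lambda>k. \<Sum>t=1..horizon P. lag_gap (Suc t) k + \<epsilon> t k)
        (\<Sum>t=1..horizon P. (\<Sum>\<tau>=Suc t..horizon P. E \<tau>) + N t)"
      by (intro limsup_le_sum limsup_le_add gap_limsup(2) E N) auto
  qed
qed

text \<open>The lower bound compares with the true value of the first decision, the upper bound with its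
  approximate optimality for a model below the value function.\<close>

lemma first_value_bounds:
  assumes k: "2 \<le> k"
  shows "val P 1 (init P) - lag_gap 2 k \<le> first_value k" "first_value k \<le> val P 1 (init P) + \<epsilon> 1 k"
proof -
  have 1: "1 \<in> {1..horizon P}" and k1: "1 \<le> k"
    using horizon_pos k by auto
  have x0: "fwd R 0 k = init P"
    using k by (simp add: fwd_init)
  show "first_value k \<le> val P 1 (init P) + \<epsilon> 1 k"
    using fwd_value_le[OF k 1] by (simp add: first_value_def x0 numeral_2_eq_2)
  have "fwd R 1 k \<in> feas P 1 (init P)"
    using fwd_feas[OF k1 1] by (simp add: x0)
  from val_le[OF 1 init_state this] show "val P 1 (init P) - lag_gap 2 k \<le> first_value k"
    by (simp add: first_value_def lag_gap_def numeral_2_eq_2)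
qed

lemma first_value_Fapp: "2 \<le> k \<Longrightarrow> Fapp P R 1 (k - 1) (fwd R 1 k) (init P) = ereal (first_value k)"
  by (simp add: Fapp_def first_value_def Qapp_eq_qapp numeral_2_eq_2)

text \<open>The limit of forward trajectories is feasible by the closed graph, and its cost is a limit of
  forward costs.\<close>

lemma limit_path:
  assumes \<sigma>: "filterlim \<sigma> at_top sequentially" "\<And>j::nat. 1 \<le> \<sigma> j" and xs0: "xs 0 = init P"
    and xs: "\<And>t. t \<in> {1..horizon P} \<Longrightarrow> (\<lambda>j. fwd R t (\<sigma> j)) \<longlonglongrightarrow> xs t"
    and B: "limsup_le run_cost B"
  shows "xs \<in> feasible_paths P" "total_cost P xs \<le> B"
proof -
  have lim: "(\<lambda>j. fwd R t (\<sigma> j)) \<longlonglongrightarrow> xs t" if "t \<le> horizon P" for t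
  proof (cases "t = 0")
    case True
    then show ?thesis using \<sigma>(2) by (simp add: fwd_init xs0)
  next
    case False
    then show ?thesis using xs that by simp
  qed
  have state: "xs t \<in> state_set P t" if "t \<le> horizon P" for t
    using closed_sequentially[OF compact_imp_closed[OF state_set(3)[OF that]] _ lim[OF that]]
      fwd_state[OF \<sigma>(2) that] by blast
  have "xs t \<in> feas P t (xs (t - 1))" if t: "t \<in> {1..horizon P}" for t
  proof (rule feas_limit[OF t])
    show "fwd R (t - 1) (\<sigma> j) \<in> state_set P (t - 1)" for j
      using \<sigma>(2) t by (intro fwd_state) auto
    show "fwd R t (\<sigma> j) \<in> feas P t (fwd R (t - 1) (\<sigma> j))" for j
      by (rule fwd_feas[OF \<sigma>(2) t])
  qed (use t lim[of t] lim[of "t - 1"] in auto)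
  then show "xs \<in> feasible_paths P"
    using xs0 by (simp add: feasible_paths_def)
  have "(\<lambda>j. run_cost (\<sigma> j)) \<longlonglongrightarrow> total_cost P xs"
    unfolding run_cost_def total_cost_def
  proof (rule tendsto_sum)
    fix t assume t: "t \<in> {1..horizon P}"
    show "(\<lambda>j. cost P t (fwd R t (\<sigma> j), fwd R (t - 1) (\<sigma> j))) \<longlonglongrightarrow> cost P t (xs t, xs (t - 1))"
      using t by (intro cost_tendsto lim state fwd_state \<sigma>(2)) auto
  qed
  then show "total_cost P xs \<le> B"
    by (rule limsup_le_subseq_limit[OF B \<sigma>(1)])
qed

lemma Q_bounded:
  assumes t: "t \<in> {2..Suc (horizon P)}"
  shows "\<exists>B\<ge>0. \<forall>k\<ge>1. \<forall>x\<in>state_set P (t - 1). \<bar>Q t k x\<bar> \<le> B"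
proof -
  have "t \<in> {1..Suc (horizon P)}" and t1: "t - 1 \<le> horizon P"
    using t by auto
  then obtain B where B: "\<And>x. x \<in> state_set P (t - 1) \<Longrightarrow> \<bar>val P t x\<bar> \<le> B"
    using val_bounded by blast
  obtain D where D: "0 \<le> D" "\<And>x. x \<in> state_set P (t - 1) \<Longrightarrow> \<bar>Q t 1 x\<bar> \<le> D"
    using compact_continuous_abs_bound[OF state_set(3)[OF t1] qapp_continuous[OF order_refl]] by blast
  show ?thesis
  proof (intro exI[of _ "max B D"] conjI allI impI ballI)
    show "0 \<le> max B D"
      using D by simp
    fix k x assume k: "(1::nat) \<le> k" and x: "x \<in> state_set P (t - 1)"
    show "\<bar>Q t k x\<bar> \<le> max B D"
      using qapp_le_val[OF k t x] qapp_mono[OF order_refl k, of P R t x] B[OF x] D(2)[OF x] by linarith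
  qed
qed

lemma err_le_Err:
  assumes k: "1 \<le> k" and t: "t \<in> {2..horizon P}"
  shows "err t k \<le> Err P R C \<epsilon>bar t"
proof -
  have "\<epsilon> t k \<le> \<epsilon>bar t"
    using noise_bound[of t k] k t by simp
  moreover have "t \<noteq> 1"
    using t by simp
  ultimately show ?thesis
    using eta_le_eta_bar[OF k t] by (simp add: err_def Err_def)
qed

lemma noise_bound_le_Err:
  assumes t: "t \<in> {1..horizon P}"
  shows "\<epsilon>bar t \<le> Err P R C \<epsilon>bar t"
proof (cases "t = 1")
  case False
  then have t2: "t \<in> {2..horizon P}"
    using t by auto
  have "0 \<le> eta_bar P R C \<epsilon>bar t"
    using eta_nonneg[OF order_refl t2] eta_le_eta_bar[OF order_refl t2] by linarith
  moreover have "0 \<le> \<epsilon>bar t"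
    using noise_nonneg[OF order_refl t] noise_bound[OF t order_refl] by linarith
  ultimately show ?thesis
    using False by (simp add: Err_def)
qed (simp add: Err_def)

lemma bounded_noise_limit:
  "\<exists>K xs. infinite K \<and> K \<subseteq> {1..} \<and>
     (\<forall>t\<in>{1..horizon P}. xs t \<in> state_set P t \<and> ((\<lambda>k. fwd R t k) \<longlongrightarrow> xs t) (along K)) \<and>
     (\<forall>t\<in>{2..horizon P}. \<exists>l::real.
        ((\<lambda>k. Qapp P R t k (fwd R (t - 1) k)) \<longlongrightarrow> ereal l) (along K) \<and>
        value_fun P t (xs (t - 1)) - ereal (\<Sum>\<tau>=t..horizon P. Err P R C \<epsilon>bar \<tau>) \<le> ereal l \<and>
        ereal l \<le> value_fun P t (xs (t - 1))) \<and>
     (\<exists>l::real.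
        ((\<lambda>k. Fapp P R 1 (k - 1) (fwd R 1 k) (init P)) \<longlongrightarrow> ereal l) (along K) \<and>
        value_fun P 1 (init P) - ereal (\<Sum>\<tau>=2..horizon P. Err P R C \<epsilon>bar \<tau>) \<le> ereal l \<and>
        ereal l \<le> value_fun P 1 (init P) + ereal (Err P R C \<epsilon>bar 1)) \<and>
     xs \<in> eps_solutions P (\<Sum>\<tau>=1..horizon P. real \<tau> * Err P R C \<epsilon>bar \<tau>) \<and>
     ereal (total_cost P xs)
       \<le> value_fun P 1 (init P) + ereal (\<Sum>\<tau>=1..horizon P. real \<tau> * Err P R C \<epsilon>bar \<tau>)"
proof -
  let ?E = "Err P R C \<epsilon>bar" and ?T = "horizon P"
  \<comment> \<open>The two kinds of real sequences that must converge, in one family indexed by the stage.\<close>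
  define w where "w t k = (if t = 1 then first_value k else Q t k (fwd R (t - 1) k))" for t k
  have T: "1 \<in> {1..?T}" "2 \<in> {2..Suc ?T}"
    using horizon_pos by auto

  have "\<exists>B. \<forall>k\<ge>2. \<bar>w t k\<bar> \<le> B" if t: "t \<in> {1..?T}" for t
  proof (cases "t = 1")
    case True
    obtain B where B: "\<And>z. z \<in> pair_set P 1 \<Longrightarrow> \<bar>cost P 1 z\<bar> \<le> B"
      using cost_bounded[OF T(1)] by blast
    obtain D where D: "\<And>k x. 1 \<le> k \<Longrightarrow> x \<in> state_set P 1 \<Longrightarrow> \<bar>Q 2 k x\<bar> \<le> D"
      using Q_bounded[OF T(2)] by auto
    have "\<bar>first_value k\<bar> \<le> B + D" if k: "2 \<le> k" for k
    proof -
      have "fwd R 1 k \<in> state_set P 1"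
        using k horizon_pos by (intro fwd_state) auto
      then have "\<bar>cost P 1 (fwd R 1 k, init P)\<bar> \<le> B" "\<bar>Q 2 (k - 1) (fwd R 1 k)\<bar> \<le> D"
        using B D[of "k - 1"] k init_state by (auto simp: pair_set_def)
      then show ?thesis
        unfolding first_value_def by linarith
    qed
    then show ?thesis
      using True by (auto simp: w_def)
  next
    case False
    then have "t \<in> {2..Suc ?T}"
      using t by auto
    then obtain D where "\<And>k x. 1 \<le> k \<Longrightarrow> x \<in> state_set P (t - 1) \<Longrightarrow> \<bar>Q t k x\<bar> \<le> D"
      using Q_bounded by blast
    then show ?thesis
      using False t state_before[of _ t] by (intro exI[of _ D]) (auto simp: w_def)
  qed
  then obtain B where B: "\<And>t k. t \<in> {1..?T} \<Longrightarrow> 2 \<le> k \<Longrightarrow> \<bar>w t k\<bar> \<le> B t"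
    by metis

  have "\<exists>\<sigma>::nat \<Rightarrow> nat. strict_mono \<sigma> \<and> (\<forall>t\<in>{1..?T}. \<exists>l\<in>state_set P t. (\<lambda>j. fwd R t (\<sigma> j + 2)) \<longlonglongrightarrow> l)"
    by (rule common_convergent_subsequence[where u = "\<lambda>t j. fwd R t (j + 2)"])
      (auto intro: state_set fwd_state)
  then obtain \<sigma>0 :: "nat \<Rightarrow> nat" and x where \<sigma>0: "strict_mono \<sigma>0"
    "\<And>t. t \<in> {1..?T} \<Longrightarrow> x t \<in> state_set P t \<and> (\<lambda>j. fwd R t (\<sigma>0 j + 2)) \<longlonglongrightarrow> x t"
    by metis
  have "\<exists>\<sigma>::nat \<Rightarrow> nat. strict_mono \<sigma> \<and> (\<forall>t\<in>{1..?T}. \<exists>l\<in>{- B t..B t}. (\<lambda>j. w t (\<sigma>0 (\<sigma> j) + 2)) \<longlonglongrightarrow> l)"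
  proof (rule common_convergent_subsequence[where u = "\<lambda>t j. w t (\<sigma>0 j + 2)"])
    show "w t (\<sigma>0 j + 2) \<in> {- B t..B t}" if "t \<in> {1..?T}" for t j
      using B[OF that, of "\<sigma>0 j + 2"] by (simp add: abs_le_iff)
  qed auto
  then obtain \<sigma>1 :: "nat \<Rightarrow> nat" and l where \<sigma>1: "strict_mono \<sigma>1"
    "\<And>t. t \<in> {1..?T} \<Longrightarrow> (\<lambda>j. w t (\<sigma>0 (\<sigma>1 j) + 2)) \<longlonglongrightarrow> l t"
    by metis
  \<comment> \<open>The shift by two skips the first forward pass, whose objective is \<open>-\<infinity>\<close> if there is a later stage.\<close>
  define \<sigma> where "\<sigma> j = \<sigma>0 (\<sigma>1 j) + 2" for j
  have mono: "strict_mono \<sigma>"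
    using \<sigma>0(1) \<sigma>1(1) by (simp add: strict_mono_def \<sigma>_def)
  have \<sigma>2: "2 \<le> \<sigma> j" for j
    by (simp add: \<sigma>_def)
  then have \<sigma>_ge1: "1 \<le> \<sigma> j" for j
    by (meson one_le_numeral order_trans)
  have top: "filterlim \<sigma> at_top sequentially"
    by (rule filterlim_subseq[OF mono])
  define xs where "xs t = (if t = 0 then init P else x t)" for t
  have x_lim: "xs t \<in> state_set P t" "(\<lambda>j. fwd R t (\<sigma> j)) \<longlonglongrightarrow> xs t" if "t \<in> {1..?T}" for t
    using \<sigma>0(2)[OF that] LIMSEQ_subseq_LIMSEQ[OF _ \<sigma>1(1), of "\<lambda>j. fwd R t (\<sigma>0 j + 2)" "x t"] that
    by (auto simp: xs_def \<sigma>_def o_def)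
  have w_lim: "(\<lambda>j. w t (\<sigma> j)) \<longlonglongrightarrow> l t" if "t \<in> {1..?T}" for t
    using \<sigma>1(2)[OF that] by (simp add: \<sigma>_def)

  have E: "limsup_le (err t) (?E t)" if "t \<in> {2..?T}" for t
    by (intro limsup_le_of_bound eventually_sequentiallyI[of 1] err_le_Err that)
  have N: "limsup_le (\<epsilon> t) (\<epsilon>bar t)" if "t \<in> {1..?T}" for t
    by (intro limsup_le_of_bound eventually_sequentiallyI[of 1] noise_bound that)

  have stage: "((\<lambda>k. Qapp P R t k (fwd R (t - 1) k)) \<longlongrightarrow> ereal (l t)) (along (range \<sigma>)) \<and>
      value_fun P t (xs (t - 1)) - ereal (\<Sum>\<tau>=t..?T. ?E \<tau>) \<le> ereal (l t) \<and>
      ereal (l t) \<le> value_fun P t (xs (t - 1))" if t: "t \<in> {2..?T}" for t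
  proof -
    have t': "t \<in> {1..?T}" "t \<in> {2..Suc ?T}" "t \<in> {1..Suc ?T}" "t - 1 \<in> {1..?T}"
      using t by auto
    have Q_lim: "(\<lambda>j. Q t (\<sigma> j) (fwd R (t - 1) (\<sigma> j))) \<longlonglongrightarrow> l t"
      using w_lim[OF t'(1)] t by (simp add: w_def)
    then have "(\<lambda>j. Qapp P R t (\<sigma> j) (fwd R (t - 1) (\<sigma> j))) \<longlonglongrightarrow> ereal (l t)"
      using \<sigma>_ge1 by (simp add: Qapp_eq_qapp)
    moreover have v_lim: "(\<lambda>j. val P t (fwd R (t - 1) (\<sigma> j))) \<longlonglongrightarrow> val P t (xs (t - 1))"
      using x_lim[OF t'(4)] by (intro val_tendsto[OF t'(2)] state_before \<sigma>_ge1 t'(3)) auto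
    moreover have "val P t (xs (t - 1)) - l t \<le> (\<Sum>\<tau>=t..?T. ?E \<tau>)"
    proof (rule limsup_le_subseq_limit[OF gap_limsup(1)[OF E t'(2)] top])
      show "(\<lambda>j. gap t (\<sigma> j)) \<longlonglongrightarrow> val P t (xs (t - 1)) - l t"
        unfolding gap_def by (intro tendsto_diff v_lim Q_lim)
    qed
    moreover have "l t \<le> val P t (xs (t - 1))"
      using gap_nonneg[OF \<sigma>_ge1 t'(2)] by (intro LIMSEQ_le[OF Q_lim v_lim]) (auto simp: gap_def)
    ultimately show ?thesis
      using tendsto_along_range[OF mono] value_fun_eq_val[OF t'(3)] x_lim(1)[OF t'(4)] by auto
  qed

  have first_lim: "(\<lambda>j. first_value (\<sigma> j)) \<longlonglongrightarrow> l 1"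
    using w_lim[OF T(1)] by (simp add: w_def)
  have val1: "value_fun P 1 (init P) = ereal (val P 1 (init P))"
    using value_fun_eq_val[of 1 "init P"] init_state by simp
  have "((\<lambda>k. Fapp P R 1 (k - 1) (fwd R 1 k) (init P)) \<longlongrightarrow> ereal (l 1)) (along (range \<sigma>))"
    by (rule tendsto_along_range[OF mono]) (use first_lim in \<open>simp only: first_value_Fapp[OF \<sigma>2] lim_ereal\<close>)
  moreover have "val P 1 (init P) - l 1 \<le> (\<Sum>\<tau>=2..?T. ?E \<tau>)"
  proof (rule limsup_le_subseq_limit[OF _ top])
    show "limsup_le (\<lambda>k. val P 1 (init P) - first_value k) (\<Sum>\<tau>=2..?T. ?E \<tau>)"
    proof (rule limsup_le_mono[OF gap_limsup(2)[OF E T(2)]])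
      show "\<forall>\<^sub>F k in sequentially. val P 1 (init P) - first_value k \<le> lag_gap 2 k"
        using eventually_ge_at_top[of 2] by eventually_elim (use first_value_bounds(1) in \<open>simp add: algebra_simps\<close>)
    qed
    show "(\<lambda>j. val P 1 (init P) - first_value (\<sigma> j)) \<longlonglongrightarrow> val P 1 (init P) - l 1"
      by (intro tendsto_diff tendsto_const first_lim)
  qed
  moreover have "l 1 \<le> val P 1 (init P) + ?E 1"
  proof (rule LIMSEQ_le_const2[OF first_lim], intro exI allI impI)
    fix j
    show "first_value (\<sigma> j) \<le> val P 1 (init P) + ?E 1"
      using first_value_bounds(2)[OF \<sigma>2] noise_bound[OF T(1) \<sigma>_ge1] noise_bound_le_Err[OF T(1)]
      by (meson add_left_mono order_trans)
  qed
  ultimately have first: "\<exists>l::real.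
      ((\<lambda>k. Fapp P R 1 (k - 1) (fwd R 1 k) (init P)) \<longlongrightarrow> ereal l) (along (range \<sigma>)) \<and>
      value_fun P 1 (init P) - ereal (\<Sum>\<tau>=2..?T. ?E \<tau>) \<le> ereal l \<and>
      ereal l \<le> value_fun P 1 (init P) + ereal (?E 1)"
    unfolding val1 by (intro exI[of _ "l 1"]) (simp add: algebra_simps del: One_nat_def)

  have "xs 0 = init P"
    by (simp add: xs_def)
  note path = limit_path[OF top \<sigma>_ge1 this x_lim(2) run_cost_limsup[OF E N]]
  have "(\<Sum>t=1..?T. (\<Sum>\<tau>=Suc t..?T. ?E \<tau>) + \<epsilon>bar t) \<le> (\<Sum>t=1..?T. \<Sum>\<tau>=t..?T. ?E \<tau>)"
    using noise_bound_le_Err by (intro sum_mono) (simp add: sum.atLeast_Suc_atMost add.commute)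
  also have "\<dots> = (\<Sum>\<tau>=1..?T. real \<tau> * ?E \<tau>)"
    by (rule sum_of_tail_sums)
  finally have cost: "total_cost P xs \<le> val P 1 (init P) + (\<Sum>\<tau>=1..?T. real \<tau> * ?E \<tau>)"
    using path(2) by simp
  show ?thesis
  proof (intro exI[of _ "range \<sigma>"] exI[of _ xs] conjI)
    show "infinite (range \<sigma>)"
      using mono by (intro range_inj_infinite strict_mono_imp_inj_on)
    show "range \<sigma> \<subseteq> {1..}"
      using \<sigma>_ge1 by auto
    show "\<forall>t\<in>{1..?T}. xs t \<in> state_set P t \<and> ((\<lambda>k. fwd R t k) \<longlongrightarrow> xs t) (along (range \<sigma>))"
      using x_lim tendsto_along_range[OF mono] by blast
    show "xs \<in> eps_solutions P (\<Sum>\<tau>=1..?T. real \<tau> * ?E \<tau>)"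
      by (rule eps_solutionI[OF path(1) cost])
    show "ereal (total_cost P xs) \<le> value_fun P 1 (init P) + ereal (\<Sum>\<tau>=1..?T. real \<tau> * ?E \<tau>)"
      using cost unfolding val1 by simp
  qed (use stage first in blast)+
qed

lemma vanishing_noise_limits:
  assumes noise: "\<And>t. t \<in> {1..horizon P} \<Longrightarrow> \<epsilon> t \<longlonglongrightarrow> 0"
  shows "\<forall>t\<in>{2..horizon P + 1}.
       (\<lambda>k. value_fun P t (fwd R (t - 1) k) - Qapp P R t k (fwd R (t - 1) k)) \<longlonglongrightarrow> 0"
    and "(\<lambda>k. Fapp P R 1 (k - 1) (fwd R 1 k) (init P)) \<longlonglongrightarrow> value_fun P 1 (init P)"
    and "\<lbrakk>xs 0 = init P; strict_mono \<sigma>; \<And>t. t \<in> {1..horizon P} \<Longrightarrow> (\<lambda>j. fwd R t (\<sigma> j)) \<longlonglongrightarrow> xs t\<rbrakk>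
       \<Longrightarrow> xs \<in> eps_solutions P 0"
proof -
  have E: "limsup_le (err t) 0" if t: "t \<in> {2..horizon P}" for t
  proof -
    have lim: "\<epsilon> t \<longlonglongrightarrow> 0"
      using noise t by simp
    then have "(\<lambda>k. \<epsilon> t k + (if typeS2 P t then \<epsilon> t k else 0)) \<longlonglongrightarrow> 0"
      by (cases "typeS2 P t") (auto intro: tendsto_add_zero)
    from limsup_le_add[OF limsup_le_of_tendsto[OF this] eta_vanishes[OF t lim]]
    show ?thesis
      by (simp add: err_def[abs_def])
  qed
  note gaps = gap_limsup[where E = "\<lambda>_. 0", OF E, simplified]
  have gap: "gap t \<longlonglongrightarrow> 0" if "t \<in> {2..Suc (horizon P)}" for t
    using that gaps(1) by (intro limsup_le_0_tendsto eventually_sequentiallyI[of 1] gap_nonneg) auto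
  have lag: "lag_gap 2 \<longlonglongrightarrow> 0"
  proof (rule limsup_le_0_tendsto)
    have 2: "2 \<in> {2..Suc (horizon P)}"
      using horizon_pos by auto
    show "limsup_le (lag_gap 2) 0"
      using 2 gaps(2) by simp
    show "\<forall>\<^sub>F k in sequentially. 0 \<le> lag_gap 2 k"
      using eventually_ge_at_top[of 2] by eventually_elim (rule lag_gap_nonneg[OF _ 2])
  qed

  show "\<forall>t\<in>{2..horizon P + 1}.
       (\<lambda>k. value_fun P t (fwd R (t - 1) k) - Qapp P R t k (fwd R (t - 1) k)) \<longlonglongrightarrow> 0"
  proof
    fix t assume "t \<in> {2..horizon P + 1}"
    then have t: "t \<in> {2..Suc (horizon P)}" "t \<in> {1..Suc (horizon P)}"
      by auto
    have "(\<lambda>k. ereal (gap t k)) \<longlonglongrightarrow> 0"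
      using gap[OF t(1)] by (simp add: zero_ereal_def)
    moreover have "\<forall>\<^sub>F k in sequentially. value_fun P t (fwd R (t - 1) k) - Qapp P R t k (fwd R (t - 1) k) = ereal (gap t k)"
      using eventually_ge_at_top[of 1]
    proof eventually_elim
      case (elim k)
      then show ?case
        using value_fun_eq_val[OF t(2) state_before[OF elim t(2)]] by (simp add: Qapp_eq_qapp gap_def)
    qed
    ultimately show "(\<lambda>k. value_fun P t (fwd R (t - 1) k) - Qapp P R t k (fwd R (t - 1) k)) \<longlonglongrightarrow> 0"
      using tendsto_cong by fastforce
  qed

  have "first_value \<longlonglongrightarrow> val P 1 (init P)"
  proof (rule tendsto_sandwich)
    show "\<forall>\<^sub>F k in sequentially. val P 1 (init P) - lag_gap 2 k \<le> first_value k"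
      using eventually_ge_at_top[of 2] by eventually_elim (rule first_value_bounds(1))
    show "\<forall>\<^sub>F k in sequentially. first_value k \<le> val P 1 (init P) + \<epsilon> 1 k"
      using eventually_ge_at_top[of 2] by eventually_elim (rule first_value_bounds(2))
    show "(\<lambda>k. val P 1 (init P) - lag_gap 2 k) \<longlonglongrightarrow> val P 1 (init P)"
      using tendsto_diff[OF tendsto_const lag, of "val P 1 (init P)"] by simp
    show "(\<lambda>k. val P 1 (init P) + \<epsilon> 1 k) \<longlonglongrightarrow> val P 1 (init P)"
      using tendsto_add[OF tendsto_const noise[of 1], of "val P 1 (init P)"] horizon_pos by simp
  qed
  then have "(\<lambda>k. ereal (first_value k)) \<longlonglongrightarrow> value_fun P 1 (init P)"
    using value_fun_eq_val[of 1 "init P"] init_state by simp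
  moreover have "\<forall>\<^sub>F k in sequentially. Fapp P R 1 (k - 1) (fwd R 1 k) (init P) = ereal (first_value k)"
    using eventually_ge_at_top[of 2] by eventually_elim (rule first_value_Fapp)
  ultimately show "(\<lambda>k. Fapp P R 1 (k - 1) (fwd R 1 k) (init P)) \<longlonglongrightarrow> value_fun P 1 (init P)"
    using tendsto_cong by fastforce

  show "xs \<in> eps_solutions P 0"
    if xs0: "xs 0 = init P" and \<sigma>: "strict_mono \<sigma>"
      and lim: "\<And>t. t \<in> {1..horizon P} \<Longrightarrow> (\<lambda>j. fwd R t (\<sigma> j)) \<longlonglongrightarrow> xs t"
  proof -
    \<comment> \<open>The index \<open>\<sigma> 0\<close> may be zero, which is not an iteration.\<close>
    have "strict_mono (\<lambda>j. \<sigma> (Suc j))"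
      using \<sigma> by (simp add: strict_mono_def)
    then have top: "filterlim (\<lambda>j. \<sigma> (Suc j)) at_top sequentially"
      by (rule filterlim_subseq)
    have ge1: "1 \<le> \<sigma> (Suc j)" for j
      using strict_mono_imp_increasing[OF \<sigma>, of "Suc j"] by simp
    have "limsup_le run_cost (val P 1 (init P) + (\<Sum>t=1..horizon P. (\<Sum>\<tau>=Suc t..horizon P. 0) + 0))"
      by (intro run_cost_limsup[where E = "\<lambda>_. 0" and N = "\<lambda>_. 0"] E limsup_le_of_tendsto noise)
    then have "limsup_le run_cost (val P 1 (init P))"
      by simp
    moreover have "(\<lambda>j. fwd R t (\<sigma> (Suc j))) \<longlonglongrightarrow> xs t" if "t \<in> {1..horizon P}" for t
      using LIMSEQ_Suc[OF lim[OF that]] .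
    ultimately show ?thesis
      using limit_path[where \<sigma> = "\<lambda>j. \<sigma> (Suc j)" and xs = xs, OF top ge1 xs0]
      by (intro eps_solutionI) auto
  qed
qed

end

theorem theorem4p7:
  fixes P :: "('n::finite, 'p::finite, 'q::finite) dp_problem"
    and R :: "('n, 'p, 'q) iddp_run"
    and \<epsilon> :: "nat \<Rightarrow> nat \<Rightarrow> real"
  assumes "1 \<le> horizon P" and "H1 P" and "H2 P" and "is_iddp_run P \<epsilon> R"
  shows
    "(\<forall>\<epsilon>bar C.
        (\<forall>t\<in>{1..horizon P}. \<forall>k\<ge>1. 0 \<le> \<epsilon> t k \<and> \<epsilon> t k \<le> \<epsilon>bar t) \<and> valid_consts P C \<longrightarrow>
        (\<exists>K xs. infinite K \<and> K \<subseteq> {1..} \<and>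
           (\<forall>t\<in>{1..horizon P}.
              xs t \<in> state_set P t \<and> ((\<lambda>k. fwd R t k) \<longlongrightarrow> xs t) (along K)) \<and>
           (\<forall>t\<in>{2..horizon P}. \<exists>l::real.
              ((\<lambda>k. Qapp P R t k (fwd R (t - 1) k)) \<longlongrightarrow> ereal l) (along K) \<and>
              value_fun P t (xs (t - 1)) - ereal (\<Sum>\<tau>=t..horizon P. Err P R C \<epsilon>bar \<tau>) \<le> ereal l \<and>
              ereal l \<le> value_fun P t (xs (t - 1))) \<and>
           (\<exists>l::real.
              ((\<lambda>k. Fapp P R 1 (k - 1) (fwd R 1 k) (init P)) \<longlongrightarrow> ereal l) (along K) \<and>
              value_fun P 1 (init P) - ereal (\<Sum>\<tau>=2..horizon P. Err P R C \<epsilon>bar \<tau>) \<le> ereal l \<and>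
              ereal l \<le> value_fun P 1 (init P) + ereal (Err P R C \<epsilon>bar 1)) \<and>
           xs \<in> eps_solutions P (\<Sum>\<tau>=1..horizon P. real \<tau> * Err P R C \<epsilon>bar \<tau>) \<and>
           ereal (total_cost P xs)
             \<le> value_fun P 1 (init P) + ereal (\<Sum>\<tau>=1..horizon P. real \<tau> * Err P R C \<epsilon>bar \<tau>)))
     \<and>
     ((\<forall>t\<in>{1..horizon P}. \<epsilon> t \<longlonglongrightarrow> 0) \<longrightarrow>
        (\<forall>t\<in>{2..horizon P + 1}.
           (\<lambda>k. value_fun P t (fwd R (t - 1) k) - Qapp P R t k (fwd R (t - 1) k)) \<longlonglongrightarrow> 0) \<and>
        (\<lambda>k. Fapp P R 1 (k - 1) (fwd R 1 k) (init P)) \<longlonglongrightarrow> value_fun P 1 (init P) \<and>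
        (\<forall>xs. xs 0 = init P \<and>
              (\<exists>\<sigma>. strict_mono \<sigma> \<and> (\<forall>t\<in>{1..horizon P}. (\<lambda>j. fwd R t (\<sigma> j)) \<longlonglongrightarrow> xs t)) \<longrightarrow>
              xs \<in> eps_solutions P 0))"
proof -
  interpret iddp P \<epsilon> R
    by unfold_locales (use assms in auto)
  show ?thesis
  proof (intro conjI[of "\<forall>\<epsilon>bar C. _ \<epsilon>bar C"] allI impI)
    fix \<epsilon>bar C
    assume "(\<forall>t\<in>{1..horizon P}. \<forall>k\<ge>1. 0 \<le> \<epsilon> t k \<and> \<epsilon> t k \<le> \<epsilon>bar t) \<and> valid_consts P C"
    then interpret bounded_iddp P \<epsilon> R C \<epsilon>bar
      by unfold_locales auto
    show "\<exists>K xs. infinite K \<and> K \<subseteq> {1..} \<and>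
           (\<forall>t\<in>{1..horizon P}.
              xs t \<in> state_set P t \<and> ((\<lambda>k. fwd R t k) \<longlongrightarrow> xs t) (along K)) \<and>
           (\<forall>t\<in>{2..horizon P}. \<exists>l::real.
              ((\<lambda>k. Qapp P R t k (fwd R (t - 1) k)) \<longlongrightarrow> ereal l) (along K) \<and>
              value_fun P t (xs (t - 1)) - ereal (\<Sum>\<tau>=t..horizon P. Err P R C \<epsilon>bar \<tau>) \<le> ereal l \<and>
              ereal l \<le> value_fun P t (xs (t - 1))) \<and>
           (\<exists>l::real.
              ((\<lambda>k. Fapp P R 1 (k - 1) (fwd R 1 k) (init P)) \<longlongrightarrow> ereal l) (along K) \<and>
              value_fun P 1 (init P) - ereal (\<Sum>\<tau>=2..horizon P. Err P R C \<epsilon>bar \<tau>) \<le> ereal l \<and>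
              ereal l \<le> value_fun P 1 (init P) + ereal (Err P R C \<epsilon>bar 1)) \<and>
           xs \<in> eps_solutions P (\<Sum>\<tau>=1..horizon P. real \<tau> * Err P R C \<epsilon>bar \<tau>) \<and>
           ereal (total_cost P xs)
             \<le> value_fun P 1 (init P) + ereal (\<Sum>\<tau>=1..horizon P. real \<tau> * Err P R C \<epsilon>bar \<tau>)"
      by (rule bounded_noise_limit)
  next
    assume noise: "\<forall>t\<in>{1..horizon P}. \<epsilon> t \<longlonglongrightarrow> 0"
    have "\<exists>B. \<forall>k. \<epsilon> t k \<le> B" if "t \<in> {1..horizon P}" for t
    proof -
      have "convergent (\<epsilon> t)"
        using noise that by (auto simp: convergent_def)
      then obtain B where "\<And>k. norm (\<epsilon> t k) \<le> B"
        using convergent_imp_Bseq BseqE by metis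
      then show ?thesis
        by (intro exI[of _ B]) (simp add: abs_le_iff)
    qed
    then obtain \<epsilon>bar where \<epsilon>bar: "\<And>t k. t \<in> {1..horizon P} \<Longrightarrow> \<epsilon> t k \<le> \<epsilon>bar t"
      by metis
    obtain C where "valid_consts P C"
      using valid_consts_exist by blast
    with \<epsilon>bar interpret bounded_iddp P \<epsilon> R C \<epsilon>bar
      by unfold_locales auto
    show "(\<forall>t\<in>{2..horizon P + 1}.
           (\<lambda>k. value_fun P t (fwd R (t - 1) k) - Qapp P R t k (fwd R (t - 1) k)) \<longlonglongrightarrow> 0) \<and>
        (\<lambda>k. Fapp P R 1 (k - 1) (fwd R 1 k) (init P)) \<longlonglongrightarrow> value_fun P 1 (init P) \<and>
        (\<forall>xs. xs 0 = init P \<and>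
              (\<exists>\<sigma>. strict_mono \<sigma> \<and> (\<forall>t\<in>{1..horizon P}. (\<lambda>j. fwd R t (\<sigma> j)) \<longlonglongrightarrow> xs t)) \<longrightarrow>
              xs \<in> eps_solutions P 0)"
      using vanishing_noise_limits noise by blast
  qed
qed

end
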